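(* Let $n$ and $r$ be positive integers. The number of even Sundaram tableaux (on the alphabet $1<\bar1<2<\bar2<\cdots<n<\bar n<\infty$) of height at most $n$ and width at most $r$ is $$2^{2n-1}\,\frac{(\frac12 r+\frac12)_n+(\frac12 r)_n}{n!}\prod_{i=1}^n\prod_{j=1}^{n-1}\frac{i+j+r-1}{i+j},$$ and the number of such tableaux of height exactly $n$ is $$2^{2n}\,\frac{(\frac12 r)_n}{n!}\prod_{i=1}^n\prod_{j=1}^{n-1}\frac{i+j+r-1}{i+j}.$$
   Context: An even Sundaram tableau is a filling of the Young diagram of a partition with letters from $1<\bar1<2<\bar2<\cdots<n<\bar n<\infty$ that is semi-standard (weakly increasing along rows, strictly increasing down columns), such that all entries in row $k$ are at least $\bar k$ in this order, with the exception that $\infty$ may occur multiple times in each column but at most once in each row. The empty tableau is included. Height is the number of rows and width the number of columns. $(a)_n=a(a+1)\cdots(a+n-1)$ is the Pochhammer symbol. *)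

theory Defs
  imports Complex_Main
begin

datatype letter = Plain nat | Barred nat | Infty

text \<open>The order is \<open>Plain 1 < Barred 1 < Plain 2 < Barred 2 < \<dots> < Infty\<close>: finite letters are
  compared via \<open>Plain i \<mapsto> 2 * i\<close>, \<open>Barred i \<mapsto> 2 * i + 1\<close>.\<close>

fun letter_le :: "letter \<Rightarrow> letter \<Rightarrow> bool" where
  "letter_le x Infty = True"
| "letter_le Infty (Plain j) = False"
| "letter_le Infty (Barred j) = False"
| "letter_le (Plain i) (Plain j) = (2 * i \<le> 2 * j)"
| "letter_le (Plain i) (Barred j) = (2 * i \<le> 2 * j + 1)"
| "letter_le (Barred i) (Plain j) = (2 * i + 1 \<le> 2 * j)"
| "letter_le (Barred i) (Barred j) = (2 * i + 1 \<le> 2 * j + 1)"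

instantiation letter :: linorder
begin

definition less_eq_letter :: "letter \<Rightarrow> letter \<Rightarrow> bool" where
  "x \<le> y \<longleftrightarrow> letter_le x y"

definition less_letter :: "letter \<Rightarrow> letter \<Rightarrow> bool" where
  "x < y \<longleftrightarrow> letter_le x y \<and> \<not> letter_le y x"

instance
proof
  fix x y z :: letter
  show "(x < y) = (x \<le> y \<and> \<not> y \<le> x)"
    by (simp add: less_eq_letter_def less_letter_def)
  show "x \<le> x"
    by (cases x) (auto simp: less_eq_letter_def)
  show "x \<le> z" if "x \<le> y" "y \<le> z"
    using that by (cases x; cases y; cases z) (auto simp: less_eq_letter_def)
  show "x = y" if "x \<le> y" "y \<le> x"
    using that by (cases x; cases y) (auto simp: less_eq_letter_def, presburger+)
  show "x \<le> y \<or> y \<le> x"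
    by (cases x; cases y) (auto simp: less_eq_letter_def)
qed

end

definition alphabet :: "nat \<Rightarrow> letter set" where
  "alphabet n = Plain ` {1..n} \<union> Barred ` {1..n} \<union> {Infty}"

text \<open>A filling of a Young diagram is the list of its rows, from top to bottom (English
  convention); the underlying partition is the list of row lengths.\<close>

definition young_filling :: "'a list list \<Rightarrow> bool" where
  "young_filling T \<longleftrightarrow> sorted_wrt (\<ge>) (map length T) \<and> (\<forall>row\<in>set T. row \<noteq> [])"

definition height :: "'a list list \<Rightarrow> nat" where
  "height T = length T"

definition width :: "'a list list \<Rightarrow> nat" where
  "width T = (case T of [] \<Rightarrow> 0 | row # _ \<Rightarrow> length row)"

text \<open>Indices of rows and columns start at 0, so the bound for row \<open>k\<close> is \<open>Barred (Suc k)\<close>.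
  The exceptional letter \<open>Infty\<close> may repeat down a column but not along a row.\<close>

definition even_sundaram_tableau :: "nat \<Rightarrow> letter list list \<Rightarrow> bool" where
  "even_sundaram_tableau n T \<longleftrightarrow>
     young_filling T \<and>
     (\<forall>row\<in>set T. set row \<subseteq> alphabet n) \<and>
     (\<forall>row\<in>set T. sorted row) \<and>
     (\<forall>row\<in>set T. count_list row Infty \<le> 1) \<and>
     (\<forall>k c. Suc k < length T \<and> c < length (T ! Suc k) \<longrightarrow>
        T ! k ! c < T ! Suc k ! c \<or> (T ! k ! c = Infty \<and> T ! Suc k ! c = Infty)) \<and>
     (\<forall>k < length T. \<forall>x\<in>set (T ! k). Barred (Suc k) \<le> x)"

end

theory Submission
  imports Defs "Jordan_Normal_Form.Determinant" "HOL-Computational_Algebra.Formal_Power_Series"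
begin

text \<open>
  The proof counts the tableaux of each shape and then sums the counts over the shapes in the box.

  \<^bold>\<open>Tableaux of a given shape.\<close> Write \<open>\<nu>\<close> for the shape, padded with zeros to \<open>n\<close> rows, with rows numbered
  from 0. Deleting the largest finite letter leaves a tableau whose shape interlaces with \<open>\<nu>\<close>, and the lower
  bound on the entries of a row limits which rows are nonempty after each letter: one more row with every
  barred letter, no new row with an unbarred one. Each part of the smaller shape runs through an interval
  of its own, so a determinant whose \<open>i\<close>-th row depends on the \<open>i\<close>-th part only is again such a determinant
  after the summation. Starting from the empty shape the counts are determinants of binomial
  coefficients \<open>(x + p) choose (2 p + 1)\<close> and \<open>(x + p) choose (2 p)\<close> in turn. Deleting \<open>Infty\<close>
  removes a vertical strip; there the rows for \<open>x = c\<close> and \<open>x = c - 1\<close> are added, and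
  \<open>((c + p) choose (2 p)) + ((c - 1 + p) choose (2 p))\<close> is a polynomial in the square of \<open>c\<close>. This turns the
  determinant into a Vandermonde product: with \<open>c\<^sub>i = \<nu> i + (n - 1 - i)\<close>, the number of tableaux of shape
  \<open>\<nu>\<close> is a constant times \<open>\<Prod>i<j. c\<^sub>i\<^sup>2 - c\<^sub>j\<^sup>2\<close>, the constant being halved if the last part is 0
  (lemma \<open>card_full_tableaux\<close>). The numbers \<open>c\<^sub>i\<close> form an arbitrary \<open>n\<close>-subset of \<open>{0..r + n - 1}\<close>, and the
  height is \<open>n\<close> exactly if 0 is not in it.

  \<^bold>\<open>Summing over shapes.\<close> It remains to sum the Vandermonde product of squares over the \<open>n\<close>-subsets of
  \<open>{1..M}\<close> and of \<open>{0..M}\<close>, with \<open>M = r + n - 1\<close>. As the product occurs to the first power, this is a discrete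
  Selberg integral of orthogonal type, usually treated by a Pfaffian and skew orthogonal polynomials. The
  Pfaffian can be avoided. Expand the Vandermonde product of a set \<open>A\<close> along an even polynomial \<open>g\<close> of degree
  \<open>2 (n - 1)\<close> and sum first over the point at which \<open>g\<close> is evaluated. If \<open>C\<close> is a primitive of \<open>g\<close> that vanishes
  at both ends of the range, the alternating sum over the gaps of the other points collapses to
  one of \<open>G x = C x + C (x - 1)\<close> over these points themselves. Now sum over one of these: if \<open>G\<close> is orthogonal
  to all even polynomials of degree less than \<open>2 (n - 2)\<close>, only a multiple of the sum over \<open>(n - 2)\<close>-subsets
  survives (lemma \<open>sq_vandermonde_sum_recursion\<close>).

  A suitable primitive is \<open>skew_primitive\<close>, a hypergeometric sum; its orthogonality reduces to partial
  fraction identities. The resulting two-step recursion in \<open>n\<close>, at fixed \<open>M\<close>, is the one that the product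
  formula satisfies. Both ranges are treated at once by means of a sign \<open>s\<close>, which is 1 for \<open>{1..M}\<close> and
  \<open>-1\<close> for \<open>{0..M}\<close>.
\<close>

section \<open>Vandermonde products of squares\<close>

text \<open>Compare the leading coefficients on both sides of the Lagrange interpolation formula. This identity serves
  three purposes below: the expansion of a Vandermonde product, the evaluation of determinants, and all
  partial fraction sums.\<close>

lemma lagrange_leading_coeff:
  fixes P :: "real poly" and X :: "real set"
  assumes fin: "finite X" and deg: "degree P < card X"
  shows "(\<Sum>x\<in>X. poly P x / (\<Prod>y\<in>X - {x}. x - y)) = coeff P (card X - 1)"
proof -
  define L where "L x = (\<Prod>y\<in>X - {x}. [:- y, 1:])" for x
  define Q where "Q = (\<Sum>x\<in>X. smult (poly P x / (\<Prod>y\<in>X - {x}. x - y)) (L x))"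
  have L_deg: "degree (L x) = card X - 1" and L_lead: "lead_coeff (L x) = 1" if "x \<in> X" for x
  proof -
    show "degree (L x) = card X - 1"
      unfolding L_def using that fin by (subst degree_prod_eq_sum_degree) auto
    show "lead_coeff (L x) = 1"
      unfolding L_def by (simp add: lead_coeff_prod)
  qed
  have "P = Q"
  proof (rule poly_eqI_degree[of X])
    fix z assume z: "z \<in> X"
    have "poly (L x) z = 0" if "x \<in> X" "x \<noteq> z" for x
      unfolding L_def poly_prod using that z fin by (auto intro!: prod_zero)
    then have "poly Q z = (\<Sum>x\<in>X. if x = z then poly P x else 0)"
      unfolding Q_def poly_sum using z fin
      by (intro sum.cong refl) (auto simp: L_def poly_prod prod_zero_iff)
    then show "poly P z = poly Q z" using z fin by simp
  next
    show "degree P < card X" by (fact deg)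
    have "degree Q \<le> card X - 1"
      unfolding Q_def by (intro degree_sum_le fin) (use L_deg degree_smult_le in force)
    then show "degree Q < card X" using deg by linarith
  qed
  then have "coeff P (card X - 1) = coeff Q (card X - 1)" by (rule arg_cong)
  also have "\<dots> = (\<Sum>x\<in>X. poly P x / (\<Prod>y\<in>X - {x}. x - y) * coeff (L x) (card X - 1))"
    unfolding Q_def coeff_sum coeff_smult ..
  also have "\<dots> = (\<Sum>x\<in>X. poly P x / (\<Prod>y\<in>X - {x}. x - y))"
    using L_deg L_lead by (intro sum.cong) auto
  finally show ?thesis ..
qed

definition sq_vandermonde :: "nat set \<Rightarrow> real" where
  "sq_vandermonde A = (\<Prod>b\<in>A. \<Prod>a\<in>{a \<in> A. a < b}. (real b)\<^sup>2 - (real a)\<^sup>2)"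

text \<open>The sign with which \<open>x\<close> enters a Vandermonde product: moving \<open>x\<close> past the larger elements of \<open>A\<close> reverses
  that many factors.\<close>

definition sign_above :: "nat \<Rightarrow> nat set \<Rightarrow> real" where
  "sign_above x A = (-1) ^ card {a \<in> A. x < a}"

lemma sign_above_sq [simp]: "sign_above x A * sign_above x A = 1"
  by (simp add: sign_above_def flip: power_mult_distrib)

lemma sign_above_remove [simp]: "sign_above x (A - {x}) = sign_above x A"
  unfolding sign_above_def by (rule arg_cong[of _ _ "\<lambda>B. (-1) ^ card B"]) auto

lemma sq_vandermonde_insert:
  assumes fin: "finite A" and x: "x \<notin> A"
  shows "sq_vandermonde (insert x A)
       = sq_vandermonde A * (sign_above x A * (\<Prod>a\<in>A. (real x)\<^sup>2 - (real a)\<^sup>2))"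
proof -
  let ?d = "\<lambda>b a. (real b)\<^sup>2 - (real a)\<^sup>2"
  have inner: "(\<Prod>a\<in>{a \<in> insert x A. a < b}. ?d b a)
      = (if x < b then ?d b x else 1) * (\<Prod>a\<in>{a \<in> A. a < b}. ?d b a)" if "b \<in> A" for b
  proof (cases "x < b")
    case True
    then have "{a \<in> insert x A. a < b} = insert x {a \<in> A. a < b}" by auto
    then show ?thesis using True x fin by simp
  next
    case False
    then have "{a \<in> insert x A. a < b} = {a \<in> A. a < b}" by auto
    then show ?thesis using False by simp
  qed
  have above: "(\<Prod>b\<in>A. if x < b then ?d b x else 1)
      = sign_above x A * (\<Prod>b\<in>{a \<in> A. x < a}. ?d x b)"
  proof -
    have "(\<Prod>b\<in>A. if x < b then ?d b x else 1) = (\<Prod>b\<in>{a \<in> A. x < a}. ?d b x)"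
      using fin by (simp add: prod.If_cases Int_def)
    also have "\<dots> = (\<Prod>b\<in>{a \<in> A. x < a}. (-1) * ?d x b)"
      by (intro prod.cong) auto
    finally show ?thesis unfolding sign_above_def by (simp only: prod.distrib prod_constant)
  qed
  have below: "{a \<in> insert x A. a < x} = {a \<in> A. a < x}" by auto
  have "sq_vandermonde (insert x A) = (\<Prod>a\<in>{a \<in> insert x A. a < x}. ?d x a) *
      (\<Prod>b\<in>A. \<Prod>a\<in>{a \<in> insert x A. a < b}. ?d b a)"
    unfolding sq_vandermonde_def using fin x by (rule prod.insert)
  also have "(\<Prod>b\<in>A. \<Prod>a\<in>{a \<in> insert x A. a < b}. ?d b a)
      = (\<Prod>b\<in>A. if x < b then ?d b x else 1) * sq_vandermonde A"
    unfolding sq_vandermonde_def by (subst prod.distrib [symmetric]) (rule prod.cong [OF refl inner])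
  finally have outer: "sq_vandermonde (insert x A)
      = (\<Prod>a\<in>{a \<in> A. a < x}. ?d x a) * ((\<Prod>b\<in>A. if x < b then ?d b x else 1) * sq_vandermonde A)"
    unfolding below .
  note outer
  also have "\<dots> = sq_vandermonde A * (sign_above x A *
      ((\<Prod>a\<in>{a \<in> A. a < x}. ?d x a) * (\<Prod>b\<in>{a \<in> A. x < a}. ?d x b)))"
    by (simp add: above)
  also have "(\<Prod>a\<in>{a \<in> A. a < x}. ?d x a) * (\<Prod>b\<in>{a \<in> A. x < a}. ?d x b) = (\<Prod>a\<in>A. ?d x a)"
  proof -
    have "A = {a \<in> A. a < x} \<union> {a \<in> A. x < a}" using x by (auto simp: not_less_iff_gr_or_eq)
    then show ?thesis using fin by (metis (no_types, lifting) prod.union_disjoint[of "{a \<in> A. a < x}" "{a \<in> A. x < a}"] finite_Un disjoint_iff mem_Collect_eq less_asym)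
  qed
  finally show ?thesis .
qed

lemma sq_vandermonde_empty [simp]: "sq_vandermonde {} = 1"
  and sq_vandermonde_singleton [simp]: "sq_vandermonde {x} = 1"
proof -
  show *: "sq_vandermonde {} = 1" by (simp add: sq_vandermonde_def)
  show "sq_vandermonde {x} = 1"
    using sq_vandermonde_insert[of "{}" x] by (simp add: * sign_above_def)
qed

text \<open>The analogue of the Laplace expansion of a determinant along the column of values of \<open>P\<close>: after division
  by the Vandermonde product it is Lagrange interpolation at the squares of the elements of \<open>A\<close>.\<close>

lemma sq_vandermonde_expand:
  fixes P :: "real poly"
  assumes fin: "finite A" and deg: "degree P < card A"
  shows "(\<Sum>x\<in>A. sign_above x A * poly P ((real x)\<^sup>2) * sq_vandermonde (A - {x}))
       = coeff P (card A - 1) * sq_vandermonde A"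
proof -
  let ?sq = "\<lambda>x::nat. (real x)\<^sup>2"
  have inj: "inj_on ?sq B" for B by (auto simp: inj_on_def)
  have "sign_above x A * poly P (?sq x) * sq_vandermonde (A - {x})
      = poly P (?sq x) / (\<Prod>y\<in>?sq ` A - {?sq x}. ?sq x - y) * sq_vandermonde A" if x: "x \<in> A" for x
  proof -
    have img: "?sq ` A - {?sq x} = ?sq ` (A - {x})" using x by (auto simp: inj_on_def)
    let ?\<Pi> = "\<Prod>a\<in>A - {x}. ?sq x - ?sq a"
    have nz: "?\<Pi> \<noteq> 0" using fin by auto
    have "sq_vandermonde A = sq_vandermonde (A - {x}) * (sign_above x A * ?\<Pi>)"
      using sq_vandermonde_insert[of "A - {x}" x] fin x by (simp add: insert_absorb)
    then have "sign_above x A * sq_vandermonde A = (sign_above x A * sign_above x A) * (sq_vandermonde (A - {x}) * ?\<Pi>)"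
      by (simp only: ac_simps)
    then have "sq_vandermonde (A - {x}) = sign_above x A * sq_vandermonde A / ?\<Pi>"
      using nz by (simp add: field_simps)
    then have "sign_above x A * poly P (?sq x) * sq_vandermonde (A - {x})
        = (sign_above x A * sign_above x A) * (poly P (?sq x) / ?\<Pi> * sq_vandermonde A)"
      by simp
    also have "\<dots> = poly P (?sq x) / (\<Prod>y\<in>?sq ` A - {?sq x}. ?sq x - y) * sq_vandermonde A"
      unfolding img by (simp add: prod.reindex[OF inj])
    finally show ?thesis .
  qed
  then have "(\<Sum>x\<in>A. sign_above x A * poly P (?sq x) * sq_vandermonde (A - {x}))
      = (\<Sum>x\<in>?sq ` A. poly P x / (\<Prod>y\<in>?sq ` A - {x}. x - y)) * sq_vandermonde A"
    by (simp add: sum.reindex[OF inj] sum_distrib_right)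
  also have "\<dots> = coeff P (card A - 1) * sq_vandermonde A"
    using lagrange_leading_coeff[of "?sq ` A" P] fin deg by (simp add: card_image[OF inj])
  finally show ?thesis .
qed

text \<open>The sign is constant on each gap of \<open>B\<close> and changes at each element of \<open>B\<close>, so the left side telescopes within
  the gaps and only boundary terms at the elements of \<open>B\<close> are left. The primitive \<open>C\<close> takes integer arguments because
  it is evaluated at \<open>lo - 1\<close>, possibly \<open>-1\<close>.\<close>

lemma alternating_gap_sum:
  fixes C :: "int \<Rightarrow> real"
  assumes B: "B \<subseteq> {lo..M}" and lo: "lo \<le> M" and ends: "C (int lo - 1) = 0" "C (int M) = 0"
  shows "(\<Sum>x\<in>{lo..M} - B. sign_above x B * (C (int x) - C (int x - 1)))
       = - (\<Sum>x\<in>B. sign_above x B * (C (int x) + C (int x - 1)))"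
proof -
  define s :: "nat \<Rightarrow> real" where "s x = (-1) ^ card {b \<in> B. x \<le> b}" for x
  have finB: "finite B" using B finite_subset by blast
  have s_Suc: "s (Suc x) = sign_above x B" for x
    by (simp add: s_def sign_above_def Suc_le_eq)
  have s_out: "s x = sign_above x B" if "x \<notin> B" for x
  proof -
    have "{b \<in> B. x \<le> b} = {b \<in> B. x < b}" using that by (auto simp: le_less)
    then show ?thesis by (simp add: s_def sign_above_def)
  qed
  have s_in: "s x = - sign_above x B" if "x \<in> B" for x
  proof -
    have "{b \<in> B. x \<le> b} = insert x {b \<in> B. x < b}" using that by auto
    then show ?thesis using finB by (simp add: s_def sign_above_def)
  qed
  define F where "F x = s x * C (int x - 1)" for x
  \<comment> \<open>Outside \<open>B\<close> the sign stays the same from \<open>x\<close> to \<open>Suc x\<close>; on \<open>B\<close> it flips, which turns the difference into a sum.\<close>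
  have step: "F (Suc x) - F x = sign_above x B * (if x \<in> B then C (int x) + C (int x - 1)
      else C (int x) - C (int x - 1))" for x
    by (auto simp: F_def s_Suc s_out s_in algebra_simps)
  have "(\<Sum>x\<in>{lo..M}. F (Suc x) - F x) = F (Suc M) - F lo"
    using lo by (intro sum_Suc_diff) auto
  also have "\<dots> = 0" using ends by (simp add: F_def)
  finally have "0 = (\<Sum>x\<in>{lo..M} - B. F (Suc x) - F x) + (\<Sum>x\<in>B. F (Suc x) - F x)"
    using B by (simp add: sum.subset_diff)
  then show ?thesis unfolding step by simp
qed

section \<open>The two-step recursion for sums of Vandermonde products\<close>

definition sq_vandermonde_sum :: "nat \<Rightarrow> nat \<Rightarrow> nat \<Rightarrow> real" where
  "sq_vandermonde_sum lo M n = (\<Sum>A | A \<subseteq> {lo..M} \<and> card A = n. sq_vandermonde A)"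

lemma sum_delete_element:
  fixes f :: "'a \<Rightarrow> 'a set \<Rightarrow> 'b :: comm_monoid_add"
  assumes fin: "finite I"
  shows "(\<Sum>A | A \<subseteq> I \<and> card A = Suc n. \<Sum>x\<in>A. f x (A - {x}))
       = (\<Sum>B | B \<subseteq> I \<and> card B = n. \<Sum>x\<in>I - B. f x B)"
proof -
  have finS: "finite {A. A \<subseteq> I \<and> card A = m}" for m
    using fin by (rule_tac finite_subset[of _ "Pow I"]) auto
  have finE: "finite A" if "A \<subseteq> I" for A using that fin finite_subset by blast
  have "(\<Sum>A | A \<subseteq> I \<and> card A = Suc n. \<Sum>x\<in>A. f x (A - {x}))
      = (\<Sum>(A, x)\<in>(SIGMA A:{A. A \<subseteq> I \<and> card A = Suc n}. A). f x (A - {x}))"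
    using finS finE by (subst sum.Sigma) auto
  also have "\<dots> = (\<Sum>(B, x)\<in>(SIGMA B:{B. B \<subseteq> I \<and> card B = n}. I - B). f x B)"
    by (rule sum.reindex_bij_witness[of _ "\<lambda>(B, x). (insert x B, x)" "\<lambda>(A, x). (A - {x}, x)"])
       (auto simp: finE insert_absorb)
  also have "\<dots> = (\<Sum>B | B \<subseteq> I \<and> card B = n. \<Sum>x\<in>I - B. f x B)"
    using finS fin by (subst sum.Sigma) auto
  finally show ?thesis .
qed

text \<open>Expanding along \<open>P\<close> removes one point \<open>x\<close> of the set; summing over \<open>x\<close> replaces differences of \<open>C\<close> at the removed
  point by sums of \<open>C\<close> at the remaining points. Removing in turn the point at which the sum is taken cancels the
  sign and leaves the monic polynomial with roots at the squares of the other points, of which the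
  moment condition sees the leading coefficient only.\<close>

lemma sq_vandermonde_sum_recursion:
  fixes C :: "int \<Rightarrow> real" and P :: "real poly"
  assumes lo: "lo \<le> M"
    and ends: "C (int lo - 1) = 0" "C (int M) = 0"
    and P: "degree P \<le> Suc m" "\<And>x. x \<in> {lo..M} \<Longrightarrow> poly P ((real x)\<^sup>2) = C (int x) - C (int x - 1)"
    and moments: "\<And>R. degree R \<le> m \<Longrightarrow>
      (\<Sum>x\<in>{lo..M}. (C (int x) + C (int x - 1)) * poly R ((real x)\<^sup>2)) = coeff R m * \<nu>"
  shows "coeff P (Suc m) * sq_vandermonde_sum lo M (Suc (Suc m)) = - \<nu> * sq_vandermonde_sum lo M m"
proof -
  let ?I = "{lo..M}" and ?sq = "\<lambda>x::nat. (real x)\<^sup>2"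
  let ?g = "\<lambda>x::nat. C (int x) - C (int x - 1)" and ?G = "\<lambda>x::nat. C (int x) + C (int x - 1)"
  let ?\<Pi> = "\<lambda>D x. \<Prod>a\<in>D. ?sq x - ?sq a"
  have fin: "finite A" if "A \<subseteq> ?I" for A using that finite_subset by blast
  have "coeff P (Suc m) * sq_vandermonde_sum lo M (Suc (Suc m))
      = (\<Sum>A | A \<subseteq> ?I \<and> card A = Suc (Suc m). \<Sum>x\<in>A.
           sign_above x (A - {x}) * ?g x * sq_vandermonde (A - {x}))"
    unfolding sq_vandermonde_sum_def sum_distrib_left
  proof (intro sum.cong refl)
    fix A assume "A \<in> {A. A \<subseteq> ?I \<and> card A = Suc (Suc m)}"
    then have A: "A \<subseteq> ?I" "card A = Suc (Suc m)" by auto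
    have "coeff P (Suc m) * sq_vandermonde A
        = (\<Sum>x\<in>A. sign_above x A * poly P (?sq x) * sq_vandermonde (A - {x}))"
      using sq_vandermonde_expand[OF fin[OF A(1)], of P] P(1) A(2) by simp
    also have "\<dots> = (\<Sum>x\<in>A. sign_above x (A - {x}) * ?g x * sq_vandermonde (A - {x}))"
      using A(1) by (intro sum.cong refl) (auto simp: P(2))
    finally show "coeff P (Suc m) * sq_vandermonde A = \<dots>" .
  qed
  also have "\<dots> = (\<Sum>B | B \<subseteq> ?I \<and> card B = Suc m. \<Sum>x\<in>?I - B. sign_above x B * ?g x * sq_vandermonde B)"
    by (rule sum_delete_element) simp
  also have "\<dots> = (\<Sum>B | B \<subseteq> ?I \<and> card B = Suc m. - (\<Sum>x\<in>B. sign_above x B * ?G x * sq_vandermonde B))"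
  proof (intro sum.cong refl)
    fix B assume "B \<in> {B. B \<subseteq> ?I \<and> card B = Suc m}"
    then have B: "B \<subseteq> ?I" by auto
    show "(\<Sum>x\<in>?I - B. sign_above x B * ?g x * sq_vandermonde B)
        = - (\<Sum>x\<in>B. sign_above x B * ?G x * sq_vandermonde B)"
      using alternating_gap_sum[where C = C, OF B lo ends] by (simp flip: sum_distrib_right)
  qed
  also have "\<dots> = - (\<Sum>B | B \<subseteq> ?I \<and> card B = Suc m. \<Sum>x\<in>B. ?G x * sq_vandermonde (B - {x}) * ?\<Pi> (B - {x}) x)"
    unfolding sum_negf
  proof (intro arg_cong[of _ _ uminus] sum.cong refl)
    fix B x assume "B \<in> {B. B \<subseteq> ?I \<and> card B = Suc m}" and x: "x \<in> B"
    then have finB: "finite B" using fin by auto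
    have "sq_vandermonde B = sq_vandermonde (B - {x}) * (sign_above x B * ?\<Pi> (B - {x}) x)"
      using sq_vandermonde_insert[of "B - {x}" x] finB x by (simp add: insert_absorb)
    then have "sign_above x B * ?G x * sq_vandermonde B
        = (sign_above x B * sign_above x B) * (?G x * sq_vandermonde (B - {x}) * ?\<Pi> (B - {x}) x)"
      by (simp only: ac_simps)
    then show "sign_above x B * ?G x * sq_vandermonde B
        = ?G x * sq_vandermonde (B - {x}) * ?\<Pi> (B - {x}) x" by simp
  qed
  also have "(\<Sum>B | B \<subseteq> ?I \<and> card B = Suc m. \<Sum>x\<in>B. ?G x * sq_vandermonde (B - {x}) * ?\<Pi> (B - {x}) x)
      = (\<Sum>D | D \<subseteq> ?I \<and> card D = m. \<Sum>x\<in>?I - D. ?G x * sq_vandermonde D * ?\<Pi> D x)"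
    by (rule sum_delete_element) simp
  also have "\<dots> = (\<Sum>D | D \<subseteq> ?I \<and> card D = m. \<nu> * sq_vandermonde D)"
  proof (intro sum.cong refl)
    fix D assume "D \<in> {D. D \<subseteq> ?I \<and> card D = m}"
    then have D: "D \<subseteq> ?I" "card D = m" by auto
    define R where "R = (\<Prod>a\<in>D. [:- ?sq a, 1:])"
    have R_deg: "degree R = m" unfolding R_def using D fin by (subst degree_prod_eq_sum_degree) auto
    have "lead_coeff R = 1" unfolding R_def by (simp add: lead_coeff_prod)
    then have R: "degree R \<le> m" "coeff R m = 1" using R_deg by auto
    have R_eval: "poly R (?sq x) = ?\<Pi> D x" for x unfolding R_def poly_prod by simp
    \<comment> \<open>The product vanishes on \<open>D\<close>, so the sum may run over the whole range, as the moment condition requires.\<close>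
    have "(\<Sum>x\<in>?I - D. ?G x * sq_vandermonde D * ?\<Pi> D x) = (\<Sum>x\<in>?I. ?G x * sq_vandermonde D * ?\<Pi> D x)"
      using fin[OF D(1)] by (intro sum.mono_neutral_left) (auto simp: prod_zero_iff)
    also have "\<dots> = sq_vandermonde D * (\<Sum>x\<in>?I. ?G x * poly R (?sq x))"
      unfolding R_eval sum_distrib_left by (simp only: ac_simps)
    finally show "(\<Sum>x\<in>?I - D. ?G x * sq_vandermonde D * ?\<Pi> D x) = \<nu> * sq_vandermonde D"
      using moments[OF R(1)] R(2) by simp
  qed
  finally show ?thesis by (simp add: sq_vandermonde_sum_def sum_distrib_left sum_negf)
qed

section \<open>Partial fractions and moments\<close>

definition rising_poly :: "real \<Rightarrow> nat \<Rightarrow> real poly" where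
  "rising_poly s m = (\<Prod>i<m. [:s + real i, 1:])"

lemma poly_rising_poly: "poly (rising_poly s m) x = pochhammer (x + s) m"
  unfolding rising_poly_def poly_prod pochhammer_prod
  by (simp add: lessThan_atLeast0 add_ac)

lemma degree_rising_poly: "degree (rising_poly s m) = m"
  unfolding rising_poly_def by (subst degree_prod_eq_sum_degree) auto

lemma fact_add_pochhammer: "fact (m + k) = fact m * (pochhammer (real m + 1) k :: real)"
  using pochhammer_product'[of "1 :: real" m k] by (simp add: pochhammer_fact add.commute)

text \<open>Lagrange interpolation with the nodes \<open>0, \<dots>, N\<close> and the pole \<open>-\<alpha>\<close>. For a polynomial of degree at most \<open>N\<close> only the
  residue is left.\<close>

lemma partial_fraction_sum:
  fixes p :: "real poly"
  assumes deg: "degree p \<le> Suc N" and \<alpha>: "\<And>i. i \<le> N \<Longrightarrow> \<alpha> + real i \<noteq> 0"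
  shows "(\<Sum>j\<le>N. (-1) ^ j / (fact j * fact (N - j)) * (poly p (real j) / (real j + \<alpha>)))
       = poly p (- \<alpha>) / pochhammer \<alpha> (Suc N) + (-1) ^ N * coeff p (Suc N)"
proof -
  define J where "J = real ` {..N}"
  have inj: "inj_on real A" for A by (simp add: inj_on_def)
  have notin: "- \<alpha> \<notin> J"
  proof
    assume "- \<alpha> \<in> J"
    then obtain i where "i \<le> N" "- \<alpha> = real i" by (auto simp: J_def)
    then show False using \<alpha>[of i] by simp
  qed
  have finJ: "finite J" and cardJ: "card J = Suc N" by (auto simp: J_def card_image)
  have node: "(\<Prod>y\<in>J - {real j}. real j - y) = (-1) ^ (N - j) * fact j * fact (N - j)" if j: "j \<le> N" for j
  proof -
    have "J - {real j} = real ` ({..<j} \<union> {Suc j..N})"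
      using j by (auto simp: J_def)
    then have "(\<Prod>y\<in>J - {real j}. real j - y) = (\<Prod>i\<in>{..<j} \<union> {Suc j..N}. real j - real i)"
      by (simp add: prod.reindex[OF inj])
    also have "\<dots> = (\<Prod>i<j. real j - real i) * (\<Prod>i\<in>{Suc j..N}. real j - real i)"
      by (rule prod.union_disjoint) auto
    also have "(\<Prod>i<j. real j - real i) = fact j"
    proof -
      have "(\<Prod>i<j. real j - real i) = (\<Prod>i<j. real (Suc i))"
        by (rule prod.reindex_bij_witness[of _ "\<lambda>i. j - Suc i" "\<lambda>i. j - Suc i"]) (auto simp: of_nat_diff)
      then show ?thesis by (simp add: fact_prod_Suc lessThan_atLeast0)
    qed
    also have "(\<Prod>i\<in>{Suc j..N}. real j - real i) = (\<Prod>i<N - j. (-1) * real (Suc i))"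
      by (rule prod.reindex_bij_witness[of _ "\<lambda>i. j + Suc i" "\<lambda>i. i - Suc j"]) (use j in \<open>auto simp: of_nat_diff\<close>)
    also have "\<dots> = (-1) ^ (N - j) * fact (N - j)"
      unfolding prod.distrib by (simp add: fact_prod_Suc lessThan_atLeast0)
    finally show ?thesis by simp
  qed
  have "(\<Prod>y\<in>J. - \<alpha> - y) = (\<Prod>i\<le>N. (-1) * (\<alpha> + real i))"
    unfolding J_def by (simp add: prod.reindex[OF inj])
  also have "\<dots> = (-1) ^ Suc N * pochhammer \<alpha> (Suc N)"
    unfolding prod.distrib pochhammer_prod by (simp add: atLeast0LessThan lessThan_Suc_atMost)
  finally have pole: "(\<Prod>y\<in>J. - \<alpha> - y) = (-1) ^ Suc N * pochhammer \<alpha> (Suc N)" .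
  have "coeff p (Suc N) = (\<Sum>x\<in>insert (- \<alpha>) J. poly p x / (\<Prod>y\<in>insert (- \<alpha>) J - {x}. x - y))"
    using lagrange_leading_coeff[of "insert (- \<alpha>) J" p] finJ notin cardJ deg by simp
  also have "\<dots> = poly p (- \<alpha>) / (\<Prod>y\<in>J. - \<alpha> - y)
      + (\<Sum>x\<in>J. poly p x / (\<Prod>y\<in>insert (- \<alpha>) J - {x}. x - y))"
    using finJ notin by simp
  also have "(\<Sum>x\<in>J. poly p x / (\<Prod>y\<in>insert (- \<alpha>) J - {x}. x - y))
      = (\<Sum>j\<le>N. (-1) ^ N * ((-1) ^ j / (fact j * fact (N - j)) * (poly p (real j) / (real j + \<alpha>))))"
    unfolding J_def sum.reindex[OF inj] o_def
  proof (intro sum.cong refl)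
    fix j assume "j \<in> {..N}"
    then have j: "j \<le> N" by simp
    have "insert (- \<alpha>) J - {real j} = insert (- \<alpha>) (J - {real j})" using notin j by (auto simp: J_def)
    then have "(\<Prod>y\<in>insert (- \<alpha>) J - {real j}. real j - y) = (real j + \<alpha>) * ((-1) ^ (N - j) * fact j * fact (N - j))"
      using notin finJ node[OF j] by simp
    moreover have "(-1 :: real) ^ (N - j) = (-1) ^ N * (-1) ^ j"
      using j by (cases "even N"; cases "even j") simp_all
    ultimately show "poly p (real j) / (\<Prod>y\<in>insert (- \<alpha>) (real ` {..N}) - {real j}. real j - y)
        = (-1) ^ N * ((-1) ^ j / (fact j * fact (N - j)) * (poly p (real j) / (real j + \<alpha>)))"
      unfolding J_def[symmetric] by (cases "even N"; cases "even j") simp_all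
  qed
  finally have "coeff p (Suc N) = poly p (- \<alpha>) / ((-1) ^ Suc N * pochhammer \<alpha> (Suc N))
      + (-1) ^ N * (\<Sum>j\<le>N. (-1) ^ j / (fact j * fact (N - j)) * (poly p (real j) / (real j + \<alpha>)))"
    unfolding pole sum_distrib_left .
  then have "(-1) ^ N * coeff p (Suc N) = - (poly p (- \<alpha>) / pochhammer \<alpha> (Suc N))
      + (\<Sum>j\<le>N. (-1) ^ j / (fact j * fact (N - j)) * (poly p (real j) / (real j + \<alpha>)))"
    by (cases "even N") (auto simp: field_simps)
  then show ?thesis by simp
qed

text \<open>The difference of two instances of the one-pole formula, in which the leading coefficients cancel.\<close>

lemma two_pole_sum:
  fixes p :: "real poly"
  assumes deg: "degree p \<le> Suc N" and \<alpha>: "\<And>i. i \<le> N \<Longrightarrow> \<alpha> + real i \<noteq> 0"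
    and \<beta>: "\<And>i. i \<le> N \<Longrightarrow> \<beta> + real i \<noteq> 0" and ne: "\<alpha> \<noteq> \<beta>"
  shows "(\<Sum>j\<le>N. (-1) ^ j / (fact j * fact (N - j)) * (poly p (real j) / ((real j + \<alpha>) * (real j + \<beta>))))
       = (poly p (- \<alpha>) / pochhammer \<alpha> (Suc N) - poly p (- \<beta>) / pochhammer \<beta> (Suc N)) / (\<beta> - \<alpha>)"
proof -
  let ?w = "\<lambda>j. (-1) ^ j / (fact j * fact (N - j)) :: real"
  have "(\<beta> - \<alpha>) * (\<Sum>j\<le>N. ?w j * (poly p (real j) / ((real j + \<alpha>) * (real j + \<beta>))))
      = (\<Sum>j\<le>N. ?w j * (poly p (real j) / (real j + \<alpha>))) - (\<Sum>j\<le>N. ?w j * (poly p (real j) / (real j + \<beta>)))"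
    unfolding sum_distrib_left sum_subtractf[symmetric]
  proof (intro sum.cong refl)
    fix j assume "j \<in> {..N}"
    then have "real j + \<alpha> \<noteq> 0" "real j + \<beta> \<noteq> 0" using \<alpha>[of j] \<beta>[of j] by (auto simp: add.commute)
    then have pf: "(\<beta> - \<alpha>) * (poly p (real j) / ((real j + \<alpha>) * (real j + \<beta>)))
        = poly p (real j) / (real j + \<alpha>) - poly p (real j) / (real j + \<beta>)"
      by (simp add: field_simps)
    show "(\<beta> - \<alpha>) * (?w j * (poly p (real j) / ((real j + \<alpha>) * (real j + \<beta>))))
        = ?w j * (poly p (real j) / (real j + \<alpha>)) - ?w j * (poly p (real j) / (real j + \<beta>))"
      by (subst mult.left_commute) (simp only: pf right_diff_distrib)
  qed
  also have "\<dots> = poly p (- \<alpha>) / pochhammer \<alpha> (Suc N) - poly p (- \<beta>) / pochhammer \<beta> (Suc N)"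
    using partial_fraction_sum[OF deg \<alpha>] partial_fraction_sum[OF deg \<beta>] by simp
  finally show ?thesis
    using ne by (subst nonzero_eq_divide_eq) (simp_all only: mult.commute right_minus_eq not_sym)
qed

text \<open>Central factorial polynomials. With \<open>y\<close> a half-integer, \<open>y * half_factorial j y\<close> is an odd polynomial whose central
  difference is again a product of linear factors (\<open>half_factorial_diff\<close>), which makes it a convenient basis for
  odd primitives of even polynomials.\<close>

definition half_factorial :: "nat \<Rightarrow> real \<Rightarrow> real" where
  "half_factorial j y = (\<Prod>i<j. y\<^sup>2 - (real i + 1/2)\<^sup>2)"

text \<open>Test functions built from the upper end \<open>E = M + 1/2\<close> of the range. Multiplied with \<open>y * half_factorial j y\<close> they give a
  discrete analogue of a beta density, so that the mixed moments factor.\<close>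

definition top_factorial :: "real \<Rightarrow> nat \<Rightarrow> real \<Rightarrow> real" where
  "top_factorial E k y = (\<Prod>i<k. (E + 1 + real i)\<^sup>2 - y\<^sup>2)"

lemma half_factorial_pochhammer: "half_factorial j (x + 1/2) = pochhammer (x + 1 - real j) (2 * j)"
proof (induction j)
  case (Suc j)
  have "pochhammer (x + 1 - real (Suc j)) (2 * Suc j) = (x - real j) * pochhammer (x + 1 - real j) (Suc (2 * j))"
    by (simp add: pochhammer_rec algebra_simps)
  also have "\<dots> = (x - real j) * (pochhammer (x + 1 - real j) (2 * j) * (x + 1 + real j))"
    by (simp add: pochhammer_rec' algebra_simps)
  finally show ?case using Suc by (simp add: half_factorial_def power2_eq_square algebra_simps)
qed (simp add: half_factorial_def)

text \<open>Telescoping: the summand is a difference of products of consecutive factors.\<close>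

lemma moment_base:
  "(\<Sum>a\<le>M. (2 * real a + 1) * half_factorial j (real a + 1/2))
     = (real M + 1) * pochhammer (real M + 1 - real j) (2 * j + 1) / (real j + 1)"
proof -
  define B where "B m = real m * pochhammer (real m - real j) (2 * j + 1)" for m :: nat
  have step: "B (Suc m) - B m = (real j + 1) * ((2 * real m + 1) * half_factorial j (real m + 1/2))" for m
  proof -
    have e1: "pochhammer (real (Suc m) - real j) (2 * j + 1) = pochhammer (real m + 1 - real j) (2 * j) * (real m + 1 + real j)"
      by (simp add: pochhammer_rec' algebra_simps)
    have e2: "pochhammer (real m - real j) (2 * j + 1) = (real m - real j) * pochhammer (real m + 1 - real j) (2 * j)"
      by (simp add: pochhammer_rec algebra_simps)
    show ?thesis
      unfolding half_factorial_pochhammer B_def e1 e2 by (simp add: algebra_simps)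
  qed
  have "(real j + 1) * (\<Sum>a\<le>M. (2 * real a + 1) * half_factorial j (real a + 1/2)) = (\<Sum>a\<le>M. B (Suc a) - B a)"
    unfolding sum_distrib_left step ..
  also have "\<dots> = B (Suc M) - B 0" by (induction M) auto
  finally show ?thesis by (simp add: B_def field_simps)
qed

text \<open>A discrete beta integral. In the induction the new factor of \<open>top_factorial\<close> is written as a constant minus the
  next factor of \<open>half_factorial\<close>.\<close>

lemma moment_odd:
  "(\<Sum>a\<le>M. (2 * real a + 1) * half_factorial j (real a + 1/2) * top_factorial (real M + 1/2) k (real a + 1/2))
     = fact j * fact k / fact (j + k + 1)
       * pochhammer (real M + 1 - real j) (2 * j + k + 1) * pochhammer (real M + 1) (k + 1)"
proof (induction k arbitrary: j)
  case 0
  have "fact j * fact 0 / fact (j + 0 + 1) = 1 / (real j + 1)" by (simp add: divide_simps)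
  moreover have "pochhammer (real M + 1) (0 + 1) = real M + 1" by simp
  moreover have "top_factorial (real M + 1/2) 0 y = 1" for y by (simp add: top_factorial_def)
  ultimately show ?case using moment_base[where M = M and j = j] by (simp only: mult_1_right add_0_right) simp
next
  case (Suc k)
  let ?X = "\<lambda>j k. \<Sum>a\<le>M. (2 * real a + 1) * half_factorial j (real a + 1/2) * top_factorial (real M + 1/2) k (real a + 1/2)"
  let ?p = "pochhammer (real M + 1 - real j) (2 * j + k + 1)" and ?q = "pochhammer (real M + 1) (k + 1)"
  have "?X j (Suc k) = (real M + 1 + real k - real j) * (real M + real k + real j + 2) * ?X j k - ?X (Suc j) k"
    unfolding sum_distrib_left sum_subtractf[symmetric]
    by (intro sum.cong refl) (simp add: top_factorial_def half_factorial_def power2_eq_square algebra_simps)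
  also have "?X (Suc j) k = fact (Suc j) * fact k / fact (j + k + 2) * ((real M - real j) * ?p * (real M + real j + real k + 2)) * ?q"
  proof -
    have "pochhammer (real M + 1 - real (Suc j)) (2 * Suc j + k + 1) = (real M - real j) * pochhammer (real M + 1 - real j) (Suc (2 * j + k + 1))"
      by (simp add: pochhammer_rec algebra_simps)
    also have "\<dots> = (real M - real j) * ?p * (real M + real j + real k + 2)"
      by (simp add: pochhammer_rec' algebra_simps)
    finally show ?thesis using Suc.IH[of "Suc j"] by simp
  qed
  also have "?X j k = fact j * fact k / fact (j + k + 1) * ?p * ?q" by (rule Suc.IH)
  also have "(real M + 1 + real k - real j) * (real M + real k + real j + 2) * (fact j * fact k / fact (j + k + 1) * ?p * ?q)
      - fact (Suc j) * fact k / fact (j + k + 2) * ((real M - real j) * ?p * (real M + real j + real k + 2)) * ?q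
      = fact j * fact (Suc k) / fact (j + k + 2) * (?p * (real M + real j + real k + 2)) * (?q * (real M + real k + 2))"
  proof -
    have key: "a * b * (f * g / F * p * q) - c * f * g / (J * F) * (d * p * b) * q = f * (e * g) / (J * F) * (p * b) * (q * h)"
      if "a * J - c * d = e * h" "J \<noteq> 0" "F \<noteq> 0" for a b c d e f g h F J p q :: real
    proof -
      have "a * b * (f * g / F * p * q) - c * f * g / (J * F) * (d * p * b) * q
          = f * g * p * q * b / (J * F) * (a * J - c * d)"
        using that(2,3) by (simp add: field_simps)
      then show ?thesis unfolding that(1) by simp
    qed
    have f: "fact (j + k + 2) = (real j + real k + 2) * fact (j + k + 1)"
      "fact (Suc j) = (real j + 1) * fact j" "fact (Suc k) = (real k + 1) * fact k" by (simp_all add: algebra_simps)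
    have b: "real M + real j + real k + 2 = real M + real k + real j + 2" by simp
    show ?thesis
      unfolding f b by (rule key [OF _ _ fact_nonzero]) (simp_all add: algebra_simps)
  qed
  also have "?p * (real M + real j + real k + 2) = pochhammer (real M + 1 - real j) (2 * j + Suc k + 1)"
    by (simp add: pochhammer_rec' algebra_simps)
  also have "?q * (real M + real k + 2) = pochhammer (real M + 1) (Suc k + 1)"
    by (simp add: pochhammer_rec' algebra_simps)
  finally show ?case by simp
qed

text \<open>The moment of a constant against the test functions. It does not belong to the previous family and follows instead
  from the Vandermonde convolution over the full symmetric range, of which the sum is one half. The factor
  \<open>M + 1/2\<close> is included because the duplication formula for Pochhammer symbols absorbs it.\<close>

lemma moment_even:
  "(real M + 1/2) * (\<Sum>a\<le>M. top_factorial (real M + 1/2) k (real a + 1/2))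
     = fact k * pochhammer (real M + 1) (k + 1) * pochhammer (real M + 1/2) (k + 1)
       / (2 * pochhammer (1/2) (k + 1))"
proof -
  define n where "n = 2 * M + 1"
  define F where "F u = real ((u + k) choose k) * real ((n - u + k) choose k)" for u
  have t: "top_factorial (real M + 1/2) k (real a + 1/2) = (fact k)\<^sup>2 * F (M - a)" if a: "a \<le> M" for a
  proof -
    have e: "n - (M - a) = M + a + 1" using a by (simp add: n_def)
    have c: "fact k * real ((u + k) choose k) = pochhammer (real u + 1) k" for u
      using fact_add_pochhammer[of u k] binomial_fact[of k "u + k", where 'a = real]
      by (simp add: field_simps)
    have "(fact k)\<^sup>2 * F (M - a) = (fact k * real ((M - a + k) choose k)) * (fact k * real ((M + a + 1 + k) choose k))"
      unfolding F_def e power2_eq_square by (simp only: ac_simps)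
    also have "\<dots> = pochhammer (real M - real a + 1) k * pochhammer (real M + real a + 2) k"
      unfolding c using a by (simp add: of_nat_diff add_ac)
    also have "\<dots> = (\<Prod>i<k. (real M - real a + 1 + real i) * (real M + real a + 2 + real i))"
      by (simp add: pochhammer_prod prod.distrib atLeast0LessThan)
    also have "\<dots> = top_factorial (real M + 1/2) k (real a + 1/2)"
      unfolding top_factorial_def by (intro prod.cong refl) (simp add: power2_eq_square algebra_simps)
    finally show ?thesis ..
  qed
  have F_sym: "F (n - u) = F u" if "u \<le> n" for u
    using that by (simp add: F_def mult.commute)
  have F_gb: "F u = (-1) ^ n * (((- real k - 1) gchoose u) * ((- real k - 1) gchoose (n - u)))" if "u \<le> n" for u
  proof -
    have g: "(- real k - 1) gchoose v = (-1) ^ v * real ((v + k) choose k)" for v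
    proof -
      have "real ((v + k) choose k) = real ((v + k) choose v)"
        using binomial_symmetric[of v "v + k"] by simp
      moreover have "- real k - 1 = - (real k + 1)" by simp
      ultimately show ?thesis
        by (simp only: gbinomial_minus) (simp add: binomial_gbinomial add.commute)
    qed
    have "(-1 :: real) ^ n * ((-1) ^ u * (-1) ^ (n - u)) = 1"
      using that by (simp flip: power_add)
    then show ?thesis unfolding F_def g by (simp add: algebra_simps)
  qed
  have "(\<Sum>u\<le>n. F u) = (-1) ^ n * ((- real (2 * k + 1) - 1) gchoose n)"
  proof -
    have "(\<Sum>u\<le>n. F u) = (-1) ^ n * (\<Sum>u\<le>n. ((- real k - 1) gchoose u) * ((- real k - 1) gchoose (n - u)))"
      unfolding sum_distrib_left by (intro sum.cong refl) (simp add: F_gb)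
    also have "(\<Sum>u\<le>n. ((- real k - 1) gchoose u) * ((- real k - 1) gchoose (n - u)))
        = (- real (2 * k + 1) - 1) gchoose n"
    proof -
      have "- real (2 * k + 1) - 1 = (- real k - 1) + (- real k - 1)" by simp
      then show ?thesis by (simp only: gbinomial_Vandermonde [symmetric] atMost_atLeast0)
    qed
    finally show ?thesis .
  qed
  also have "\<dots> = real ((n + 2 * k + 1) choose n)"
  proof -
    have "- real (2 * k + 1) - 1 = - (real (2 * k + 1) + 1)" by simp
    moreover have "real (2 * k + 1) + 1 + real n - 1 = real (n + 2 * k + 1)" by simp
    ultimately show ?thesis
      by (simp only: gbinomial_minus binomial_gbinomial) (simp flip: power_add)
  qed
  finally have total: "(\<Sum>u\<le>n. F u) = real ((n + 2 * k + 1) choose n)" .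
  have half: "2 * (\<Sum>u\<le>M. F u) = (\<Sum>u\<le>n. F u)"
  proof -
    have "(\<Sum>u\<in>{Suc M..n}. F u) = (\<Sum>u\<le>M. F u)"
      by (rule sum.reindex_bij_witness[of _ "\<lambda>u. n - u" "\<lambda>u. n - u"]) (auto simp: n_def F_sym[unfolded n_def, simplified])
    moreover have "{..n} = {..M} \<union> {Suc M..n}" by (auto simp: n_def)
    moreover have "sum F ({..M} \<union> {Suc M..n}) = sum F {..M} + sum F {Suc M..n}"
      by (rule sum.union_disjoint) auto
    ultimately show ?thesis by simp
  qed
  have "(\<Sum>a\<le>M. top_factorial (real M + 1/2) k (real a + 1/2)) = (\<Sum>a\<le>M. (fact k)\<^sup>2 * F (M - a))"
    by (intro sum.cong refl) (simp add: t)
  also have "\<dots> = (\<Sum>u\<le>M. (fact k)\<^sup>2 * F u)"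
    by (rule sum.reindex_bij_witness[of _ "\<lambda>u. M - u" "\<lambda>u. M - u"]) auto
  finally have W: "2 * (\<Sum>a\<le>M. top_factorial (real M + 1/2) k (real a + 1/2)) = (fact k)\<^sup>2 * real ((n + 2 * k + 1) choose n)"
    using half total by (simp add: sum_distrib_left[symmetric])
  have b: "real ((n + 2 * k + 1) choose n) = pochhammer (real n + 1) (2 * k + 1) / fact (2 * k + 1)"
    using fact_add_pochhammer[of n "2 * k + 1"] binomial_fact[of n "n + 2 * k + 1", where 'a = real]
    by (simp add: add.assoc)
  have top: "(2 * real M + 1) * pochhammer (real n + 1) (2 * k + 1)
      = 4 ^ (k + 1) * pochhammer (real M + 1/2) (k + 1) * pochhammer (real M + 1) (k + 1)"
  proof -
    have "(2 * real M + 1) * pochhammer (real n + 1) (2 * k + 1) = pochhammer (2 * (real M + 1/2)) (Suc (2 * k + 1))"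
      by (simp add: pochhammer_rec n_def algebra_simps)
    also have "Suc (2 * k + 1) = 2 * (k + 1)" by simp
    also have "pochhammer (2 * (real M + 1/2)) (2 * (k + 1))
        = 4 ^ (k + 1) * pochhammer (real M + 1/2) (k + 1) * pochhammer (real M + 1/2 + 1/2) (k + 1)"
      unfolding pochhammer_double by (simp add: power_mult)
    also have "real M + 1/2 + 1/2 = real M + 1" by simp
    finally show ?thesis .
  qed
  have bot: "2 * fact (2 * k + 1) = 4 ^ (k + 1) * pochhammer (1/2) (k + 1) * (fact k :: real)"
  proof -
    have "pochhammer (2 * (1/2) :: real) (2 * (k + 1)) = fact (2 * k + 2)"
      using pochhammer_fact[of "2 * (k + 1)", where 'a = real] by (simp del: fact_Suc)
    moreover have "pochhammer (1/2 + 1/2 :: real) (k + 1) = fact (k + 1)"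
      using pochhammer_fact[of "k + 1", where 'a = real] by (simp del: fact_Suc)
    ultimately have "fact (2 * k + 2) = 4 ^ (k + 1) * pochhammer (1/2) (k + 1) * (fact (k + 1) :: real)"
      using pochhammer_double[of "1/2 :: real" "k + 1"] by (simp add: power_mult del: fact_Suc)
    moreover have "fact (2 * k + 2) = (real k + 1) * (2 * fact (2 * k + 1))" by (simp add: algebra_simps)
    moreover have "fact (k + 1) = (real k + 1) * fact k" by simp
    ultimately have "(real k + 1) * (2 * fact (2 * k + 1)) = (real k + 1) * (4 ^ (k + 1) * pochhammer (1/2) (k + 1) * fact k)"
      by (simp only: ac_simps)
    then show ?thesis by (simp only: mult_cancel_left) simp
  qed
  let ?W = "\<Sum>a\<le>M. top_factorial (real M + 1/2) k (real a + 1/2)"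
  have p: "pochhammer (1/2 :: real) (k + 1) \<noteq> 0"
    using pochhammer_pos[of "1/2 :: real" "k + 1"] by simp
  have "(4 * real M + 2) * ?W * (2 * fact (2 * k + 1))
      = 2 * (fact k)\<^sup>2 * ((2 * real M + 1) * pochhammer (real n + 1) (2 * k + 1))"
  proof -
    have aux: "(4 * m + 2) * w * (2 * f) = 2 * g * ((2 * m + 1) * p)" if "2 * w = g * (p / f)" "f \<noteq> 0" for m w f g p :: real
    proof -
      have "2 * w * f = g * p" using that by simp
      then have "(2 * m + 1) * 2 * (2 * w * f) = (2 * m + 1) * 2 * (g * p)" by simp
      then show ?thesis by (simp add: algebra_simps)
    qed
    show ?thesis using W unfolding b by (rule aux) (rule fact_nonzero)
  qed
  then have "4 * (real M + 1/2) * ?W * (4 ^ (k + 1) * pochhammer (1/2) (k + 1) * fact k)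
      = 2 * (fact k)\<^sup>2 * (4 ^ (k + 1) * pochhammer (real M + 1/2) (k + 1) * pochhammer (real M + 1) (k + 1))"
    unfolding top bot by (simp add: algebra_simps)
  then have "(4 ^ (k + 1) * fact k * 2) * (2 * pochhammer (1/2) (k + 1) * ((real M + 1/2) * ?W))
      = (4 ^ (k + 1) * fact k * 2) * (fact k * pochhammer (real M + 1/2) (k + 1) * pochhammer (real M + 1) (k + 1))"
    unfolding power2_eq_square by (simp only: ac_simps)
  then have "2 * pochhammer (1/2) (k + 1) * ((real M + 1/2) * ?W)
      = fact k * pochhammer (real M + 1/2) (k + 1) * pochhammer (real M + 1) (k + 1)"
    by (subst (asm) mult_left_cancel) auto
  then show ?thesis using p by (simp add: nonzero_eq_divide_eq ac_simps)
qed

section \<open>An explicit skew orthogonal polynomial\<close>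

text \<open>Coefficients of the primitive in the basis \<open>y * half_factorial j y\<close>. The factor \<open>fact (M - j) / fact (M + j)\<close> cancels
  against the mixed moments. The last factor has the form \<open>E - s c j / (2 j + 1)\<close> with \<open>E = M + 1/2\<close>: its pole at \<open>j = -1/2\<close> produces the
  only contribution to the low moments, which the additive constant in \<open>skew_primitive\<close> compensates, and
  \<open>c = (2 N + 1) (2 N - 1) / (2 N)\<close> is the value for which it does so.\<close>

definition skew_coeff :: "real \<Rightarrow> nat \<Rightarrow> nat \<Rightarrow> nat \<Rightarrow> real" where
  "skew_coeff s M N j = (-1) ^ j * fact (N + j - 1) / ((fact j)\<^sup>2 * fact (N - j)) * (fact (M - j) / fact (M + j))
     * (real M + 1/2 - s * ((2 * real N + 1) * (2 * real N - 1) / (2 * real N)) * (real j / (2 * real j + 1)))"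

text \<open>An odd polynomial plus a constant, as a function of the half-integer \<open>y\<close>. For \<open>s = 1\<close> and \<open>s = -1\<close> the constant
  makes it vanish at \<open>s / 2\<close>, the half-integer below the range of summation.\<close>

definition skew_primitive :: "real \<Rightarrow> nat \<Rightarrow> nat \<Rightarrow> real \<Rightarrow> real" where
  "skew_primitive s M N y = (\<Sum>j\<le>N. skew_coeff s M N j * (y * half_factorial j y)) - s / 2 * skew_coeff s M N 0"

text \<open>The factor with the pole is a linear polynomial over \<open>j + 1/2\<close>, and its numerator is \<open>s c / 4\<close> at the pole.\<close>

lemma linear_factor_sum:
  fixes q :: "real poly" and E s :: real
  assumes N: "N \<ge> 1" and deg: "degree q \<le> N - 1"
  defines "c \<equiv> (2 * real N + 1) * (2 * real N - 1) / (2 * real N)"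
  shows "(\<Sum>j\<le>N. (-1) ^ j / (fact j * fact (N - j)) * (poly q (real j) * (E - s * c * (real j / (2 * real j + 1)))))
       = s * poly q (- (1/2)) / (2 * real N * pochhammer (1/2) (N - 1))"
proof -
  define p where "p = q * [:E / 2, E - s * c / 2:]"
  have degp: "degree p \<le> N"
  proof -
    have "degree p \<le> degree q + degree [:E / 2, E - s * c / 2:]" unfolding p_def by (rule degree_mult_le)
    also have "\<dots> \<le> (N - 1) + 1" using deg by (intro add_mono) auto
    finally show ?thesis using N by simp
  qed
  have "(\<Sum>j\<le>N. (-1) ^ j / (fact j * fact (N - j)) * (poly q (real j) * (E - s * c * (real j / (2 * real j + 1)))))
      = (\<Sum>j\<le>N. (-1) ^ j / (fact j * fact (N - j)) * (poly p (real j) / (real j + 1/2)))"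
  proof (intro sum.cong refl)
    fix j
    have "E - s * c * (real j / (2 * real j + 1)) = (E / 2 + real j * (E - s * c / 2)) / (real j + 1/2)"
      by (simp add: divide_simps) (simp add: algebra_simps)
    moreover have "poly p (real j) = poly q (real j) * (E / 2 + real j * (E - s * c / 2))"
      unfolding p_def poly_mult by simp
    ultimately show "(-1) ^ j / (fact j * fact (N - j)) * (poly q (real j) * (E - s * c * (real j / (2 * real j + 1))))
        = (-1) ^ j / (fact j * fact (N - j)) * (poly p (real j) / (real j + 1/2))"
      by (simp only: times_divide_eq_right)
  qed
  also have "\<dots> = poly p (- (1/2)) / pochhammer (1/2) (Suc N)"
    using partial_fraction_sum[of p N "1/2"] degp by (simp add: coeff_eq_0)
  also have "poly p (- (1/2)) = poly q (- (1/2)) * (s * ((real N + 1/2) * (real N - 1/2)) / (2 * real N))"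
    using N unfolding p_def c_def by (simp add: field_simps)
  also have "pochhammer (1/2 :: real) (Suc N) = pochhammer (1/2) (N - 1) * ((real N + 1/2) * (real N - 1/2))"
  proof -
    obtain n where n: "N = Suc n" using N by (cases N) auto
    show ?thesis unfolding n by (simp add: pochhammer_rec' field_simps)
  qed
  also have "poly q (- (1/2)) * (s * ((real N + 1/2) * (real N - 1/2)) / (2 * real N))
        / (pochhammer (1/2) (N - 1) * ((real N + 1/2) * (real N - 1/2)))
      = s * poly q (- (1/2)) / (2 * real N * pochhammer (1/2) (N - 1))"
  proof -
    have "x * (s * D / y) / (P * D) = s * x / (y * P)" if "D \<noteq> 0" for x D y P :: real
      using that by (simp add: mult_ac)
    moreover have "(real N + 1/2) * (real N - 1/2) \<noteq> 0" using N by simp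
    ultimately show ?thesis by blast
  qed
  finally show ?thesis .
qed

lemma half_factorial_top:
  assumes "j \<le> M"
  shows "half_factorial j (real M + 1/2) = fact (M + j) / fact (M - j)"
  using fact_add_pochhammer[of "M - j" "2 * j"] assms
  by (simp add: half_factorial_pochhammer of_nat_diff algebra_simps)

lemma half_factorial_half:
  assumes "y\<^sup>2 = 1/4"
  shows "half_factorial j y = (if j = 0 then 1 else 0)"
proof (cases j)
  case (Suc n)
  show ?thesis
    unfolding Suc half_factorial_def prod.lessThan_Suc_shift using assms by (simp add: power2_eq_square)
qed (simp add: half_factorial_def)

lemma skew_primitive_bottom:
  assumes "s\<^sup>2 = 1"
  shows "skew_primitive s M N (s / 2) = 0"
proof -
  have "half_factorial j (s / 2) = (if j = 0 then 1 else 0)" for j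
    using assms by (intro half_factorial_half) (simp add: power_divide)
  then have "(\<Sum>j\<le>N. skew_coeff s M N j * (s / 2 * half_factorial j (s / 2)))
      = (\<Sum>j\<le>N. if j = 0 then skew_coeff s M N 0 * (s / 2) else 0)"
    by (intro sum.cong) auto
  then show ?thesis by (simp add: skew_primitive_def)
qed

lemma skew_coeff_0: "N \<ge> 1 \<Longrightarrow> skew_coeff s M N 0 = (real M + 1/2) / real N"
  by (cases N) (simp_all add: skew_coeff_def)

text \<open>At the upper end the factorials depending on \<open>M\<close> cancel and the residue at \<open>-1/2\<close> equals the additive constant.\<close>

lemma skew_primitive_top:
  assumes N: "1 \<le> N" "N \<le> M"
  shows "skew_primitive s M N (real M + 1/2) = 0"
proof -
  let ?E = "real M + 1/2"
  let ?c = "(2 * real N + 1) * (2 * real N - 1) / (2 * real N)"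
  have "(\<Sum>j\<le>N. skew_coeff s M N j * (?E * half_factorial j ?E))
      = ?E * (\<Sum>j\<le>N. (-1) ^ j / (fact j * fact (N - j)) * (poly (rising_poly 1 (N - 1)) (real j)
          * (?E - s * ?c * (real j / (2 * real j + 1)))))"
    unfolding sum_distrib_left
  proof (intro sum.cong refl)
    fix j assume "j \<in> {..N}"
    then have j: "j \<le> N" "j \<le> M" using N by auto
    have "N + j - 1 = j + (N - 1)" using N by simp
    then have "fact (N + j - 1) = fact j * poly (rising_poly 1 (N - 1)) (real j)"
      using fact_add_pochhammer[of j "N - 1"] by (simp add: poly_rising_poly)
    then show "skew_coeff s M N j * (?E * half_factorial j ?E) = ?E * ((-1) ^ j / (fact j * fact (N - j)) *
        (poly (rising_poly 1 (N - 1)) (real j) * (?E - s * ?c * (real j / (2 * real j + 1)))))"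
      by (simp add: skew_coeff_def half_factorial_top[OF j(2)] power2_eq_square)
  qed
  also have "\<dots> = ?E * (s * pochhammer (1/2) (N - 1) / (2 * real N * pochhammer (1/2) (N - 1)))"
    using N by (subst linear_factor_sum) (simp_all add: degree_rising_poly poly_rising_poly)
  also have "\<dots> = s / 2 * skew_coeff s M N 0"
    using N pochhammer_pos[of "1/2 :: real" "N - 1"] by (simp add: skew_coeff_0 divide_simps)
  finally show ?thesis by (simp add: skew_primitive_def)
qed

text \<open>The central difference of the primitive, as a polynomial in the square of the argument.\<close>

definition skew_diff_poly :: "real \<Rightarrow> nat \<Rightarrow> nat \<Rightarrow> real poly" where
  "skew_diff_poly s M N
     = (\<Sum>j\<le>N. smult (skew_coeff s M N j * (2 * real j + 1)) (\<Prod>i<j. [:- (real i)\<^sup>2, 1:]))"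

lemma half_factorial_shift_up:
  "x * half_factorial j (x + 1/2) = (x + real j) * (\<Prod>i<j. x\<^sup>2 - (real i)\<^sup>2)"
proof (induction j)
  case (Suc j)
  have "x * half_factorial (Suc j) (x + 1/2) = (x * half_factorial j (x + 1/2)) * ((x - real j) * (x + real j + 1))"
    by (simp add: half_factorial_def power2_eq_square algebra_simps)
  then show ?case unfolding Suc by (simp add: power2_eq_square algebra_simps)
qed (simp add: half_factorial_def)

lemma half_factorial_shift_down:
  "x * half_factorial j (x - 1/2) = (x - real j) * (\<Prod>i<j. x\<^sup>2 - (real i)\<^sup>2)"
proof (induction j)
  case (Suc j)
  have "x * half_factorial (Suc j) (x - 1/2) = (x * half_factorial j (x - 1/2)) * ((x + real j) * (x - real j - 1))"
    by (simp add: half_factorial_def power2_eq_square algebra_simps)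
  then show ?case unfolding Suc by (simp add: power2_eq_square algebra_simps)
qed (simp add: half_factorial_def)

lemma half_factorial_sum:
  assumes "x \<noteq> 0"
  shows "half_factorial j (x + 1/2) + half_factorial j (x - 1/2) = 2 * (\<Prod>i<j. x\<^sup>2 - (real i)\<^sup>2)"
proof -
  have "x * (half_factorial j (x + 1/2) + half_factorial j (x - 1/2)) = x * (2 * (\<Prod>i<j. x\<^sup>2 - (real i)\<^sup>2))"
    unfolding distrib_left half_factorial_shift_up half_factorial_shift_down by (simp add: algebra_simps)
  then show ?thesis using assms by simp
qed

lemma half_factorial_diff:
  "(x + 1/2) * half_factorial j (x + 1/2) - (x - 1/2) * half_factorial j (x - 1/2)
     = (2 * real j + 1) * (\<Prod>i<j. x\<^sup>2 - (real i)\<^sup>2)"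
proof (cases "x = 0")
  case True
  have "half_factorial j (1/2) = (if j = 0 then 1 else 0)" "half_factorial j (- (1/2)) = (if j = 0 then 1 else 0)"
    by (rule half_factorial_half; simp add: power2_eq_square)+
  moreover have "(\<Prod>i<j. (0::real)\<^sup>2 - (real i)\<^sup>2) = (if j = 0 then 1 else 0)"
    by (cases j) (auto simp: prod.lessThan_Suc_shift simp del: prod.lessThan_Suc)
  ultimately show ?thesis using True by simp
next
  case False
  have "x * ((x + 1/2) * half_factorial j (x + 1/2) - (x - 1/2) * half_factorial j (x - 1/2))
      = (x + 1/2) * (x * half_factorial j (x + 1/2)) - (x - 1/2) * (x * half_factorial j (x - 1/2))"
    by (simp add: algebra_simps)
  also have "\<dots> = x * ((2 * real j + 1) * (\<Prod>i<j. x\<^sup>2 - (real i)\<^sup>2))"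
    unfolding half_factorial_shift_up half_factorial_shift_down by (simp add: algebra_simps)
  finally show ?thesis using False by simp
qed

lemma poly_skew_diff_poly:
  "poly (skew_diff_poly s M N) (x\<^sup>2) = skew_primitive s M N (x + 1/2) - skew_primitive s M N (x - 1/2)"
proof -
  have "skew_primitive s M N (x + 1/2) - skew_primitive s M N (x - 1/2)
      = (\<Sum>j\<le>N. skew_coeff s M N j * ((x + 1/2) * half_factorial j (x + 1/2) - (x - 1/2) * half_factorial j (x - 1/2)))"
    by (simp add: skew_primitive_def right_diff_distrib sum_subtractf)
  also have "\<dots> = poly (skew_diff_poly s M N) (x\<^sup>2)"
    unfolding half_factorial_diff skew_diff_poly_def poly_sum
    by (intro sum.cong refl) (simp add: poly_prod)
  finally show ?thesis ..
qed

lemma degree_skew_diff_poly: "degree (skew_diff_poly s M N) \<le> N"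
  and coeff_skew_diff_poly: "coeff (skew_diff_poly s M N) N = (2 * real N + 1) * skew_coeff s M N N"
proof -
  define e where "e j = (\<Prod>i<j. [:- (real i)\<^sup>2, 1:])" for j :: nat
  have e_deg: "degree (e j) = j" for j unfolding e_def by (subst degree_prod_eq_sum_degree) auto
  have "lead_coeff (e j) = 1" for j unfolding e_def by (simp add: lead_coeff_prod)
  then have e_lead: "coeff (e j) j = 1" for j using e_deg by metis
  have D: "skew_diff_poly s M N = (\<Sum>j\<le>N. smult (skew_coeff s M N j * (2 * real j + 1)) (e j))"
    by (simp add: skew_diff_poly_def e_def)
  show "degree (skew_diff_poly s M N) \<le> N"
    unfolding D by (intro degree_sum_le) (use e_deg degree_smult_le le_trans in auto)
  have "coeff (skew_diff_poly s M N) N = (\<Sum>j\<le>N. if j = N then (2 * real N + 1) * skew_coeff s M N N else 0)"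
    unfolding D coeff_sum by (intro sum.cong refl) (auto simp: e_lead e_deg coeff_eq_0)
  then show "coeff (skew_diff_poly s M N) N = (2 * real N + 1) * skew_coeff s M N N" by simp
qed

text \<open>The second term stems from the additive constant of the primitive.\<close>

lemma skew_moment_expand:
  assumes N: "1 \<le> N" "N \<le> M"
  defines "E \<equiv> real M + 1/2" and "c \<equiv> (2 * real N + 1) * (2 * real N - 1) / (2 * real N)"
  shows "(\<Sum>a\<le>M. 2 * skew_primitive s M N (real a + 1/2) * top_factorial E k (real a + 1/2))
     = fact k * pochhammer (real M + 1) (k + 1) *
        ((\<Sum>j\<le>N. (-1) ^ j / (fact j * fact (N - j)) * (fact (N + j - 1) / fact (j + k + 1)
            * pochhammer (real j + (real M + 1)) (k + 1) * (E - s * c * (real j / (2 * real j + 1)))))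
         - s * pochhammer E (k + 1) / (2 * real N * pochhammer (1/2) (k + 1)))"
proof -
  let ?t = "\<lambda>a. top_factorial E k (real a + 1/2)" and ?h = "\<lambda>j a. half_factorial j (real a + 1/2)"
  let ?T = "skew_coeff s M N"
  have "(\<Sum>a\<le>M. 2 * skew_primitive s M N (real a + 1/2) * ?t a)
      = (\<Sum>a\<le>M. (\<Sum>j\<le>N. ?T j * ((2 * real a + 1) * ?h j a * ?t a)) - s * ?T 0 * ?t a)"
  proof (intro sum.cong refl)
    fix a
    have two: "2 * real a + 1 = 2 * (real a + 1/2)" by simp
    have "(\<Sum>j\<le>N. ?T j * ((2 * real a + 1) * ?h j a * ?t a)) = 2 * ?t a * (\<Sum>j\<le>N. ?T j * ((real a + 1/2) * ?h j a))"
      unfolding sum_distrib_left two by (intro sum.cong refl) (simp only: ac_simps)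
    then show "2 * skew_primitive s M N (real a + 1/2) * ?t a
        = (\<Sum>j\<le>N. ?T j * ((2 * real a + 1) * ?h j a * ?t a)) - s * ?T 0 * ?t a"
      unfolding skew_primitive_def by (simp add: right_diff_distrib left_diff_distrib mult_ac)
  qed
  also have "\<dots> = (\<Sum>j\<le>N. ?T j * (\<Sum>a\<le>M. (2 * real a + 1) * ?h j a * ?t a)) - s * ?T 0 * (\<Sum>a\<le>M. ?t a)"
    unfolding sum_subtractf sum_distrib_left by (subst sum.swap) (rule refl)
  also have "(\<Sum>j\<le>N. ?T j * (\<Sum>a\<le>M. (2 * real a + 1) * ?h j a * ?t a))
      = fact k * pochhammer (real M + 1) (k + 1) *
        (\<Sum>j\<le>N. (-1) ^ j / (fact j * fact (N - j)) * (fact (N + j - 1) / fact (j + k + 1)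
            * pochhammer (real j + (real M + 1)) (k + 1) * (E - s * c * (real j / (2 * real j + 1)))))"
    unfolding sum_distrib_left[where r = "fact k * pochhammer (real M + 1) (k + 1)"]
  proof (intro sum.cong refl)
    fix j assume "j \<in> {..N}"
    then have j: "j \<le> M" using N by simp
    have "fact (M + j + k + 1) = fact (M - j) * pochhammer (real M + 1 - real j) (2 * j + k + 1)"
      using fact_add_pochhammer[of "M - j" "2 * j + k + 1"] j by (simp add: of_nat_diff algebra_simps)
    moreover have "fact (M + j + k + 1) = fact (M + j) * pochhammer (real j + (real M + 1)) (k + 1)"
      using fact_add_pochhammer[of "M + j" "k + 1"] by (simp add: algebra_simps)
    ultimately have r: "fact (M - j) * pochhammer (real M + 1 - real j) (2 * j + k + 1)
        = fact (M + j) * pochhammer (real j + (real M + 1)) (k + 1)" by simp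
    have "?T j * (\<Sum>a\<le>M. (2 * real a + 1) * ?h j a * ?t a)
      = ((-1) ^ j * fact (N + j - 1) / ((fact j)\<^sup>2 * fact (N - j)) / fact (M + j)
         * (E - s * c * (real j / (2 * real j + 1)))) * (fact j * fact k / fact (j + k + 1))
         * (fact (M - j) * pochhammer (real M + 1 - real j) (2 * j + k + 1)) * pochhammer (real M + 1) (k + 1)"
      unfolding E_def moment_odd skew_coeff_def c_def by simp
    also have "\<dots> = fact k * pochhammer (real M + 1) (k + 1) * ((-1) ^ j / (fact j * fact (N - j)) *
        (fact (N + j - 1) / fact (j + k + 1) * pochhammer (real j + (real M + 1)) (k + 1)
          * (E - s * c * (real j / (2 * real j + 1)))))"
      unfolding r by (simp add: power2_eq_square mult_ac)
    finally show "?T j * (\<Sum>a\<le>M. (2 * real a + 1) * ?h j a * ?t a) = \<dots>" .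
  qed
  also have "s * ?T 0 * (\<Sum>a\<le>M. ?t a)
      = fact k * pochhammer (real M + 1) (k + 1) * (s * pochhammer E (k + 1) / (2 * real N * pochhammer (1/2) (k + 1)))"
  proof -
    have "s * ?T 0 * (\<Sum>a\<le>M. ?t a) = s / real N * (E * (\<Sum>a\<le>M. ?t a))"
      using N by (simp add: skew_coeff_0 E_def)
    then show ?thesis unfolding E_def moment_even by (simp add: mult_ac)
  qed
  finally show ?thesis by (simp only: right_diff_distrib)
qed

text \<open>For these \<open>k\<close> the quotient of factorials is a polynomial in \<open>j\<close>, small enough in degree for \<open>linear_factor_sum\<close>; the
  residue at \<open>-1/2\<close> cancels the contribution of the additive constant.\<close>

lemma skew_moment_low:
  assumes N: "N \<le> M" and k: "k + 2 \<le> N"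
  shows "(\<Sum>a\<le>M. 2 * skew_primitive s M N (real a + 1/2) * top_factorial (real M + 1/2) k (real a + 1/2)) = 0"
proof -
  define q where "q = rising_poly (real k + 2) (N - 2 - k) * rising_poly (real M + 1) (k + 1)"
  have deg: "degree q \<le> N - 1"
    unfolding q_def using degree_mult_le[of "rising_poly (real k + 2) (N - 2 - k)" "rising_poly (real M + 1) (k + 1)"] k
    by (simp add: degree_rising_poly)
  have q: "fact (N + j - 1) / fact (j + k + 1) * pochhammer (real j + (real M + 1)) (k + 1) = poly q (real j)" for j
  proof -
    have "N + j - 1 = (j + k + 1) + (N - 2 - k)" using k by simp
    then have "fact (N + j - 1) = fact (j + k + 1) * pochhammer (real j + (real k + 2)) (N - 2 - k)"
      using fact_add_pochhammer[of "j + k + 1" "N - 2 - k"] by (simp add: algebra_simps)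
    then show ?thesis by (simp add: q_def poly_rising_poly)
  qed
  have half: "pochhammer (1/2 :: real) (N - 1) = pochhammer (1/2) (k + 1) * pochhammer (real k + 3/2) (N - 2 - k)"
  proof -
    have "N - 1 = (k + 1) + (N - 2 - k)" "1/2 + real (k + 1) = real k + 3/2" using k by auto
    then show ?thesis by (simp only: pochhammer_product')
  qed
  have q_half: "poly q (- (1/2)) = pochhammer (real k + 3/2) (N - 2 - k) * pochhammer (real M + 1/2) (k + 1)"
    by (simp add: q_def poly_rising_poly add_ac)
  have "pochhammer (real k + 3/2) (N - 2 - k) \<noteq> 0"
    using pochhammer_pos[of "real k + 3/2" "N - 2 - k"] by simp
  then have "s * poly q (- (1/2)) / (2 * real N * pochhammer (1/2) (N - 1))
      = s * pochhammer (real M + 1/2) (k + 1) / (2 * real N * pochhammer (1/2) (k + 1))"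
    unfolding q_half half by simp
  then show ?thesis
    using N k deg by (subst skew_moment_expand) (simp_all only: q, subst linear_factor_sum, simp_all)
qed

text \<open>For \<open>k = N - 1\<close> the quotient of factorials is \<open>1 / (j + N)\<close>. The residue at \<open>-1/2\<close> cancels as before and the one at \<open>-N\<close>
  is the value.\<close>

lemma skew_moment_top:
  assumes N: "1 \<le> N" "N \<le> M"
  shows "(\<Sum>a\<le>M. 2 * skew_primitive s M N (real a + 1/2) * top_factorial (real M + 1/2) (N - 1) (real a + 1/2))
     = (fact (N - 1))\<^sup>2 * (fact (M + N) / fact (M - N)) * (real M + 1/2 - s * (real N + 1/2)) / fact (2 * N)"
proof -
  let ?E = "real M + 1/2"
  define c where "c = (2 * real N + 1) * (2 * real N - 1) / (2 * real N)"
  define p where "p = rising_poly (real M + 1) N * [:?E / 2, ?E - s * c / 2:]"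
  have N1: "N - 1 + 1 = N" using N by simp
  have N0: "real N \<ge> 1" using N by simp
  have degp: "degree p \<le> Suc N"
  proof -
    have "degree p \<le> degree (rising_poly (real M + 1) N) + degree [:?E / 2, ?E - s * c / 2:]"
      unfolding p_def by (rule degree_mult_le)
    also have "\<dots> \<le> N + 1" by (intro add_mono) (auto simp: degree_rising_poly)
    finally show ?thesis by simp
  qed
  have "(\<Sum>j\<le>N. (-1) ^ j / (fact j * fact (N - j)) * (fact (N + j - 1) / fact (j + (N - 1) + 1)
            * pochhammer (real j + (real M + 1)) (N - 1 + 1) * (?E - s * c * (real j / (2 * real j + 1)))))
      = (\<Sum>j\<le>N. (-1) ^ j / (fact j * fact (N - j)) * (poly p (real j) / ((real j + 1/2) * (real j + real N))))"
  proof (intro sum.cong refl arg_cong2[of _ _ _ _ "(*)"])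
    fix j
    obtain n where n: "N = Suc n" using N by (cases N) auto
    have f: "fact (N + j - 1) / fact (j + (N - 1) + 1) = 1 / (real j + real N)"
      unfolding n by (simp add: divide_simps add_ac)
    have l: "?E - s * c * (real j / (2 * real j + 1)) = (?E / 2 + real j * (?E - s * c / 2)) / (real j + 1/2)"
      by (simp add: field_simps)
    show "fact (N + j - 1) / fact (j + (N - 1) + 1) * pochhammer (real j + (real M + 1)) (N - 1 + 1)
          * (?E - s * c * (real j / (2 * real j + 1))) = poly p (real j) / ((real j + 1/2) * (real j + real N))"
      unfolding f l N1 p_def poly_mult poly_rising_poly by simp
  qed
  also have "\<dots> = (poly p (- (1/2)) / pochhammer (1/2) (Suc N) - poly p (- real N) / pochhammer (real N) (Suc N)) / (real N - 1/2)"
    using N0 by (intro two_pole_sum degp) auto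
  also have "poly p (- (1/2)) / pochhammer (1/2) (Suc N)
      = s * pochhammer ?E N / (2 * real N * pochhammer (1/2) N) * (real N - 1/2)"
  proof -
    have "poly p (- (1/2)) = pochhammer ?E N * (s * (real N + 1/2) * (real N - 1/2) / (2 * real N))"
      using N0 unfolding p_def c_def poly_mult poly_rising_poly by (simp add: field_simps)
    moreover have "pochhammer (1/2 :: real) (Suc N) = pochhammer (1/2) N * (real N + 1/2)"
      by (simp add: pochhammer_rec' algebra_simps)
    ultimately show ?thesis by (simp add: mult_ac)
  qed
  also have "poly p (- real N) / pochhammer (real N) (Suc N)
      = - (fact M / fact (M - N)) * (?E - s * (real N + 1/2)) * (fact (N - 1) / fact (2 * N)) * (real N - 1/2)"
  proof -
    have "fact M = fact (M - N) * pochhammer (- real N + (real M + 1)) N"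
      using fact_add_pochhammer[of "M - N" N] N by (simp add: of_nat_diff algebra_simps)
    then have "poly (rising_poly (real M + 1) N) (- real N) = fact M / fact (M - N)"
      by (simp add: poly_rising_poly field_simps)
    moreover have "?E / 2 + - real N * (?E - s * c / 2) = - ((?E - s * (real N + 1/2)) * (real N - 1/2))"
      using N0 unfolding c_def by (simp add: field_simps)
    moreover have "pochhammer (real N) (Suc N) = fact (2 * N) / fact (N - 1)"
    proof -
      have "N - 1 + Suc N = 2 * N" "real (N - 1) + 1 = real N" using N by auto
      then have "fact (2 * N) = fact (N - 1) * pochhammer (real N) (Suc N)"
        using fact_add_pochhammer[of "N - 1" "Suc N"] by (simp only:)
      then show ?thesis by (metis nonzero_mult_div_cancel_left fact_nonzero)
    qed
    ultimately show ?thesis unfolding p_def poly_mult by simp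
  qed
  also have "(s * pochhammer ?E N / (2 * real N * pochhammer (1/2) N) * (real N - 1/2)
        - - (fact M / fact (M - N)) * (?E - s * (real N + 1/2)) * (fact (N - 1) / fact (2 * N)) * (real N - 1/2)) / (real N - 1/2)
      = s * pochhammer ?E N / (2 * real N * pochhammer (1/2) N)
        + (fact M / fact (M - N)) * (?E - s * (real N + 1/2)) * (fact (N - 1) / fact (2 * N))"
  proof -
    have "(A * d - - b * u * v * d) / d = A + b * u * v" if "d \<noteq> 0" for A b u v d :: real
      using that by (simp add: divide_simps algebra_simps)
    moreover have "real N - 1/2 \<noteq> 0" using N0 by simp
    ultimately show ?thesis by blast
  qed
  finally have main: "(\<Sum>j\<le>N. (-1) ^ j / (fact j * fact (N - j)) * (fact (N + j - 1) / fact (j + (N - 1) + 1)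
            * pochhammer (real j + (real M + 1)) (N - 1 + 1) * (?E - s * c * (real j / (2 * real j + 1)))))
      = s * pochhammer ?E N / (2 * real N * pochhammer (1/2) N)
        + (fact M / fact (M - N)) * (?E - s * (real N + 1/2)) * (fact (N - 1) / fact (2 * N))" .
  have "fact (M + N) = fact M * pochhammer (real M + 1) N" by (rule fact_add_pochhammer)
  then have M: "pochhammer (real M + 1) N = fact (M + N) / fact M" by simp
  show ?thesis
    unfolding skew_moment_expand[OF N] c_def[symmetric] main
    unfolding N1 M
    by (simp add: power2_eq_square)
qed

section \<open>Summing the Vandermonde products\<close>

text \<open>It suffices to know a linear functional on a basis with one element in each degree. This transfers the moments
  from the test functions to all even polynomials.\<close>

lemma linear_functional_triangular:
  fixes L :: "real poly \<Rightarrow> real" and b :: "nat \<Rightarrow> real poly"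
  assumes add: "\<And>P Q. L (P + Q) = L P + L Q" and smult: "\<And>c P. L (smult c P) = c * L P"
    and deg: "\<And>k. degree (b k) = k" and b_nz: "\<And>k. b k \<noteq> 0"
    and low: "\<And>k. k < m \<Longrightarrow> L (b k) = 0"
    and R: "degree R \<le> m"
  shows "L R = coeff R m / coeff (b m) m * L (b m)"
proof -
  have lead: "coeff (b k) k \<noteq> 0" for k using b_nz[of k] deg[of k] by (metis leading_coeff_0_iff)
  define rest where "rest R k = R - smult (coeff R k / coeff (b k) k) (b k)" for R k
  have split: "L R = coeff R k / coeff (b k) k * L (b k) + L (rest R k)" for R k
  proof -
    have "R = smult (coeff R k / coeff (b k) k) (b k) + rest R k" by (simp add: rest_def)
    then show ?thesis by (metis add smult)
  qed
  have rest_coeff: "coeff (rest R k) i = 0" if "degree R \<le> k" "k \<le> i" for R k i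
    using that lead[of k] deg[of k] by (cases "i = k") (auto simp: rest_def coeff_eq_0)
  have zero: "L R = 0" if "\<And>i. k \<le> i \<Longrightarrow> coeff R i = 0" "k \<le> m" for R k
    using that
  proof (induction k arbitrary: R)
    case 0
    then have "R = smult 0 R" by (intro poly_eqI) auto
    then show ?case by (metis smult mult_zero_left)
  next
    case (Suc k)
    have "degree R \<le> k" using Suc.prems(1) by (intro degree_le) auto
    then have "L (rest R k) = 0" using Suc.prems(2) by (intro Suc.IH rest_coeff) auto
    moreover have "L (b k) = 0" using Suc.prems(2) by (intro low) auto
    ultimately show ?case using split[of R k] by simp
  qed
  have "L (rest R m) = 0" using R by (intro zero[of m] rest_coeff) auto
  then show ?thesis using split[of R m] by simp
qed

text \<open>Even polynomials on the integers whose averages over neighbouring points are combinations of the test functions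
  \<open>top_factorial\<close> on the half-integers between them.\<close>

definition top_poly :: "nat \<Rightarrow> nat \<Rightarrow> real poly" where
  "top_poly M k = (\<Prod>i<k. [:(real M + 1 + real i)\<^sup>2, - 1:])"

lemma degree_top_poly: "degree (top_poly M k) = k"
  unfolding top_poly_def by (subst degree_prod_eq_sum_degree) auto

lemma coeff_top_poly: "coeff (top_poly M k) k = (- 1) ^ k"
proof -
  have "lead_coeff (top_poly M k) = (- 1) ^ k" unfolding top_poly_def by (simp add: lead_coeff_prod)
  then show ?thesis by (simp add: degree_top_poly)
qed

lemma top_poly_average_0:
  "poly (top_poly M 0) (x\<^sup>2) + poly (top_poly M 0) ((x + 1)\<^sup>2) = 2 * top_factorial (real M + 1/2) 0 (x + 1/2)"
  by (simp add: top_poly_def top_factorial_def)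

lemma top_poly_average_Suc:
  "poly (top_poly M (Suc k)) (x\<^sup>2) + poly (top_poly M (Suc k)) ((x + 1)\<^sup>2)
     = 2 * top_factorial (real M + 1/2) (Suc k) (x + 1/2)
       - (real k + 1) * (2 * real M + 1 + 2 * (real k + 1)) * top_factorial (real M + 1/2) k (x + 1/2)"
proof -
  let ?t = "\<lambda>k. top_factorial (real M + 1/2) k (x + 1/2)"
  have t: "?t (Suc k) = ?t k * ((real M + 1 + real k - x) * (real M + 2 + real k + x))" for k
    by (simp add: top_factorial_def power2_eq_square algebra_simps)
  have left: "poly (top_poly M (Suc k)) (x\<^sup>2) = ?t k * ((real M + 1 + real k - x) * (real M + 1 + x))" for k
  proof (induction k)
    case 0
    show ?case by (simp add: top_poly_def top_factorial_def power2_eq_square algebra_simps)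
  next
    case (Suc k)
    have "poly (top_poly M (Suc (Suc k))) (x\<^sup>2)
        = poly (top_poly M (Suc k)) (x\<^sup>2) * ((real M + 2 + real k - x) * (real M + 2 + real k + x))"
      by (simp add: top_poly_def poly_prod power2_eq_square algebra_simps)
    then show ?case unfolding Suc t by (simp add: algebra_simps)
  qed
  have right: "poly (top_poly M (Suc k)) ((x + 1)\<^sup>2) = ?t k * ((real M - x) * (real M + 2 + real k + x))" for k
  proof (induction k)
    case 0
    show ?case by (simp add: top_poly_def top_factorial_def power2_eq_square algebra_simps)
  next
    case (Suc k)
    have "poly (top_poly M (Suc (Suc k))) ((x + 1)\<^sup>2)
        = poly (top_poly M (Suc k)) ((x + 1)\<^sup>2) * ((real M + 1 + real k - x) * (real M + 3 + real k + x))"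
      by (simp add: top_poly_def poly_prod power2_eq_square algebra_simps)
    then show ?case unfolding Suc t by (simp add: algebra_simps)
  qed
  show ?thesis unfolding left right t by (simp add: algebra_simps)
qed

text \<open>The recursion lemma applied to the primitive \<open>skew_primitive s M (Suc m)\<close>.\<close>

lemma sq_vandermonde_sum_two_step:
  assumes case_s: "(s = 1 \<and> lo = 1) \<or> (s = -1 \<and> lo = 0)" and M: "Suc m \<le> M"
  shows "sq_vandermonde_sum lo M (Suc (Suc m))
       * (fact (2 * m + 3) * fact (2 * m + 1) * (fact (M - Suc m))\<^sup>2 * (real M + 1/2 - s * (real m + 1/2)))
     = sq_vandermonde_sum lo M m
       * ((fact (Suc m) * fact m)\<^sup>2 * (fact (M + Suc m))\<^sup>2 * (real M + 1/2 - s * (real m + 3/2)))"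
proof -
  let ?N = "Suc m"
  let ?h = "skew_primitive s M ?N" and ?P = "skew_diff_poly s M ?N"
  let ?t = "\<lambda>k a. top_factorial (real M + 1/2) k (real a + 1/2)"
  define C where "C z = ?h (of_int z + 1/2)" for z :: int
  have s2: "s\<^sup>2 = 1" using case_s by auto
  have hbot: "?h (s / 2) = 0" by (rule skew_primitive_bottom[OF s2])
  have htop: "?h (real M + 1/2) = 0" using M by (intro skew_primitive_top) auto
  have ends: "C (int lo - 1) = 0" "C (int M) = 0"
    using case_s hbot htop by (auto simp: C_def)
  have C_x: "C (int x) = ?h (real x + 1/2)" "C (int x - 1) = ?h (real x - 1/2)" for x :: nat
    by (simp_all add: C_def)
  define L where "L R = (\<Sum>x\<in>{lo..M}. (C (int x) + C (int x - 1)) * poly R ((real x)\<^sup>2))" for R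
  \<comment> \<open>Summation by parts moves the sum of two values of the primitive onto the test polynomial. The sums have
    different ranges, but the primitive vanishes at the points in which they differ.\<close>
  have L_avg: "L R = (\<Sum>a\<le>M. ?h (real a + 1/2) * (poly R ((real a)\<^sup>2) + poly R ((real a + 1)\<^sup>2)))" for R
  proof -
    let ?f = "\<lambda>x. ?h (real x + 1/2) * poly R ((real x)\<^sup>2)" and ?g = "\<lambda>x. ?h (real x - 1/2) * poly R ((real x)\<^sup>2)"
    have split0: "sum f {0..M} = f 0 + sum f {1..M}" for f :: "nat \<Rightarrow> real"
      by (simp add: sum.atLeast_Suc_atMost)
    have "sum ?f {lo..M} = sum ?f {0..M}"
      using case_s hbot split0[of ?f] by auto
    moreover have "sum ?g {lo..M} = sum ?g {1..M}"
      using case_s hbot split0[of ?g] by auto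
    moreover have "sum ?g {1..M} = (\<Sum>a\<le>M. ?h (real a + 1/2) * poly R ((real a + 1)\<^sup>2))"
    proof -
      have "sum ?g {1..M} = (\<Sum>a<M. ?g (Suc a))" using sum.atLeast1_atMost_eq[of ?g M] by simp
      also have "\<dots> = (\<Sum>a<M. ?h (real a + 1/2) * poly R ((real a + 1)\<^sup>2))"
        by (intro sum.cong refl) (simp add: add.commute)
      finally show ?thesis using htop by (simp flip: lessThan_Suc_atMost)
    qed
    ultimately show ?thesis
      unfolding L_def C_x by (simp add: distrib_left distrib_right sum.distrib atMost_atLeast0)
  qed
  have L_add: "L (P + Q) = L P + L Q" for P Q by (simp add: L_def distrib_left sum.distrib)
  have L_smult: "L (smult c P) = c * L P" for c P by (simp add: L_def sum_distrib_left mult_ac)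
  have L_top_0: "L (top_poly M 0) = (\<Sum>a\<le>M. 2 * ?h (real a + 1/2) * ?t 0 a)"
    unfolding L_avg top_poly_average_0 by (intro sum.cong refl) simp
  have L_top_Suc: "L (top_poly M (Suc k)) = (\<Sum>a\<le>M. 2 * ?h (real a + 1/2) * ?t (Suc k) a)
      - (real k + 1) * (2 * real M + 1 + 2 * (real k + 1)) / 2 * (\<Sum>a\<le>M. 2 * ?h (real a + 1/2) * ?t k a)" for k
    unfolding L_avg top_poly_average_Suc sum_distrib_left sum_subtractf[symmetric]
    by (intro sum.cong refl) (simp add: right_diff_distrib mult_ac)
  have mom0: "(\<Sum>a\<le>M. 2 * ?h (real a + 1/2) * ?t k a) = 0" if "k < m" for k
    using that M by (intro skew_moment_low) auto
  have L_low: "L (top_poly M k) = 0" if "k < m" for k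
  proof (cases k)
    case 0
    then show ?thesis using mom0[of 0] that unfolding 0 L_top_0 by simp
  next
    case (Suc j)
    then show ?thesis using mom0[of j] mom0[of "Suc j"] that unfolding Suc L_top_Suc by simp
  qed
  have L_m: "L (top_poly M m) = (\<Sum>a\<le>M. 2 * ?h (real a + 1/2) * ?t m a)"
  proof (cases "m = 0")
    case True
    then show ?thesis using L_top_0 by simp
  next
    case False
    then obtain j where "m = Suc j" using not0_implies_Suc by blast
    then show ?thesis using L_top_Suc[of j] mom0[of j] by simp
  qed
  define Q where "Q = (fact m)\<^sup>2 * (fact (M + ?N) / fact (M - ?N)) * (real M + 1/2 - s * (real m + 3/2)) / fact (2 * ?N)"
  have L_m': "L (top_poly M m) = Q"
    unfolding L_m Q_def using skew_moment_top[of ?N M s] M by (simp add: algebra_simps del: fact_Suc)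
  have moments: "L R = coeff R m * ((- 1) ^ m * Q)" if "degree R \<le> m" for R
  proof -
    have "L R = coeff R m / coeff (top_poly M m) m * L (top_poly M m)"
    proof (rule linear_functional_triangular[of L "top_poly M" m R])
      show "top_poly M k \<noteq> 0" for k using coeff_top_poly[of M k] by auto
    qed (use that L_add L_smult L_low degree_top_poly in auto)
    then show ?thesis unfolding coeff_top_poly L_m' by (cases "even m") auto
  qed
  have main: "coeff ?P (Suc m) * sq_vandermonde_sum lo M (Suc (Suc m)) = - ((- 1) ^ m * Q) * sq_vandermonde_sum lo M m"
  proof (rule sq_vandermonde_sum_recursion[where C = C])
    show "lo \<le> M" using case_s M by auto
    show "poly ?P ((real x)\<^sup>2) = C (int x) - C (int x - 1)" for x
      unfolding C_x by (rule poly_skew_diff_poly)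
    show "(\<Sum>x\<in>{lo..M}. (C (int x) + C (int x - 1)) * poly R ((real x)\<^sup>2)) = coeff R m * ((- 1) ^ m * Q)"
      if "degree R \<le> m" for R
      using moments[OF that] by (simp add: L_def)
  qed (use ends degree_skew_diff_poly in auto)
  have lead: "coeff ?P (Suc m) = - ((- 1) ^ m * ((2 * real m + 3) * fact (2 * m + 1) / (fact (Suc m))\<^sup>2
      * (fact (M - ?N) / fact (M + ?N)) * (real M + 1/2 - s * (real m + 1/2))))"
  proof -
    have "(2 * real ?N + 1) * (2 * real ?N - 1) / (2 * real ?N) * (real ?N / (2 * real ?N + 1)) = real m + 1/2"
      by (simp add: divide_simps) (simp add: algebra_simps)
    then have sc: "s * ((2 * real ?N + 1) * (2 * real ?N - 1) / (2 * real ?N)) * (real ?N / (2 * real ?N + 1)) = s * (real m + 1/2)"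
      by (simp only: mult.assoc)
    have e: "?N + ?N - 1 = 2 * m + 1" "2 * real ?N + 1 = 2 * real m + 3" by auto
    show ?thesis
      unfolding coeff_skew_diff_poly skew_coeff_def sc
      unfolding e diff_self_eq_0 fact_0 power_Suc by (simp only: mult_1_right) (simp add: mult_ac del: fact_Suc)
  qed
  define S2 S0 where "S2 = sq_vandermonde_sum lo M (Suc (Suc m))" and "S0 = sq_vandermonde_sum lo M m"
  define u v where "u = real M + 1/2 - s * (real m + 1/2)" and "v = real M + 1/2 - s * (real m + 3/2)"
  define fa fb fc fd fn fm where "fa = (fact (M - ?N) :: real)" and "fb = (fact (M + ?N) :: real)"
    and "fc = (fact (2 * m + 1) :: real)" and "fd = (fact (2 * ?N) :: real)"
    and "fn = (fact ?N :: real)" and "fm = (fact m :: real)"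
  have pos: "fa \<noteq> 0" "fb \<noteq> 0" "fc \<noteq> 0" "fd \<noteq> 0" "fn \<noteq> 0"
    by (simp_all add: fa_def fb_def fc_def fd_def fn_def del: fact_Suc)
  have "(2 * real m + 3) * fc / fn\<^sup>2 * (fa / fb) * u * S2 = fm\<^sup>2 * (fb / fa) * v / fd * S0"
    using main unfolding lead Q_def fa_def[symmetric] fb_def[symmetric] fc_def[symmetric] fd_def[symmetric]
      fn_def[symmetric] fm_def[symmetric] u_def[symmetric] v_def[symmetric] S2_def[symmetric] S0_def[symmetric]
    by (cases "even m") auto
  then have eq: "((2 * real m + 3) * fd) * fc * fa\<^sup>2 * u * S2 = (fn * fm)\<^sup>2 * fb\<^sup>2 * v * S0"
    using pos by (simp add: field_simps power2_eq_square)
  have "fact (2 * m + 3) = (2 * real m + 3) * fd"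
  proof -
    have "2 * m + 3 = Suc (2 * ?N)" by simp
    then show ?thesis unfolding fd_def by (simp only: fact_Suc) simp
  qed
  then show ?thesis
    using eq unfolding fa_def[symmetric] fb_def[symmetric] fc_def[symmetric] fn_def[symmetric] fm_def[symmetric]
      u_def[symmetric] v_def[symmetric] S2_def[symmetric] S0_def[symmetric]
    by (simp only: ac_simps)
qed

text \<open>The value of \<open>sq_vandermonde_sum\<close>, in terms of \<open>M\<close> rather than \<open>r = M + 1 - n\<close>. The factor with index \<open>j = 0\<close> in the
  third product and the last factor together are \<open>1 / fact n\<close>; in this form the recursion covers \<open>n = 0\<close> as well.\<close>

definition sq_vandermonde_closed :: "real \<Rightarrow> nat \<Rightarrow> nat \<Rightarrow> real" where
  "sq_vandermonde_closed s M n = (\<Prod>j<n. fact (2 * j)) * (\<Prod>k<n. real M + 3/2 - s / 2 - real n + 2 * real k)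
     * (\<Prod>j<n. fact (M + j) * fact j / (fact (M + j - n) * fact (n + j))) * (fact (M - n) / fact M)"

text \<open>Passing from \<open>n\<close> to \<open>n + 2\<close> at fixed \<open>M\<close> changes each of the products by a few factors at its ends.\<close>

lemma closed_two_step:
  assumes M: "Suc (Suc n) \<le> M" and s: "s = 1 \<or> s = -1"
  shows "sq_vandermonde_closed s M (Suc (Suc n))
       * (fact (2 * n + 3) * fact (2 * n + 1) * (fact (M - Suc n))\<^sup>2 * (real M + 1/2 - s * (real n + 1/2)))
     = sq_vandermonde_closed s M n
       * ((fact (Suc n) * fact n)\<^sup>2 * (fact (M + Suc n))\<^sup>2 * (real M + 1/2 - s * (real n + 3/2)))"
proof -
  obtain d where d: "M = n + 2 + d" using M by (metis add_2_eq_Suc' le_Suc_ex)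
  define b where "b = real M + 3/2 - s / 2"
  define A where "A n = (\<Prod>j<n. fact (2 * j) :: real)" for n :: nat
  define B where "B n = (\<Prod>k<n. b - real n + 2 * real k)" for n :: nat
  define P where "P n = (\<Prod>j<n. fact (M + j) :: real)" for n :: nat
  define D where "D n = (\<Prod>j<n. fact j :: real)" for n :: nat
  define e where "e n = (\<Prod>j<n. fact (M + j - n) :: real)" for n :: nat
  define F where "F n = (\<Prod>j<n. fact (n + j) :: real)" for n :: nat
  have closed: "sq_vandermonde_closed s M n = A n * B n * (P n * D n / (e n * F n)) * (fact (M - n) / fact M)" for n
    unfolding sq_vandermonde_closed_def A_def B_def P_def D_def e_def F_def b_def
    by (simp add: prod_dividef prod.distrib)
  have A: "A (Suc (Suc n)) = A n * fact (2 * n) * fact (2 * n + 2)"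
    by (simp add: A_def del: fact_Suc)
  have B: "B (Suc (Suc n)) = B n * ((b - real n - 2) * (b + real n))"
    unfolding B_def prod.lessThan_Suc_shift[of _ "Suc n"] by (simp add: algebra_simps)
  have P: "P (Suc (Suc n)) = P n * fact (M + n) * fact (M + n + 1)"
    by (simp add: P_def del: fact_Suc)
  have D: "D (Suc (Suc n)) = D n * fact n * fact (Suc n)"
    by (simp add: D_def del: fact_Suc)
  have e: "e (Suc (Suc n)) = fact (M - n - 2) * fact (M - n - 1) * e n"
    unfolding e_def prod.lessThan_Suc_shift by (simp add: d del: fact_Suc prod.lessThan_Suc)
  have F: "F (Suc (Suc n)) = F n * fact (2 * n) * fact (2 * n + 1) * fact (2 * n + 2) * fact (2 * n + 3) / (fact n * fact (Suc n))"
  proof -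
    have "F n * fact (n + n) * fact (n + Suc n) * fact (n + Suc (Suc n)) * fact (n + Suc (Suc (Suc n)))
        = (\<Prod>j<Suc (Suc (Suc (Suc n))). fact (n + j))"
      by (simp add: F_def del: fact_Suc)
    also have "\<dots> = fact n * fact (Suc n) * F (Suc (Suc n))"
      unfolding F_def prod.lessThan_Suc_shift[of _ "Suc (Suc (Suc n))"] prod.lessThan_Suc_shift[of _ "Suc (Suc n)"]
      by (simp add: del: fact_Suc prod.lessThan_Suc)
    finally have "fact n * fact (Suc n) * F (Suc (Suc n))
        = F n * fact (2 * n) * fact (2 * n + 1) * fact (2 * n + 2) * fact (2 * n + 3)"
      by (simp add: mult_2 numeral_3_eq_3 del: fact_Suc)
    then show ?thesis by (simp add: nonzero_eq_divide_eq mult_ac del: fact_Suc)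
  qed
  define u v where "u = real M + 1/2 - s * (real n + 1/2)" and "v = real M + 1/2 - s * (real n + 3/2)"
  have key: "((b - real n - 2) * (b + real n)) * fact (M + n) * fact (M - n - 1) * u = fact (M + n + 1) * fact (M - n) * v"
  proof -
    have f: "fact (M + n + 1) = (real M + real n + 1) * fact (M + n)"
      "fact (M - n) = (real M - real n) * fact (M - n - 1)"
      by (simp_all add: d algebra_simps)
    have "b = real M + 1 \<and> u = real M - real n \<and> v = real M - real n - 1
        \<or> b = real M + 2 \<and> u = real M + real n + 1 \<and> v = real M + real n + 2"
      using s by (auto simp: b_def u_def v_def)
    then have "(b - real n - 2) * (b + real n) * u = (real M + real n + 1) * (real M - real n) * v"
    proof (elim disjE conjE, goal_cases)
      case 1
      then show ?case by (simp only:) (simp add: algebra_simps)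
    next
      case 2
      then show ?case by (simp only:) (simp add: algebra_simps)
    qed
    then have "(b - real n - 2) * (b + real n) * u * (fact (M + n) * fact (M - n - 1))
        = (real M + real n + 1) * (real M - real n) * v * (fact (M + n) * fact (M - n - 1))" by simp
    then show ?thesis unfolding f by (simp only: ac_simps)
  qed
  have alg: "A * p0 * p2 * (B * w) * (P * g1 * g2 * (D * h0 * h1) / (k2 * k1 * e * (F * p0 * p1 * p2 * p3 / (h0 * h1)))) * (k2 / m)
      * (p3 * p1 * k1\<^sup>2 * u) = A * B * (P * D / (e * F)) * (k0 / m) * ((h1 * h0)\<^sup>2 * g2\<^sup>2 * v)"
    if key: "w * g1 * k1 * u = g2 * k0 * v"
      and nz: "p0 \<noteq> 0" "p1 \<noteq> 0" "p2 \<noteq> 0" "p3 \<noteq> 0" "h0 \<noteq> 0" "h1 \<noteq> 0" "k1 \<noteq> 0" "k2 \<noteq> 0" "e \<noteq> 0" "F \<noteq> 0" "m \<noteq> 0"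
    for A B P D e F p0 p1 p2 p3 w g1 g2 h0 h1 k0 k1 k2 m u v :: real
  proof -
    have "A * p0 * p2 * (B * w) * (P * g1 * g2 * (D * h0 * h1) / (k2 * k1 * e * (F * p0 * p1 * p2 * p3 / (h0 * h1)))) * (k2 / m)
      * (p3 * p1 * k1\<^sup>2 * u) = A * B * P * D * g2 * (h0 * h1)\<^sup>2 / (e * F * m) * (w * g1 * k1 * u)"
      using nz by (simp add: divide_simps power2_eq_square)
    then show ?thesis unfolding key by (simp add: power2_eq_square mult_ac)
  qed
  have nz: "e n \<noteq> 0" "F n \<noteq> 0" by (simp_all add: e_def F_def)
  have sub: "M - Suc (Suc n) = M - n - 2" "M - Suc n = M - n - 1" "M + Suc n = M + n + 1" by auto
  show ?thesis
    unfolding closed A B P D e F sub u_def[symmetric] v_def[symmetric]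
    by (rule alg[OF key]) (simp_all add: nz del: fact_Suc)
qed

lemma sq_vandermonde_sum_closed:
  assumes "(s = 1 \<and> lo = 1) \<or> (s = -1 \<and> lo = 0)" and "n \<le> M"
  shows "sq_vandermonde_sum lo M n = sq_vandermonde_closed s M n"
  using assms(2)
proof (induction n rule: induct_nat_012)
  case 0
  have "{A. A \<subseteq> {lo..M} \<and> card A = 0} = {{}}"
    by (auto simp: card_eq_0_iff dest: finite_subset)
  then show ?case by (simp add: sq_vandermonde_sum_def sq_vandermonde_closed_def)
next
  case 1
  have "{A. A \<subseteq> {lo..M} \<and> card A = 1} = (\<lambda>x. {x}) ` {lo..M}" by (auto simp: card_1_singleton_iff)
  then have "sq_vandermonde_sum lo M 1 = real (card {lo..M})"
    unfolding sq_vandermonde_sum_def by (simp add: sum.reindex)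
  moreover have "sq_vandermonde_closed s M 1 = real M + 1/2 - s / 2"
    by (simp add: sq_vandermonde_closed_def)
  ultimately show ?case using assms(1) by auto
next
  case (ge2 n)
  let ?X = "fact (2 * n + 3) * fact (2 * n + 1) * (fact (M - Suc n))\<^sup>2 * (real M + 1/2 - s * (real n + 1/2))"
  have s: "s = 1 \<or> s = -1" using assms(1) by auto
  have "real M + 1/2 - s * (real n + 1/2) > 0" using s ge2.prems by auto
  then have "?X \<noteq> 0" by simp
  moreover have "sq_vandermonde_sum lo M (Suc (Suc n)) * ?X = sq_vandermonde_closed s M (Suc (Suc n)) * ?X"
    using sq_vandermonde_sum_two_step[OF assms(1), of n M] closed_two_step[OF ge2.prems s] ge2 by simp
  ultimately show ?case by simp
qed

lemma box_product:
  assumes r: "r \<ge> 1" and n: "n \<ge> 1"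
  shows "(\<Prod>j<n. fact (r + n - 1 + j) * fact j / (fact (r + n - 1 + j - n) * fact (n + j)))
       * (fact (r + n - 1 - n) / fact (r + n - 1))
     = (\<Prod>i = 1..n. \<Prod>j = 1..n - 1. (real i + real j + real r - 1) / (real i + real j)) / fact n"
proof -
  let ?f = "\<lambda>j. fact (r + n - 1 + j) * fact j / (fact (r + n - 1 + j - n) * fact (n + j)) :: real"
  have row: "?f j = (\<Prod>i = 1..n. (real i + real j + real r - 1) / (real i + real j))" for j
  proof -
    have top: "fact (r + n - 1 + j) = fact (r + n - 1 + j - n) * (\<Prod>i = 1..n. real i + real j + real r - 1)"
    proof -
      have "r + n - 1 + j = (r + n - 1 + j - n) + n" using r by simp
      then have "fact (r + n - 1 + j) = fact (r + n - 1 + j - n) * pochhammer (real (r + n - 1 + j - n) + 1) n"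
        using fact_add_pochhammer[of "r + n - 1 + j - n" n] by (simp only:)
      also have "real (r + n - 1 + j - n) + 1 = real r + real j" using r by (simp add: of_nat_diff)
      also have "pochhammer (real r + real j) n = (\<Prod>i = 1..n. real i + real j + real r - 1)"
        unfolding pochhammer_prod
        by (rule prod.reindex_bij_witness[of _ "\<lambda>i. i - 1" Suc]) auto
      finally show ?thesis .
    qed
    have bot: "fact (n + j) = fact j * (\<Prod>i = 1..n. real i + real j)"
    proof -
      have "fact (j + n) = fact j * pochhammer (real j + 1) n" by (rule fact_add_pochhammer)
      also have "pochhammer (real j + 1) n = (\<Prod>i = 1..n. real i + real j)"
        unfolding pochhammer_prod by (rule prod.reindex_bij_witness[of _ "\<lambda>i. i - 1" Suc]) auto
      finally show ?thesis by (simp add: add.commute)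
    qed
    show ?thesis unfolding top bot prod_dividef by simp
  qed
  have "{..<n} = insert 0 {1..n - 1}" using n by auto
  then have "(\<Prod>j<n. ?f j) = ?f 0 * (\<Prod>j = 1..n - 1. ?f j)" by simp
  then have "(\<Prod>j<n. ?f j) * (fact (r + n - 1 - n) / fact (r + n - 1)) = (\<Prod>j = 1..n - 1. ?f j) / fact n"
    by simp
  also have "(\<Prod>j = 1..n - 1. ?f j) = (\<Prod>i = 1..n. \<Prod>j = 1..n - 1. (real i + real j + real r - 1) / (real i + real j))"
    unfolding row by (rule prod.swap)
  finally show ?thesis .
qed

lemma sq_vandermonde_sum_formula:
  assumes case_s: "(s = 1 \<and> lo = 1) \<or> (s = -1 \<and> lo = 0)" and r: "r \<ge> 1" and n: "n \<ge> 1"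
  shows "2 ^ n * sq_vandermonde_sum lo (r + n - 1) n / (\<Prod>j<n. fact (2 * j))
     = 2 ^ (2 * n) * (pochhammer (real r / 2 + (1 - s) / 4) n / fact n)
       * (\<Prod>i = 1..n. \<Prod>j = 1..n - 1. (real i + real j + real r - 1) / (real i + real j))"
proof -
  have "(\<Prod>k<n. real (r + n - 1) + 3/2 - s / 2 - real n + 2 * real k) = (\<Prod>k<n. 2 * (real r / 2 + (1 - s) / 4 + real k))"
    using r by (intro prod.cong refl) (simp add: of_nat_diff field_simps)
  also have "\<dots> = 2 ^ n * pochhammer (real r / 2 + (1 - s) / 4) n"
    unfolding prod.distrib pochhammer_prod atLeast0LessThan by simp
  finally have B: "(\<Prod>k<n. real (r + n - 1) + 3/2 - s / 2 - real n + 2 * real k)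
      = 2 ^ n * pochhammer (real r / 2 + (1 - s) / 4) n" .
  have "n \<le> r + n - 1" using r by simp
  then have "sq_vandermonde_sum lo (r + n - 1) n = (\<Prod>j<n. fact (2 * j)) * (2 ^ n * pochhammer (real r / 2 + (1 - s) / 4) n)
     * ((\<Prod>i = 1..n. \<Prod>j = 1..n - 1. (real i + real j + real r - 1) / (real i + real j)) / fact n)"
    unfolding sq_vandermonde_sum_closed[OF case_s \<open>n \<le> r + n - 1\<close>] sq_vandermonde_closed_def B
      box_product[OF r n, symmetric] by (simp only: mult.assoc)
  moreover have "(\<Prod>j<n. fact (2 * j) :: real) \<noteq> 0" by simp
  moreover have "(2 :: real) ^ (2 * n) = 2 ^ n * 2 ^ n" by (simp add: mult_2 power_add)
  ultimately show ?thesis by (simp add: mult_ac)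
qed

section \<open>Determinants\<close>

text \<open>Sequences of \<open>k\<close> numbers with independent ranges, extended by zeros: the form in which the smaller shapes occur.\<close>

definition box :: "nat \<Rightarrow> (nat \<Rightarrow> nat set) \<Rightarrow> (nat \<Rightarrow> nat) set" where
  "box k S = {\<kappa>. (\<forall>i<k. \<kappa> i \<in> S i) \<and> (\<forall>i\<ge>k. \<kappa> i = 0)}"

lemma finite_box:
  assumes "\<And>i. i < k \<Longrightarrow> finite (S i)"
  shows "finite (box k S)"
proof -
  have "box k S \<subseteq> (\<lambda>x i. if i < k then x i else 0) ` (\<Pi>\<^sub>E i\<in>{..<k}. S i)"
  proof
    fix \<kappa> assume "\<kappa> \<in> box k S"
    then show "\<kappa> \<in> (\<lambda>x i. if i < k then x i else 0) ` (\<Pi>\<^sub>E i\<in>{..<k}. S i)"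
      by (intro image_eqI[of _ _ "restrict \<kappa> {..<k}"]) (auto simp: box_def fun_eq_iff)
  qed
  moreover have "finite (\<Pi>\<^sub>E i\<in>{..<k}. S i)" using assms by (intro finite_PiE) auto
  ultimately show ?thesis using finite_surj by blast
qed

lemma sum_prod_box:
  fixes f :: "nat \<Rightarrow> nat \<Rightarrow> 'a :: comm_semiring_1"
  assumes "\<And>i. i < k \<Longrightarrow> finite (S i)"
  shows "(\<Sum>\<kappa>\<in>box k S. \<Prod>i<k. f i (\<kappa> i)) = (\<Prod>i<k. \<Sum>y\<in>S i. f i y)"
proof -
  have "(\<Prod>i<k. \<Sum>y\<in>S i. f i y) = (\<Sum>x\<in>(\<Pi>\<^sub>E i\<in>{..<k}. S i). \<Prod>i<k. f i (x i))"
    using assms by (intro prod_sum_PiE) auto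
  also have "\<dots> = (\<Sum>\<kappa>\<in>box k S. \<Prod>i<k. f i (\<kappa> i))"
  proof (rule sum.reindex_bij_witness[of _ "\<lambda>\<kappa>. restrict \<kappa> {..<k}" "\<lambda>x i. if i < k then x i else 0"])
    fix x assume x: "x \<in> (\<Pi>\<^sub>E i\<in>{..<k}. S i)"
    show "restrict (\<lambda>i. if i < k then x i else 0) {..<k} = x"
      using PiE_arb[OF x] by (intro ext) (simp add: restrict_def)
    show "(\<lambda>i. if i < k then x i else 0) \<in> box k S"
      using x by (simp add: box_def PiE_mem)
    show "(\<Prod>i<k. f i (if i < k then x i else 0)) = (\<Prod>i<k. f i (x i))"
      by (intro prod.cong) simp_all
  next
    fix \<kappa> assume \<kappa>: "\<kappa> \<in> box k S"
    show "(\<lambda>i. if i < k then restrict \<kappa> {..<k} i else 0) = \<kappa>"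
      using \<kappa> by (intro ext) (simp add: box_def)
    show "restrict \<kappa> {..<k} \<in> (\<Pi>\<^sub>E i\<in>{..<k}. S i)"
      using \<kappa> by (intro restrict_PiE_iff[THEN iffD2]) (simp add: box_def)
  qed
  finally show ?thesis ..
qed

lemma det_leibniz:
  fixes G :: "nat \<Rightarrow> nat \<Rightarrow> real"
  shows "det (mat k k (\<lambda>(i, j). G i j)) = (\<Sum>p | p permutes {0..<k}. signof p * (\<Prod>i<k. G i (p i)))"
proof -
  have "det (mat k k (\<lambda>(i, j). G i j))
      = (\<Sum>p | p permutes {0..<k}. signof p * (\<Prod>i = 0..<k. mat k k (\<lambda>(i, j). G i j) $$ (i, p i)))"
    by (rule det_def') simp
  also have "\<dots> = (\<Sum>p | p permutes {0..<k}. signof p * (\<Prod>i<k. G i (p i)))"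
  proof (intro sum.cong refl arg_cong2[where f = "(*)"])
    fix p assume "p \<in> {p. p permutes {0..<k}}"
    then have "p i < k" if "i < k" for i
      using permutes_in_image[of p "{0..<k}" i] that by simp
    then show "(\<Prod>i = 0..<k. mat k k (\<lambda>(i, j). G i j) $$ (i, p i)) = (\<Prod>i<k. G i (p i))"
      unfolding lessThan_atLeast0 by (intro prod.cong) simp_all
  qed
  finally show ?thesis .
qed

text \<open>A determinant is linear in each row.\<close>

lemma det_sum_rows:
  fixes F :: "nat \<Rightarrow> nat \<Rightarrow> nat \<Rightarrow> real"
  assumes "\<And>i. i < k \<Longrightarrow> finite (S i)"
  shows "(\<Sum>\<kappa>\<in>box k S. det (mat k k (\<lambda>(i, j). F i (\<kappa> i) j))) = det (mat k k (\<lambda>(i, j). \<Sum>y\<in>S i. F i y j))"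
proof -
  have "(\<Sum>\<kappa>\<in>box k S. det (mat k k (\<lambda>(i, j). F i (\<kappa> i) j)))
      = (\<Sum>p | p permutes {0..<k}. signof p * (\<Sum>\<kappa>\<in>box k S. \<Prod>i<k. F i (\<kappa> i) (p i)))"
    unfolding det_leibniz sum_distrib_left by (rule sum.swap)
  also have "\<dots> = det (mat k k (\<lambda>(i, j). \<Sum>y\<in>S i. F i y j))"
  proof -
    have "(\<Sum>\<kappa>\<in>box k S. \<Prod>i<k. F i (\<kappa> i) (p i)) = (\<Prod>i<k. \<Sum>y\<in>S i. F i y (p i))" for p
      by (rule sum_prod_box[OF assms, where f = "\<lambda>i y. F i y (p i)"])
    then show ?thesis unfolding det_leibniz by (simp only:)
  qed
  finally show ?thesis .
qed

lemma det_scale_rows_cols: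
  fixes a :: "nat \<Rightarrow> nat \<Rightarrow> real"
  shows "det (mat k k (\<lambda>(i, j). r i * a i j * s j)) = (\<Prod>i<k. r i) * det (mat k k (\<lambda>(i, j). a i j)) * (\<Prod>j<k. s j)"
proof -
  have perm: "(\<Prod>i<k. s (p i)) = (\<Prod>i<k. s i)" if "p permutes {0..<k}" for p
    using prod.permute[OF that, of s] by (simp add: o_def lessThan_atLeast0)
  have "det (mat k k (\<lambda>(i, j). r i * a i j * s j))
      = (\<Sum>p | p permutes {0..<k}. (\<Prod>i<k. r i) * (signof p * (\<Prod>i<k. a i (p i))) * (\<Prod>i<k. s i))"
    unfolding det_leibniz by (intro sum.cong refl) (simp add: prod.distrib perm)
  then show ?thesis
    unfolding det_leibniz by (simp only: sum_distrib_left [symmetric] sum_distrib_right [symmetric])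
qed

text \<open>Subtracting the next row from each row is multiplication by a unitriangular matrix.\<close>

lemma det_row_differences:
  fixes a :: "nat \<Rightarrow> nat \<Rightarrow> real"
  shows "det (mat k k (\<lambda>(i, j). a i j - (if Suc i < k then a (Suc i) j else 0))) = det (mat k k (\<lambda>(i, j). a i j))"
proof -
  define U where "U = mat k k (\<lambda>(i, j). if j = i then 1 else if j = Suc i then - 1 else 0 :: real)"
  define A where "A = mat k k (\<lambda>(i, j). a i j)"
  have car: "U \<in> carrier_mat k k" "A \<in> carrier_mat k k" by (auto simp: U_def A_def)
  have "mat k k (\<lambda>(i, j). a i j - (if Suc i < k then a (Suc i) j else 0)) = U * A"
  proof (rule eq_matI)
    fix i j assume "i < dim_row (U * A)" "j < dim_col (U * A)"
    then have ij: "i < k" "j < k" by (auto simp: U_def A_def)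
    have "(U * A) $$ (i, j) = (\<Sum>l\<in>{0..<k}. (if l = i then a l j else 0) + (if l = Suc i then - a l j else 0))"
      using ij by (auto simp: U_def A_def scalar_prod_def intro!: sum.cong)
    also have "\<dots> = a i j - (if Suc i < k then a (Suc i) j else 0)"
      using ij by (simp add: sum.distrib)
    finally show "mat k k (\<lambda>(i, j). a i j - (if Suc i < k then a (Suc i) j else 0)) $$ (i, j) = (U * A) $$ (i, j)"
      using ij by simp
  qed (auto simp: U_def A_def)
  moreover have "det U = 1"
  proof -
    have "upper_triangular U" by (auto simp: U_def upper_triangular_def)
    then have "det U = prod_list (diag_mat U)" using car by (intro det_upper_triangular) auto
    also have "diag_mat U = map (\<lambda>_. 1) [0..<k]" by (auto simp: diag_mat_def U_def intro!: map_cong)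
    finally show ?thesis by (simp add: map_replicate_const prod_list_replicate)
  qed
  ultimately show ?thesis using det_mult[OF car] by (simp add: A_def)
qed

lemma det_last_column_unit:
  fixes a :: "nat \<Rightarrow> nat \<Rightarrow> real"
  assumes "\<And>i. i < k \<Longrightarrow> a i k = 0" and "a k k = 1"
  shows "det (mat (Suc k) (Suc k) (\<lambda>(i, j). a i j)) = det (mat k k (\<lambda>(i, j). a i j))"
proof -
  let ?A = "mat (Suc k) (Suc k) (\<lambda>(i, j). a i j)"
  have "det ?A = (\<Sum>i<Suc k. ?A $$ (i, k) * cofactor ?A i k)"
    by (rule laplace_expansion_column[of _ "Suc k"]) auto
  also have "\<dots> = cofactor ?A k k" using assms by simp
  also have "\<dots> = det (mat_delete ?A k k)"
    by (simp add: cofactor_def flip: power_add mult_2)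
  also have "mat_delete ?A k k = mat k k (\<lambda>(i, j). a i j)"
    by (rule eq_matI) (auto simp: mat_delete_def)
  finally show ?thesis .
qed

text \<open>The Laplace expansion along the first column is \<open>sq_vandermonde_expand\<close>. The columns are in order of descending degree
  because \<open>c\<close> descends, which makes the determinant positive.\<close>

lemma det_sq_vandermonde:
  fixes p :: "nat \<Rightarrow> real poly" and c :: "nat \<Rightarrow> nat"
  assumes p: "\<And>m. degree (p m) = m" "\<And>m. coeff (p m) m = 1"
    and dec: "\<And>i j. i < j \<Longrightarrow> j < n \<Longrightarrow> c j < c i"
  shows "det (mat n n (\<lambda>(i, j). poly (p (n - 1 - j)) ((real (c i))\<^sup>2))) = sq_vandermonde (c ` {..<n})"
  using dec
proof (induction n arbitrary: c)
  case 0
  show ?case by simp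
next
  case (Suc n)
  let ?A = "mat (Suc n) (Suc n) (\<lambda>(i, j). poly (p (Suc n - 1 - j)) ((real (c i))\<^sup>2))"
  have inj: "inj_on c {..<Suc n}"
  proof (rule inj_onI)
    fix a b assume "a \<in> {..<Suc n}" "b \<in> {..<Suc n}" "c a = c b"
    then show "a = b" using Suc.prems[of a b] Suc.prems[of b a] by (cases a b rule: linorder_cases) auto
  qed
  have cof: "?A $$ (i, 0) * cofactor ?A i 0
      = sign_above (c i) (c ` {..<Suc n}) * poly (p n) ((real (c i))\<^sup>2) * sq_vandermonde (c ` {..<Suc n} - {c i})"
    if i: "i < Suc n" for i
  proof -
    let ?c = "\<lambda>l. c (insert_index i l)"
    have "mat_delete ?A i 0 = mat n n (\<lambda>(l, j). poly (p (n - 1 - j)) ((real (?c l))\<^sup>2))"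
      by (rule eq_matI) (auto simp: mat_delete_def insert_index_def)
    moreover have "det (mat n n (\<lambda>(l, j). poly (p (n - 1 - j)) ((real (?c l))\<^sup>2))) = sq_vandermonde (?c ` {..<n})"
    proof (rule Suc.IH)
      show "?c b < ?c a" if "a < b" "b < n" for a b
        using that Suc.prems[of "insert_index i a" "insert_index i b"] by (auto simp: insert_index_def split: if_splits)
    qed
    ultimately have "det (mat_delete ?A i 0) = sq_vandermonde (?c ` {..<n})" by simp
    moreover have "?c ` {..<n} = c ` {..<Suc n} - {c i}"
    proof -
      have "insert_index i ` {..<n} = {..<Suc n} - {i}"
        using insert_index_image[of i n] i by (simp add: lessThan_atLeast0)
      moreover have "?c ` {..<n} = c ` insert_index i ` {..<n}" by (simp add: image_image)
      ultimately have "?c ` {..<n} = c ` ({..<Suc n} - {i})" by simp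
      also have "\<dots> = c ` {..<Suc n} - {c i}"
        using inj i by (subst inj_on_image_set_diff[OF inj]) auto
      finally show ?thesis .
    qed
    moreover have "sign_above (c i) (c ` {..<Suc n}) = (- 1) ^ i"
    proof -
      have "{a \<in> c ` {..<Suc n}. c i < a} = c ` {..<i}"
      proof (intro equalityI subsetI)
        fix a assume "a \<in> {a \<in> c ` {..<Suc n}. c i < a}"
        then obtain l where l: "l < Suc n" "a = c l" "c i < c l" by auto
        then have "l < i" using Suc.prems[of i l] by (cases i l rule: linorder_cases) auto
        then show "a \<in> c ` {..<i}" using l by auto
      next
        fix a assume "a \<in> c ` {..<i}"
        then obtain l where "l < i" "a = c l" by auto
        then show "a \<in> {a \<in> c ` {..<Suc n}. c i < a}" using Suc.prems[of l i] i by auto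
      qed
      moreover have "card (c ` {..<i}) = i"
        using inj i by (subst card_image) (auto intro: inj_on_subset)
      ultimately show ?thesis by (simp add: sign_above_def)
    qed
    ultimately show ?thesis using i by (simp add: cofactor_def )
  qed
  have "det ?A = (\<Sum>i<Suc n. ?A $$ (i, 0) * cofactor ?A i 0)"
    by (rule laplace_expansion_column[of _ "Suc n"]) auto
  also have "\<dots> = (\<Sum>i\<in>{..<Suc n}. sign_above (c i) (c ` {..<Suc n}) * poly (p n) ((real (c i))\<^sup>2)
      * sq_vandermonde (c ` {..<Suc n} - {c i}))"
    by (intro sum.cong refl cof) auto
  also have "\<dots> = (\<Sum>x\<in>c ` {..<Suc n}. sign_above x (c ` {..<Suc n}) * poly (p n) ((real x)\<^sup>2)
      * sq_vandermonde (c ` {..<Suc n} - {x}))"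
    by (simp add: sum.reindex[OF inj])
  also have "\<dots> = sq_vandermonde (c ` {..<Suc n})"
    using sq_vandermonde_expand[of "c ` {..<Suc n}" "p n"] p by (simp add: card_image[OF inj])
  finally show ?case by simp
qed

section \<open>Peeling off the largest letter\<close>

text \<open>The letters \<open>Plain 1, Barred 1, Plain 2, Barred 2, \<dots>\<close> in increasing order. The numbering starts with \<open>Plain 1\<close>, below
  the smallest letter that can occur, so that level 0 leaves only the empty tableau.\<close>

definition level :: "nat \<Rightarrow> letter" where
  "level m = (if odd m then Barred ((m + 1) div 2) else Plain (m div 2 + 1))"

lemma le_level_Suc: "x \<le> level (Suc m) \<longleftrightarrow> x \<le> level m \<or> x = level (Suc m)"
  by (cases x) (auto simp: level_def less_eq_letter_def elim!: oddE evenE, presburger+)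

lemma level_less: "level m < level (Suc m)"
  by (auto simp: level_def less_letter_def elim!: oddE evenE)

lemma less_level_Suc: "x < level (Suc m) \<longleftrightarrow> x \<le> level m"
  using le_level_Suc[of x m] level_less[of m] by (auto simp: le_less)

lemma Barred_le_level: "Barred (Suc i) \<le> level m \<longleftrightarrow> 2 * i < m"
  by (auto simp: level_def less_eq_letter_def elim!: oddE evenE)

lemma le_Infty [simp]: "x \<le> Infty"
  by (simp add: less_eq_letter_def)

lemma less_Infty_iff: "x < Infty \<longleftrightarrow> x \<noteq> Infty"
  by (simp add: less_le)

lemma sorted_split_top:
  fixes xs :: "'a :: linorder list"
  assumes "sorted xs" and "\<forall>x\<in>set xs. x \<le> v"
  shows "xs = filter (\<lambda>x. x < v) xs @ replicate (length xs - length (filter (\<lambda>x. x < v) xs)) v"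
  using assms
proof (induction xs)
  case (Cons x xs)
  show ?case
  proof (cases "x < v")
    case True
    let ?F = "filter (\<lambda>x. x < v) xs"
    have "xs = ?F @ replicate (length xs - length ?F) v" by (rule Cons.IH) (use Cons.prems in auto)
    then have "x # xs = x # (?F @ replicate (length xs - length ?F) v)" by (rule arg_cong)
    also have "\<dots> = filter (\<lambda>x. x < v) (x # xs)
        @ replicate (length (x # xs) - length (filter (\<lambda>x. x < v) (x # xs))) v"
      using True by simp
    finally show ?thesis .
  next
    case False
    then have "\<forall>y\<in>set (x # xs). y = v" using Cons.prems by force
    then have "filter (\<lambda>x. x < v) (x # xs) = []" "x # xs = replicate (length (x # xs)) v"
      by (auto simp: filter_empty_conv replicate_length_same)
    then show ?thesis by simp
  qed
qed simp

text \<open>Rows are a function on all natural numbers, empty from some point on, so that the number of rows need not be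
  tracked while letters are removed.\<close>

definition tableaux :: "nat \<Rightarrow> (nat \<Rightarrow> nat) \<Rightarrow> (nat \<Rightarrow> letter list) set" where
  "tableaux m \<nu> = {T. (\<forall>i. length (T i) = \<nu> i \<and> sorted (T i) \<and> set (T i) \<subseteq> {Barred (Suc i)..level m})
      \<and> (\<forall>i c. c < \<nu> (Suc i) \<longrightarrow> T i ! c < T (Suc i) ! c)}"

text \<open>Delete the occurrences of the largest letter. Columns are strict exactly if no part of the smaller shape is less than the
  next part of the larger one, and a row is empty as long as its lower bound exceeds all letters.\<close>

lemma peel_level:
  assumes anti: "\<And>i. \<nu> (Suc i) \<le> \<nu> i" and supp: "\<And>i. m < 2 * i \<Longrightarrow> \<nu> i = 0"
  defines "K \<equiv> {\<kappa>. \<forall>i. \<nu> (Suc i) \<le> \<kappa> i \<and> \<kappa> i \<le> \<nu> i \<and> (m \<le> 2 * i \<longrightarrow> \<kappa> i = 0)}"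
  shows "\<exists>f. bij_betw f (tableaux (Suc m) \<nu>) (SIGMA \<kappa>:K. tableaux m \<kappa>)"
proof -
  let ?v = "level (Suc m)"
  define del where "del T = (\<lambda>i. filter (\<lambda>x. x < ?v) (T i))" for T :: "nat \<Rightarrow> letter list"
  define f where "f T = (\<lambda>i. length (del T i), del T)" for T :: "nat \<Rightarrow> letter list"
  define g where "g = (\<lambda>(\<kappa>, T). \<lambda>i. T i @ replicate (\<nu> i - \<kappa> i) ?v)"
  have "bij_betw f (tableaux (Suc m) \<nu>) (SIGMA \<kappa>:K. tableaux m \<kappa>)"
  proof (rule bij_betw_byWitness[where f' = g])
    have split: "T i = del T i @ replicate (\<nu> i - length (del T i)) ?v" if "T \<in> tableaux (Suc m) \<nu>" for T i
    proof -
      have len: "\<nu> i = length (T i)" and srt: "sorted (T i)" and "set (T i) \<subseteq> {Barred (Suc i)..?v}"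
        using that by (auto simp: tableaux_def)
      then have top: "\<forall>x\<in>set (T i). x \<le> ?v" by auto
      show ?thesis unfolding del_def len by (rule sorted_split_top[OF srt top])
    qed
    show "\<forall>T\<in>tableaux (Suc m) \<nu>. g (f T) = T"
    proof (intro ballI ext)
      fix T i assume T: "T \<in> tableaux (Suc m) \<nu>"
      have "g (f T) i = del T i @ replicate (\<nu> i - length (del T i)) ?v" by (simp add: f_def g_def)
      also have "\<dots> = T i" by (rule split[OF T, symmetric])
      finally show "g (f T) i = T i" .
    qed
    show "f ` tableaux (Suc m) \<nu> \<subseteq> (SIGMA \<kappa>:K. tableaux m \<kappa>)"
    proof (intro subsetI, elim imageE)
      fix p T assume p: "p = f T" and T: "T \<in> tableaux (Suc m) \<nu>"
      let ?\<kappa> = "\<lambda>i. length (del T i)"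
      have len: "length (T i) = \<nu> i" and srt: "sorted (T i)" and ent: "set (T i) \<subseteq> {Barred (Suc i)..?v}" for i
        using T by (auto simp: tableaux_def)
      have col: "T i ! c < T (Suc i) ! c" if "c < \<nu> (Suc i)" for i c using T that by (auto simp: tableaux_def)
      have del_ent: "set (del T i) \<subseteq> {Barred (Suc i)..level m}" for i
        using ent[of i] by (auto simp: del_def less_level_Suc)
      have le: "?\<kappa> i \<le> \<nu> i" for i using len[of i] length_filter_le[of _ "T i"] by (auto simp: del_def)
      have old: "del T i ! c = T i ! c" if "c < ?\<kappa> i" for i c
        using that by (subst split[OF T, of i]) (simp add: nth_append)
      have new: "T i ! c = ?v" if "?\<kappa> i \<le> c" "c < \<nu> i" for i c
        using that le[of i] by (subst split[OF T, of i]) (simp add: nth_append)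
      have inter: "\<nu> (Suc i) \<le> ?\<kappa> i" for i
      proof (rule ccontr)
        assume "\<not> ?thesis"
        then have c: "?\<kappa> i < \<nu> (Suc i)" by simp
        then have "T i ! ?\<kappa> i = ?v" using anti[of i] by (intro new) auto
        moreover have "T (Suc i) ! ?\<kappa> i \<in> set (T (Suc i))" using c len[of "Suc i"] by simp
        then have "T (Suc i) ! ?\<kappa> i \<le> ?v" using ent[of "Suc i"] by auto
        ultimately show False using col[OF c] by simp
      qed
      have zero: "?\<kappa> i = 0" if "m \<le> 2 * i" for i
      proof (rule ccontr)
        assume "?\<kappa> i \<noteq> 0"
        then obtain x where "x \<in> set (del T i)" by (cases "del T i") auto
        then have "Barred (Suc i) \<le> level m" using del_ent[of i] by (meson atLeastAtMost_iff order_trans subsetD)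
        then show False using that by (simp add: Barred_le_level)
      qed
      have "?\<kappa> \<in> K" using inter le zero by (auto simp: K_def)
      moreover have "del T \<in> tableaux m ?\<kappa>"
        unfolding tableaux_def
      proof (intro CollectI conjI allI impI)
        show "sorted (del T i)" for i using srt[of i] by (simp add: del_def sorted_wrt_filter)
        show "set (del T i) \<subseteq> {Barred (Suc i)..level m}" for i by (rule del_ent)
        show "del T i ! c < del T (Suc i) ! c" if "c < ?\<kappa> (Suc i)" for i c
        proof -
          have "c < \<nu> (Suc i)" "c < ?\<kappa> i" using that le[of "Suc i"] inter[of i] by auto
          then show ?thesis using col[of c i] old[of c i] old[of c "Suc i"] that by simp
        qed
      qed simp
      ultimately show "p \<in> (SIGMA \<kappa>:K. tableaux m \<kappa>)" by (simp add: p f_def)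
    qed
    have preimage: "g (\<kappa>, T) \<in> tableaux (Suc m) \<nu>" "f (g (\<kappa>, T)) = (\<kappa>, T)"
      if \<kappa>: "\<kappa> \<in> K" and T: "T \<in> tableaux m \<kappa>" for \<kappa> T
    proof -
      have len: "length (T i) = \<kappa> i" and srt: "sorted (T i)" and ent: "set (T i) \<subseteq> {Barred (Suc i)..level m}" for i
        using T by (auto simp: tableaux_def)
      have small: "x < ?v" if "x \<in> set (T i)" for x i using ent[of i] that by (auto simp: less_level_Suc)
      have K: "\<nu> (Suc i) \<le> \<kappa> i" "\<kappa> i \<le> \<nu> i" for i using \<kappa> by (auto simp: K_def)
      have "del (g (\<kappa>, T)) i = T i" for i
        unfolding del_def g_def using small[of _ i] by (simp add: filter_id_conv)
      then show "f (g (\<kappa>, T)) = (\<kappa>, T)" by (simp add: f_def len fun_eq_iff)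
      show "g (\<kappa>, T) \<in> tableaux (Suc m) \<nu>"
        unfolding tableaux_def g_def prod.case
      proof (intro CollectI conjI allI impI)
        fix i
        show "length (T i @ replicate (\<nu> i - \<kappa> i) ?v) = \<nu> i" using K[of i] by (simp add: len)
        show "sorted (T i @ replicate (\<nu> i - \<kappa> i) ?v)"
          using srt[of i] small[of _ i] by (auto simp: sorted_append less_imp_le)
        show "set (T i @ replicate (\<nu> i - \<kappa> i) ?v) \<subseteq> {Barred (Suc i)..?v}"
        proof -
          have "Barred (Suc i) \<le> ?v" if "\<nu> i \<noteq> 0"
            using supp[of i] that by (force simp: Barred_le_level)
          then show ?thesis using ent[of i] small[of _ i] by (auto simp: less_imp_le)
        qed
        fix c assume c: "c < \<nu> (Suc i)"
        then have ci: "c < \<kappa> i" using K[of i] by simp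
        show "(T i @ replicate (\<nu> i - \<kappa> i) ?v) ! c < (T (Suc i) @ replicate (\<nu> (Suc i) - \<kappa> (Suc i)) ?v) ! c"
        proof (cases "c < \<kappa> (Suc i)")
          case True
          then show ?thesis using T ci by (simp add: nth_append len tableaux_def)
        next
          case False
          have "T i ! c < ?v" using ci len[of i] by (intro small[of _ i]) auto
          then show ?thesis using False c ci by (simp add: nth_append len)
        qed
      qed
    qed
    show "\<forall>p\<in>SIGMA \<kappa>:K. tableaux m \<kappa>. f (g p) = p" "g ` (SIGMA \<kappa>:K. tableaux m \<kappa>) \<subseteq> tableaux (Suc m) \<nu>"
      using preimage by auto
  qed
  then show ?thesis by blast
qed

definition full_tableaux :: "nat \<Rightarrow> (nat \<Rightarrow> nat) \<Rightarrow> (nat \<Rightarrow> letter list) set" where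
  "full_tableaux n \<nu> = {T. (\<forall>i. length (T i) = \<nu> i \<and> sorted (T i) \<and> set (T i) \<subseteq> alphabet n \<inter> {Barred (Suc i)..}
        \<and> count_list (T i) Infty \<le> 1)
      \<and> (\<forall>i c. c < \<nu> (Suc i) \<longrightarrow> T i ! c < T (Suc i) ! c \<or> T i ! c = Infty \<and> T (Suc i) ! c = Infty)}"

lemma finite_letters: "{Barred (Suc i)..Barred n} = (alphabet n \<inter> {Barred (Suc i)..}) - {Infty}"
proof (intro equalityI subsetI)
  fix x assume "x \<in> {Barred (Suc i)..Barred n}"
  then show "x \<in> (alphabet n \<inter> {Barred (Suc i)..}) - {Infty}"
    by (cases x) (auto simp: alphabet_def less_eq_letter_def)
next
  fix x assume "x \<in> (alphabet n \<inter> {Barred (Suc i)..}) - {Infty}"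
  then show "x \<in> {Barred (Suc i)..Barred n}"
    by (auto simp: alphabet_def less_eq_letter_def)
qed

text \<open>As \<open>Infty\<close> occurs at most once in a row but may repeat in a column, its occurrences form a vertical strip.\<close>

lemma peel_Infty:
  assumes n: "n \<ge> 1" and anti: "\<And>i. \<nu> (Suc i) \<le> \<nu> i" and supp: "\<And>i. n \<le> i \<Longrightarrow> \<nu> i = 0"
  defines "K \<equiv> {\<kappa>. \<forall>i. \<kappa> (Suc i) \<le> \<kappa> i \<and> \<kappa> i \<le> \<nu> i \<and> \<nu> i \<le> \<kappa> i + 1 \<and> (n \<le> i \<longrightarrow> \<kappa> i = 0)}"
  shows "\<exists>f. bij_betw f (full_tableaux n \<nu>) (SIGMA \<kappa>:K. tableaux (2 * n - 1) \<kappa>)"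
proof -
  have lev: "level (2 * n - 1) = Barred n" using n by (cases n) (auto simp: level_def)
  define del where "del T = (\<lambda>i. filter (\<lambda>x. x < Infty) (T i))" for T :: "nat \<Rightarrow> letter list"
  define f where "f T = (\<lambda>i. length (del T i), del T)" for T :: "nat \<Rightarrow> letter list"
  define g where "g = (\<lambda>(\<kappa>, T). \<lambda>i. T i @ replicate (\<nu> i - \<kappa> i) Infty)"
  have "bij_betw f (full_tableaux n \<nu>) (SIGMA \<kappa>:K. tableaux (2 * n - 1) \<kappa>)"
  proof (rule bij_betw_byWitness[where f' = g])
    have split: "T i = del T i @ replicate (\<nu> i - length (del T i)) Infty" if "T \<in> full_tableaux n \<nu>" for T i
    proof -
      have len: "\<nu> i = length (T i)" and srt: "sorted (T i)" and top: "\<forall>x\<in>set (T i). x \<le> Infty"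
        using that by (auto simp: full_tableaux_def)
      show ?thesis unfolding del_def len by (rule sorted_split_top[OF srt top])
    qed
    show "\<forall>T\<in>full_tableaux n \<nu>. g (f T) = T"
    proof (intro ballI ext)
      fix T i assume T: "T \<in> full_tableaux n \<nu>"
      have "g (f T) i = del T i @ replicate (\<nu> i - length (del T i)) Infty" by (simp add: f_def g_def)
      also have "\<dots> = T i" by (rule split[OF T, symmetric])
      finally show "g (f T) i = T i" .
    qed
    show "f ` full_tableaux n \<nu> \<subseteq> (SIGMA \<kappa>:K. tableaux (2 * n - 1) \<kappa>)"
    proof (intro subsetI, elim imageE)
      fix p T assume p: "p = f T" and T: "T \<in> full_tableaux n \<nu>"
      let ?\<kappa> = "\<lambda>i. length (del T i)"
      have len: "length (T i) = \<nu> i" and srt: "sorted (T i)"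
        and ent: "set (T i) \<subseteq> alphabet n \<inter> {Barred (Suc i)..}" and cnt: "count_list (T i) Infty \<le> 1" for i
        using T by (auto simp: full_tableaux_def)
      have col: "T i ! c < T (Suc i) ! c \<or> T i ! c = Infty \<and> T (Suc i) ! c = Infty" if "c < \<nu> (Suc i)" for i c
        using T that by (auto simp: full_tableaux_def)
      have del_ent: "set (del T i) \<subseteq> {Barred (Suc i)..Barred n}" for i
        using ent[of i] unfolding finite_letters by (auto simp: del_def)
      have fin: "Infty \<notin> set (del T i)" for i by (auto simp: del_def)
      have le: "?\<kappa> i \<le> \<nu> i" for i using len[of i] length_filter_le[of _ "T i"] by (auto simp: del_def)
      have old: "del T i ! c = T i ! c" if "c < ?\<kappa> i" for i c
        using that by (subst split[OF T, of i]) (simp add: nth_append)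
      have new: "T i ! c = Infty" if "?\<kappa> i \<le> c" "c < \<nu> i" for i c
        using that le[of i] by (subst split[OF T, of i]) (simp add: nth_append)
      have fin_nth: "T i ! c \<noteq> Infty" if "c < ?\<kappa> i" for i c
      proof -
        have "T i ! c \<in> set (del T i)" using nth_mem[OF that] by (simp only: old[OF that])
        then show ?thesis using fin[of i] by metis
      qed
      have strip: "\<nu> i \<le> ?\<kappa> i + 1" for i
      proof -
        have rep: "count_list (replicate d Infty) Infty = d" for d by (induction d) auto
        have "count_list (T i) Infty = \<nu> i - ?\<kappa> i"
          using fin[of i] by (subst split[OF T, of i]) (simp add: rep)
        then show ?thesis using cnt[of i] by simp
      qed
      have anti': "?\<kappa> (Suc i) \<le> ?\<kappa> i" for i
      proof (rule ccontr)
        assume "\<not> ?thesis"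
        then have c: "?\<kappa> i < ?\<kappa> (Suc i)" by simp
        then have c': "?\<kappa> i < \<nu> (Suc i)" using le[of "Suc i"] by simp
        then have "T i ! ?\<kappa> i = Infty" using anti[of i] by (intro new) auto
        then show False using col[OF c'] fin_nth[OF c] by (auto simp: less_le_not_le)
      qed
      have "?\<kappa> i = 0" if "n \<le> i" for i using supp[OF that] le[of i] by simp
      then have "?\<kappa> \<in> K" using anti' le strip by (auto simp: K_def)
      moreover have "del T \<in> tableaux (2 * n - 1) ?\<kappa>"
        unfolding tableaux_def lev
      proof (intro CollectI conjI allI impI)
        show "sorted (del T i)" for i using srt[of i] by (simp add: del_def sorted_wrt_filter)
        show "set (del T i) \<subseteq> {Barred (Suc i)..Barred n}" for i by (rule del_ent)
        show "del T i ! c < del T (Suc i) ! c" if "c < ?\<kappa> (Suc i)" for i c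
        proof -
          have "c < \<nu> (Suc i)" "c < ?\<kappa> i" using that le[of "Suc i"] anti'[of i] by auto
          then show ?thesis using col[of c i] old[of c i] old[of c "Suc i"] fin_nth[of c i] that by simp
        qed
      qed simp
      ultimately show "p \<in> (SIGMA \<kappa>:K. tableaux (2 * n - 1) \<kappa>)" by (simp add: p f_def)
    qed
    have preimage: "g (\<kappa>, T) \<in> full_tableaux n \<nu>" "f (g (\<kappa>, T)) = (\<kappa>, T)"
      if \<kappa>: "\<kappa> \<in> K" and T: "T \<in> tableaux (2 * n - 1) \<kappa>" for \<kappa> T
    proof -
      have len: "length (T i) = \<kappa> i" and srt: "sorted (T i)" and ent: "set (T i) \<subseteq> {Barred (Suc i)..Barred n}" for i
        using T unfolding tableaux_def lev by auto
      have small: "x \<noteq> Infty" if "x \<in> set (T i)" for x i using ent[of i] that unfolding finite_letters by auto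
      have K: "\<kappa> (Suc i) \<le> \<kappa> i" "\<kappa> i \<le> \<nu> i" "\<nu> i \<le> \<kappa> i + 1" for i using \<kappa> by (auto simp: K_def)
      have "del (g (\<kappa>, T)) i = T i" for i
        unfolding del_def g_def using small[of _ i] by (simp add: filter_id_conv less_Infty_iff)
      then show "f (g (\<kappa>, T)) = (\<kappa>, T)" by (simp add: f_def len fun_eq_iff)
      show "g (\<kappa>, T) \<in> full_tableaux n \<nu>"
        unfolding full_tableaux_def g_def prod.case
      proof (intro CollectI conjI allI impI)
        fix i
        show "length (T i @ replicate (\<nu> i - \<kappa> i) Infty) = \<nu> i" using K(2)[of i] by (simp add: len)
        show "sorted (T i @ replicate (\<nu> i - \<kappa> i) Infty)"
          using srt[of i] by (auto simp: sorted_append)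
        have "set (T i) \<subseteq> alphabet n \<inter> {Barred (Suc i)..}" using ent[of i] unfolding finite_letters by auto
        then show "set (T i @ replicate (\<nu> i - \<kappa> i) Infty) \<subseteq> alphabet n \<inter> {Barred (Suc i)..}"
          by (auto simp: alphabet_def)
        have rep: "count_list (replicate d Infty) Infty = d" for d by (induction d) auto
        show "count_list (T i @ replicate (\<nu> i - \<kappa> i) Infty) Infty \<le> 1"
        proof -
          have "count_list (T i) Infty = 0" using small[of Infty i] by (intro count_notin) auto
          then show ?thesis using K(3)[of i] by (simp add: rep)
        qed
        fix c assume c: "c < \<nu> (Suc i)"
        let ?a = "(T i @ replicate (\<nu> i - \<kappa> i) Infty) ! c"
        let ?b = "(T (Suc i) @ replicate (\<nu> (Suc i) - \<kappa> (Suc i)) Infty) ! c"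
        show "?a < ?b \<or> ?a = Infty \<and> ?b = Infty"
        proof (cases "c < \<kappa> (Suc i)")
          case True
          then have "c < \<kappa> i" using K(1)[of i] by simp
          then show ?thesis using T True by (simp add: nth_append len tableaux_def)
        next
          case False
          then have "?b = Infty" using c by (simp add: nth_append len)
          then show ?thesis by (simp add: less_Infty_iff)
        qed
      qed
    qed
    show "\<forall>p\<in>SIGMA \<kappa>:K. tableaux (2 * n - 1) \<kappa>. f (g p) = p"
      "g ` (SIGMA \<kappa>:K. tableaux (2 * n - 1) \<kappa>) \<subseteq> full_tableaux n \<nu>"
      using preimage by auto
  qed
  then show ?thesis by blast
qed

section \<open>Tableaux of a given shape\<close>

definition even_binomial :: "nat \<Rightarrow> nat \<Rightarrow> real" where
  "even_binomial p x = real ((x + p) choose (2 * p))"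

definition odd_binomial :: "nat \<Rightarrow> nat \<Rightarrow> real" where
  "odd_binomial p x = real ((x + p) choose (2 * p + 1))"

lemma sum_choose_upper:
  assumes "a \<le> b"
  shows "(\<Sum>y = a..b. real ((y + q) choose t)) = real ((b + q + 1) choose Suc t) - real ((a + q) choose Suc t)"
  using assms by (induction b rule: dec_induct) simp_all

lemma card_Sigma_bij:
  assumes "\<exists>f. bij_betw f A (SIGMA \<kappa>:K. B \<kappa>)" and "finite K" and "\<And>\<kappa>. \<kappa> \<in> K \<Longrightarrow> finite (B \<kappa>)"
  shows "finite A \<and> real (card A) = (\<Sum>\<kappa>\<in>K. real (card (B \<kappa>)))"
proof -
  obtain f where f: "bij_betw f A (SIGMA \<kappa>:K. B \<kappa>)" using assms(1) by blast
  have "finite (SIGMA \<kappa>:K. B \<kappa>)" using assms(2,3) by auto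
  then have "finite A" using bij_betw_finite[OF f] by blast
  moreover have "card A = (\<Sum>\<kappa>\<in>K. card (B \<kappa>))"
    using bij_betw_same_card[OF f] card_SigmaI[OF assms(2), of B] assms(3) by simp
  ultimately show ?thesis by simp
qed

lemma interlacing_box:
  assumes "\<And>i. N \<le> i \<Longrightarrow> \<nu> (Suc i) = 0"
  shows "{\<kappa>. \<forall>i. \<nu> (Suc i) \<le> \<kappa> i \<and> \<kappa> i \<le> \<nu> i \<and> (N \<le> i \<longrightarrow> \<kappa> i = 0)} = box N (\<lambda>i. {\<nu> (Suc i)..\<nu> i})"
proof (intro Set.set_eqI iffI)
  fix \<kappa> assume \<kappa>: "\<kappa> \<in> box N (\<lambda>i. {\<nu> (Suc i)..\<nu> i})"
  have "\<nu> (Suc i) \<le> \<kappa> i \<and> \<kappa> i \<le> \<nu> i \<and> (N \<le> i \<longrightarrow> \<kappa> i = 0)" for i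
    using \<kappa> assms[of i] by (cases "i < N") (auto simp: box_def)
  then show "\<kappa> \<in> {\<kappa>. \<forall>i. \<nu> (Suc i) \<le> \<kappa> i \<and> \<kappa> i \<le> \<nu> i \<and> (N \<le> i \<longrightarrow> \<kappa> i = 0)}" by blast
qed (auto simp: box_def)

text \<open>After the summation each entry is the difference of an entry of the new matrix and the one below it. The new row of the shape corresponds to
  a column of ones, which the differences reduce to a unit vector.\<close>

lemma card_tableaux_odd_step:
  assumes even: "\<And>\<kappa>. (\<And>i. \<kappa> (Suc i) \<le> \<kappa> i) \<Longrightarrow> (\<And>i. k \<le> i \<Longrightarrow> \<kappa> i = 0) \<Longrightarrow>
      finite (tableaux (2 * k) \<kappa>) \<and>
      real (card (tableaux (2 * k) \<kappa>)) = det (mat k k (\<lambda>(i, j). odd_binomial (k - 1 - j) (\<kappa> i + (k - i))))"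
    and anti: "\<And>i. \<nu> (Suc i) \<le> \<nu> i" and supp: "\<And>i. k < i \<Longrightarrow> \<nu> i = 0"
  shows "finite (tableaux (2 * k + 1) \<nu>) \<and>
      real (card (tableaux (2 * k + 1) \<nu>)) = det (mat (k + 1) (k + 1) (\<lambda>(i, j). even_binomial (k - j) (\<nu> i + (k - i))))"
proof -
  define K where "K = {\<kappa>. \<forall>i. \<nu> (Suc i) \<le> \<kappa> i \<and> \<kappa> i \<le> \<nu> i \<and> (2 * k \<le> 2 * i \<longrightarrow> \<kappa> i = 0)}"
  let ?S = "\<lambda>i. {\<nu> (Suc i)..\<nu> i}"
  have K_box: "K = box k ?S"
    using interlacing_box[of k \<nu>] supp by (simp add: K_def)
  have K_ok: "finite (tableaux (2 * k) \<kappa>) \<and>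
      real (card (tableaux (2 * k) \<kappa>)) = det (mat k k (\<lambda>(i, j). odd_binomial (k - 1 - j) (\<kappa> i + (k - i))))"
    if "\<kappa> \<in> K" for \<kappa>
  proof (rule even)
    show "\<kappa> (Suc i) \<le> \<kappa> i" for i using that by (auto simp: K_def intro: le_trans)
    show "\<kappa> i = 0" if "k \<le> i" for i using \<open>\<kappa> \<in> K\<close> that by (auto simp: K_def)
  qed
  have "\<exists>f. bij_betw f (tableaux (Suc (2 * k)) \<nu>) (SIGMA \<kappa>:K. tableaux (2 * k) \<kappa>)"
    unfolding K_def using anti supp by (intro peel_level) auto
  moreover have "finite K" unfolding K_box by (intro finite_box) auto
  ultimately have *: "finite (tableaux (Suc (2 * k)) \<nu>) \<and>
      real (card (tableaux (Suc (2 * k)) \<nu>)) = (\<Sum>\<kappa>\<in>K. real (card (tableaux (2 * k) \<kappa>)))"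
    using K_ok by (intro card_Sigma_bij) auto
  let ?a = "\<lambda>i j. even_binomial (k - j) (\<nu> i + (k - i))"
  have "(\<Sum>\<kappa>\<in>K. real (card (tableaux (2 * k) \<kappa>)))
      = (\<Sum>\<kappa>\<in>box k ?S. det (mat k k (\<lambda>(i, j). odd_binomial (k - 1 - j) (\<kappa> i + (k - i)))))"
    unfolding K_box[symmetric] using K_ok by (intro sum.cong) auto
  also have "\<dots> = det (mat k k (\<lambda>(i, j). \<Sum>y\<in>?S i. odd_binomial (k - 1 - j) (y + (k - i))))"
    by (rule det_sum_rows[where F = "\<lambda>i y j. odd_binomial (k - 1 - j) (y + (k - i))"]) auto
  also have "mat k k (\<lambda>(i, j). \<Sum>y\<in>?S i. odd_binomial (k - 1 - j) (y + (k - i)))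
      = mat k k (\<lambda>(i, j). ?a i j - (if Suc i < Suc k then ?a (Suc i) j else 0))"
  proof (rule cong_mat)
    fix i j assume ij: "i < k" "j < k"
    have "(\<Sum>y\<in>?S i. odd_binomial (k - 1 - j) (y + (k - i)))
        = (\<Sum>y = \<nu> (Suc i)..\<nu> i. real ((y + (k - i + (k - 1 - j))) choose (2 * (k - 1 - j) + 1)))"
      by (simp add: odd_binomial_def add.assoc)
    also have "\<dots> = ?a i j - ?a (Suc i) j"
    proof -
      have "Suc (2 * (k - 1 - j) + 1) = 2 * (k - j)" "\<nu> i + (k - i + (k - 1 - j)) + 1 = \<nu> i + (k - i) + (k - j)"
        "\<nu> (Suc i) + (k - i + (k - 1 - j)) = \<nu> (Suc i) + (k - Suc i) + (k - j)"
        using ij by auto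
      then show ?thesis unfolding sum_choose_upper[OF anti] even_binomial_def by (simp only:)
    qed
    finally show "(case (i, j) of (i, j) \<Rightarrow> \<Sum>y\<in>?S i. odd_binomial (k - 1 - j) (y + (k - i)))
        = (case (i, j) of (i, j) \<Rightarrow> ?a i j - (if Suc i < Suc k then ?a (Suc i) j else 0))"
      using ij by simp
  qed auto
  also have "det \<dots> = det (mat (Suc k) (Suc k) (\<lambda>(i, j). ?a i j - (if Suc i < Suc k then ?a (Suc i) j else 0)))"
    by (rule det_last_column_unit[symmetric]) (auto simp: even_binomial_def)
  also have "\<dots> = det (mat (Suc k) (Suc k) (\<lambda>(i, j). ?a i j))" by (rule det_row_differences)
  finally show ?thesis using * by simp
qed

text \<open>The same summation, but the matrix keeps its size: the row below the last one would be zero.\<close>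

lemma card_tableaux_even_step:
  assumes odd: "\<And>\<kappa>. (\<And>i. \<kappa> (Suc i) \<le> \<kappa> i) \<Longrightarrow> (\<And>i. k < i \<Longrightarrow> \<kappa> i = 0) \<Longrightarrow>
      finite (tableaux (2 * k + 1) \<kappa>) \<and>
      real (card (tableaux (2 * k + 1) \<kappa>)) = det (mat (k + 1) (k + 1) (\<lambda>(i, j). even_binomial (k - j) (\<kappa> i + (k - i))))"
    and anti: "\<And>i. \<nu> (Suc i) \<le> \<nu> i" and supp: "\<And>i. k < i \<Longrightarrow> \<nu> i = 0"
  shows "finite (tableaux (2 * k + 2) \<nu>) \<and>
      real (card (tableaux (2 * k + 2) \<nu>)) = det (mat (k + 1) (k + 1) (\<lambda>(i, j). odd_binomial (k - j) (\<nu> i + (k + 1 - i))))"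
proof -
  define K where "K = {\<kappa>. \<forall>i. \<nu> (Suc i) \<le> \<kappa> i \<and> \<kappa> i \<le> \<nu> i \<and> (2 * k + 1 \<le> 2 * i \<longrightarrow> \<kappa> i = 0)}"
  let ?S = "\<lambda>i. {\<nu> (Suc i)..\<nu> i}"
  have half: "2 * k + 1 \<le> 2 * i \<longleftrightarrow> Suc k \<le> i" for i by arith
  have K_box: "K = box (k + 1) ?S"
    unfolding K_def half using interlacing_box[of "Suc k" \<nu>] supp by simp
  have K_ok: "finite (tableaux (2 * k + 1) \<kappa>) \<and>
      real (card (tableaux (2 * k + 1) \<kappa>)) = det (mat (k + 1) (k + 1) (\<lambda>(i, j). even_binomial (k - j) (\<kappa> i + (k - i))))"
    if "\<kappa> \<in> K" for \<kappa>
  proof (rule odd)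
    show "\<kappa> (Suc i) \<le> \<kappa> i" for i using that by (auto simp: K_def intro: le_trans)
    show "\<kappa> i = 0" if "k < i" for i using \<open>\<kappa> \<in> K\<close> that by (auto simp: K_def)
  qed
  have "\<exists>f. bij_betw f (tableaux (Suc (2 * k + 1)) \<nu>) (SIGMA \<kappa>:K. tableaux (2 * k + 1) \<kappa>)"
    unfolding K_def using anti supp by (intro peel_level) auto
  moreover have "finite K" unfolding K_box by (intro finite_box) auto
  ultimately have *: "finite (tableaux (Suc (2 * k + 1)) \<nu>) \<and>
      real (card (tableaux (Suc (2 * k + 1)) \<nu>)) = (\<Sum>\<kappa>\<in>K. real (card (tableaux (2 * k + 1) \<kappa>)))"
    using K_ok by (intro card_Sigma_bij) auto
  let ?a = "\<lambda>i j. odd_binomial (k - j) (\<nu> i + (k + 1 - i))"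
  have "(\<Sum>\<kappa>\<in>K. real (card (tableaux (2 * k + 1) \<kappa>)))
      = (\<Sum>\<kappa>\<in>box (k + 1) ?S. det (mat (k + 1) (k + 1) (\<lambda>(i, j). even_binomial (k - j) (\<kappa> i + (k - i)))))"
    unfolding K_box[symmetric] using K_ok by (intro sum.cong) auto
  also have "\<dots> = det (mat (k + 1) (k + 1) (\<lambda>(i, j). \<Sum>y\<in>?S i. even_binomial (k - j) (y + (k - i))))"
    by (rule det_sum_rows[where F = "\<lambda>i y j. even_binomial (k - j) (y + (k - i))"]) auto
  also have "mat (k + 1) (k + 1) (\<lambda>(i, j). \<Sum>y\<in>?S i. even_binomial (k - j) (y + (k - i)))
      = mat (k + 1) (k + 1) (\<lambda>(i, j). ?a i j - (if Suc i < k + 1 then ?a (Suc i) j else 0))"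
  proof (rule cong_mat)
    fix i j assume ij: "i < k + 1" "j < k + 1"
    have "(\<Sum>y\<in>?S i. even_binomial (k - j) (y + (k - i)))
        = (\<Sum>y = \<nu> (Suc i)..\<nu> i. real ((y + (k - i + (k - j))) choose (2 * (k - j))))"
      by (simp add: even_binomial_def add.assoc)
    also have "\<dots> = ?a i j - (if Suc i < k + 1 then ?a (Suc i) j else 0)"
    proof -
      have e: "Suc (2 * (k - j)) = 2 * (k - j) + 1" "\<nu> i + (k - i + (k - j)) + 1 = \<nu> i + (k + 1 - i) + (k - j)"
        using ij by auto
      have last: "\<nu> (Suc i) + (k - i + (k - j)) = k - j" if "\<not> Suc i < k + 1"
        using that ij supp[of "Suc i"] by auto
      have next': "\<nu> (Suc i) + (k - i + (k - j)) = \<nu> (Suc i) + (k + 1 - Suc i) + (k - j)" by simp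
      show ?thesis
      proof (cases "Suc i < k + 1")
        case True
        then show ?thesis unfolding sum_choose_upper[OF anti] odd_binomial_def e next' by simp
      next
        case False
        have "real ((k - j) choose (2 * (k - j) + 1)) = 0" by (simp add: binomial_eq_0)
        then show ?thesis using False unfolding sum_choose_upper[OF anti] odd_binomial_def e last[OF False] by simp
      qed
    qed
    finally show "(case (i, j) of (i, j) \<Rightarrow> \<Sum>y\<in>?S i. even_binomial (k - j) (y + (k - i)))
        = (case (i, j) of (i, j) \<Rightarrow> ?a i j - (if Suc i < k + 1 then ?a (Suc i) j else 0))"
      by simp
  qed auto
  also have "det \<dots> = det (mat (k + 1) (k + 1) (\<lambda>(i, j). ?a i j))" by (rule det_row_differences)
  finally show ?thesis using * by simp
qed

lemma card_tableaux_even: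
  assumes "\<And>i. \<nu> (Suc i) \<le> \<nu> i" and "\<And>i. k \<le> i \<Longrightarrow> \<nu> i = 0"
  shows "finite (tableaux (2 * k) \<nu>) \<and>
      real (card (tableaux (2 * k) \<nu>)) = det (mat k k (\<lambda>(i, j). odd_binomial (k - 1 - j) (\<nu> i + (k - i))))"
  using assms
proof (induction k arbitrary: \<nu>)
  case 0
  have no_letters: "{Barred (Suc i)..level 0} = {}" for i by (auto simp: level_def less_eq_letter_def dest: order_trans)
  have "T = (\<lambda>_. [])" if "T \<in> tableaux 0 \<nu>" for T
    using that 0 by (auto simp: tableaux_def fun_eq_iff)
  moreover have "(\<lambda>_. []) \<in> tableaux 0 \<nu>" using 0 by (auto simp: tableaux_def)
  ultimately have "tableaux 0 \<nu> = {\<lambda>_. []}" by blast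
  then show ?case by simp
next
  case (Suc k)
  have odd: "finite (tableaux (2 * k + 1) \<kappa>) \<and>
      real (card (tableaux (2 * k + 1) \<kappa>)) = det (mat (k + 1) (k + 1) (\<lambda>(i, j). even_binomial (k - j) (\<kappa> i + (k - i))))"
    if "\<And>i. \<kappa> (Suc i) \<le> \<kappa> i" "\<And>i. k < i \<Longrightarrow> \<kappa> i = 0" for \<kappa>
  proof (rule card_tableaux_odd_step[where k = k and \<nu> = \<kappa>])
    fix \<mu> :: "nat \<Rightarrow> nat" assume "\<And>i. \<mu> (Suc i) \<le> \<mu> i" "\<And>i. k \<le> i \<Longrightarrow> \<mu> i = 0"
    then show "finite (tableaux (2 * k) \<mu>) \<and>
        real (card (tableaux (2 * k) \<mu>)) = det (mat k k (\<lambda>(i, j). odd_binomial (k - 1 - j) (\<mu> i + (k - i))))"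
      by (rule Suc.IH)
  qed (use that in auto)
  show ?case
  proof -
    have "finite (tableaux (2 * k + 2) \<nu>) \<and>
        real (card (tableaux (2 * k + 2) \<nu>)) = det (mat (k + 1) (k + 1) (\<lambda>(i, j). odd_binomial (k - j) (\<nu> i + (k + 1 - i))))"
    proof (rule card_tableaux_even_step[where k = k and \<nu> = \<nu>])
      fix \<mu> :: "nat \<Rightarrow> nat" assume "\<And>i. \<mu> (Suc i) \<le> \<mu> i" "\<And>i. k < i \<Longrightarrow> \<mu> i = 0"
      then show "finite (tableaux (2 * k + 1) \<mu>) \<and>
          real (card (tableaux (2 * k + 1) \<mu>)) = det (mat (k + 1) (k + 1) (\<lambda>(i, j). even_binomial (k - j) (\<mu> i + (k - i))))"
        by (rule odd)
    qed (use Suc.prems in auto)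
    then show ?thesis by simp
  qed
qed

lemma card_tableaux_odd:
  assumes "\<And>i. \<nu> (Suc i) \<le> \<nu> i" and "\<And>i. k < i \<Longrightarrow> \<nu> i = 0"
  shows "finite (tableaux (2 * k + 1) \<nu>) \<and>
      real (card (tableaux (2 * k + 1) \<nu>)) = det (mat (k + 1) (k + 1) (\<lambda>(i, j). even_binomial (k - j) (\<nu> i + (k - i))))"
proof (rule card_tableaux_odd_step[where k = k and \<nu> = \<nu>])
  fix \<mu> :: "nat \<Rightarrow> nat" assume "\<And>i. \<mu> (Suc i) \<le> \<mu> i" "\<And>i. k \<le> i \<Longrightarrow> \<mu> i = 0"
  then show "finite (tableaux (2 * k) \<mu>) \<and>
      real (card (tableaux (2 * k) \<mu>)) = det (mat k k (\<lambda>(i, j). odd_binomial (k - 1 - j) (\<mu> i + (k - i))))"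
    by (rule card_tableaux_even)
qed (use assms in auto)

text \<open>Relates the determinant entries to the half-integer factorials, whose behaviour under shifts is known.\<close>

lemma even_binomial_half_factorial: "even_binomial p x * fact (2 * p) = half_factorial p (real x + 1/2)"
proof -
  have "even_binomial p x = (real x + real p) gchoose (2 * p)"
    by (simp add: even_binomial_def binomial_gbinomial)
  also have "\<dots> = pochhammer (real x + real p - real (2 * p) + 1) (2 * p) / fact (2 * p)"
    by (rule gbinomial_pochhammer')
  also have "real x + real p - real (2 * p) + 1 = real x + 1 - real p" by simp
  finally show ?thesis by (simp add: half_factorial_pochhammer)
qed

text \<open>Deleting \<open>Infty\<close> from row \<open>i\<close> leaves \<open>c\<close> or \<open>c - 1\<close>. The two polynomials in \<open>c + 1/2\<close> and \<open>c - 1/2\<close> add up to an even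
  polynomial in \<open>c\<close>; for \<open>c = 0\<close> only one of two equal terms is present, hence half the value.\<close>

lemma even_binomial_pair_sum:
  "(\<Sum>y\<in>(if c = 0 then {0} else {c - 1, c}). even_binomial p y)
     = (if c = 0 then 1 else 2) * (\<Prod>i<p. (real c)\<^sup>2 - (real i)\<^sup>2) * (1 / fact (2 * p))"
proof (cases "c = 0")
  case True
  have "even_binomial p 0 = (if p = 0 then 1 else 0)" by (simp add: even_binomial_def binomial_eq_0)
  moreover have "(\<Prod>i<p. (real 0)\<^sup>2 - (real i)\<^sup>2) = (if p = 0 then 1 else 0)"
    by (cases p) (auto simp: prod.lessThan_Suc_shift simp del: prod.lessThan_Suc)
  ultimately show ?thesis using True by simp
next
  case False
  then have "real (c - 1) + 1/2 = real c - 1/2" by (simp add: of_nat_diff)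
  then have "(even_binomial p (c - 1) + even_binomial p c) * fact (2 * p) = 2 * (\<Prod>i<p. (real c)\<^sup>2 - (real i)\<^sup>2)"
    using half_factorial_sum[of "real c" p] False
    unfolding distrib_right even_binomial_half_factorial by simp
  then have "even_binomial p (c - 1) + even_binomial p c = 2 * (\<Prod>i<p. (real c)\<^sup>2 - (real i)\<^sup>2) / fact (2 * p)"
    by (simp add: nonzero_eq_divide_eq)
  then show ?thesis using False by simp
qed

text \<open>The smaller shapes give strictly decreasing sequences \<open>\<beta>\<close>. The sum may be extended to all choices of \<open>\<beta> i\<close> in
  \<open>{c i - 1, c i}\<close>, since a sequence that is not strictly decreasing repeats a value and its determinant has two
  equal rows.\<close>

lemma card_full_tableaux:
  assumes n: "n \<ge> 1" and anti: "\<And>i. \<nu> (Suc i) \<le> \<nu> i" and supp: "\<And>i. n \<le> i \<Longrightarrow> \<nu> i = 0"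
  shows "finite (full_tableaux n \<nu>) \<and> real (card (full_tableaux n \<nu>))
    = (if \<nu> (n - 1) = 0 then 2 ^ (n - 1) else 2 ^ n)
      * sq_vandermonde ((\<lambda>i. \<nu> i + (n - 1 - i)) ` {..<n}) / (\<Prod>j<n. fact (2 * j))"
proof -
  define k where "k = n - 1"
  have nk: "n = k + 1" and odd: "2 * n - 1 = 2 * k + 1" using n by (auto simp: k_def)
  define c where "c i = \<nu> i + (k - i)" for i
  define S where "S i = (if c i = 0 then {0} else {c i - 1, c i})" for i
  define K where "K = {\<kappa>. \<forall>i. \<kappa> (Suc i) \<le> \<kappa> i \<and> \<kappa> i \<le> \<nu> i \<and> \<nu> i \<le> \<kappa> i + 1 \<and> (n \<le> i \<longrightarrow> \<kappa> i = 0)}"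
  define D where "D = {\<beta> \<in> box n S. \<forall>i. Suc i < n \<longrightarrow> \<beta> (Suc i) < \<beta> i}"
  have c_dec: "c (Suc i) < c i" if "Suc i < n" for i using anti[of i] that by (simp add: c_def nk)
  have finS: "finite (S i)" for i by (simp add: S_def)
  let ?d = "\<lambda>\<beta> :: nat \<Rightarrow> nat. det (mat n n (\<lambda>(i, j). even_binomial (k - j) (\<beta> i)))"
  have KD: "bij_betw (\<lambda>\<kappa> i. if i < n then \<kappa> i + (k - i) else 0) K D"
  proof (rule bij_betw_byWitness[where f' = "\<lambda>\<beta> i. if i < n then \<beta> i - (k - i) else 0"])
    show "\<forall>\<kappa>\<in>K. (\<lambda>i. if i < n then (if i < n then \<kappa> i + (k - i) else 0) - (k - i) else 0) = \<kappa>"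
      by (auto simp: K_def fun_eq_iff)
    have low: "k - i \<le> \<beta> i" if "\<beta> \<in> D" for \<beta> i
    proof -
      have "d \<le> k \<Longrightarrow> d \<le> \<beta> (k - d)" for d
      proof (induction d)
        case (Suc d)
        then have "Suc (k - Suc d) < n" "Suc (k - Suc d) = k - d" using nk by auto
        then have "\<beta> (k - d) < \<beta> (k - Suc d)" using \<open>\<beta> \<in> D\<close> unfolding D_def by (metis (mono_tags, lifting) mem_Collect_eq)
        then show ?case using Suc by simp
      qed simp
      from this[of "k - i"] show ?thesis by (cases "i \<le> k") auto
    qed
    show "\<forall>\<beta>\<in>D. (\<lambda>i. if i < n then (if i < n then \<beta> i - (k - i) else 0) + (k - i) else 0) = \<beta>"
      using low by (auto simp: D_def box_def fun_eq_iff)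
    show "(\<lambda>\<kappa> i. if i < n then \<kappa> i + (k - i) else 0) ` K \<subseteq> D"
    proof (intro subsetI, elim imageE)
      fix \<beta> \<kappa> assume \<beta>: "\<beta> = (\<lambda>i. if i < n then \<kappa> i + (k - i) else 0)" and "\<kappa> \<in> K"
      then have \<kappa>: "\<kappa> (Suc i) \<le> \<kappa> i" "\<kappa> i \<le> \<nu> i" "\<nu> i \<le> \<kappa> i + 1" for i by (auto simp: K_def)
      have "\<kappa> i + (k - i) \<in> S i" for i using \<kappa>[of i] by (auto simp: S_def c_def)
      moreover have "\<kappa> (Suc i) + (k - Suc i) < \<kappa> i + (k - i)" if "Suc i < n" for i
        using \<kappa>(1)[of i] that nk by simp
      ultimately show "\<beta> \<in> D" by (auto simp: \<beta> D_def box_def)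
    qed
    show "(\<lambda>\<beta> i. if i < n then \<beta> i - (k - i) else 0) ` D \<subseteq> K"
    proof (intro subsetI, elim imageE)
      fix \<beta> \<kappa> assume \<kappa>: "\<kappa> = (\<lambda>i. if i < n then \<beta> i - (k - i) else 0)" and \<beta>: "\<beta> \<in> D"
      have S: "\<beta> i \<in> S i" if "i < n" for i using \<beta> that by (auto simp: D_def box_def)
      have dec: "\<beta> (Suc i) < \<beta> i" if "Suc i < n" for i using \<beta> that by (auto simp: D_def)
      show "\<kappa> \<in> K"
        unfolding K_def
      proof (intro CollectI allI conjI impI)
        fix i
        show "\<kappa> (Suc i) \<le> \<kappa> i"
          using dec[of i] low[OF \<beta>, of i] low[OF \<beta>, of "Suc i"] by (auto simp: \<kappa> nk)
        show "\<kappa> i \<le> \<nu> i" using S[of i] by (auto simp: \<kappa> S_def c_def split: if_splits)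
        show "\<nu> i \<le> \<kappa> i + 1"
          using S[of i] supp[of i] low[OF \<beta>, of i] by (cases "i < n") (auto simp: \<kappa> S_def c_def split: if_splits)
        show "\<kappa> i = 0" if "n \<le> i" using that by (simp add: \<kappa>)
      qed
    qed
  qed
  have K_ok: "finite (tableaux (2 * n - 1) \<kappa>) \<and>
      real (card (tableaux (2 * n - 1) \<kappa>)) = det (mat n n (\<lambda>(i, j). even_binomial (k - j) (\<kappa> i + (k - i))))"
    if "\<kappa> \<in> K" for \<kappa>
  proof -
    have "finite (tableaux (2 * k + 1) \<kappa>) \<and>
      real (card (tableaux (2 * k + 1) \<kappa>)) = det (mat (k + 1) (k + 1) (\<lambda>(i, j). even_binomial (k - j) (\<kappa> i + (k - i))))"
      using that by (intro card_tableaux_odd) (auto simp: K_def nk)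
    then show ?thesis unfolding odd [symmetric] nk [symmetric] .
  qed
  have finD: "finite D" unfolding D_def using finite_box[of n S] finS by simp
  then have finK: "finite K" using bij_betw_finite[OF KD] by simp
  have "\<exists>f. bij_betw f (full_tableaux n \<nu>) (SIGMA \<kappa>:K. tableaux (2 * n - 1) \<kappa>)"
    unfolding K_def using n anti supp by (rule peel_Infty)
  then have *: "finite (full_tableaux n \<nu>) \<and>
      real (card (full_tableaux n \<nu>)) = (\<Sum>\<kappa>\<in>K. real (card (tableaux (2 * n - 1) \<kappa>)))"
    using finK K_ok by (intro card_Sigma_bij) auto
  have "(\<Sum>\<kappa>\<in>K. real (card (tableaux (2 * n - 1) \<kappa>))) = (\<Sum>\<kappa>\<in>K. ?d (\<lambda>i. if i < n then \<kappa> i + (k - i) else 0))"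
  proof (rule sum.cong[OF refl])
    fix \<kappa> assume "\<kappa> \<in> K"
    moreover have "mat n n (\<lambda>(i, j). even_binomial (k - j) (\<kappa> i + (k - i)))
        = mat n n (\<lambda>(i, j). even_binomial (k - j) (if i < n then \<kappa> i + (k - i) else 0))"
      by (rule cong_mat) auto
    ultimately show "real (card (tableaux (2 * n - 1) \<kappa>)) = ?d (\<lambda>i. if i < n then \<kappa> i + (k - i) else 0)"
      using K_ok by simp
  qed
  also have "\<dots> = (\<Sum>\<beta>\<in>D. ?d \<beta>)" by (rule sum.reindex_bij_betw[OF KD, of ?d])
  also have "\<dots> = (\<Sum>\<beta>\<in>box n S. ?d \<beta>)"
  proof (rule sum.mono_neutral_left)
    show "finite (box n S)" using finS by (intro finite_box) auto
    show "D \<subseteq> box n S" by (auto simp: D_def)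
    show "\<forall>\<beta>\<in>box n S - D. ?d \<beta> = 0"
    proof
      fix \<beta> assume "\<beta> \<in> box n S - D"
      then have S: "\<And>i. i < n \<Longrightarrow> \<beta> i \<in> S i" and "\<exists>i. Suc i < n \<and> \<not> \<beta> (Suc i) < \<beta> i"
        by (auto simp: D_def box_def)
      then obtain i where i: "Suc i < n" "\<beta> i \<le> \<beta> (Suc i)" by (auto simp: not_less)
      have "\<beta> i = \<beta> (Suc i)"
        using S[of i] S[of "Suc i"] c_dec[OF i(1)] i by (auto simp: S_def split: if_splits)
      then show "?d \<beta> = 0"
        using i by (intro det_identical_rows[of _ n i "Suc i"]) auto
    qed
  qed
  also have "\<dots> = det (mat n n (\<lambda>(i, j). \<Sum>y\<in>S i. even_binomial (k - j) y))"
    by (rule det_sum_rows[where F = "\<lambda>i y j. even_binomial (k - j) y"]) (rule finS)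
  also have "\<dots> = det (mat n n (\<lambda>(i, j). (if c i = 0 then 1 else 2) * (\<Prod>l<k - j. (real (c i))\<^sup>2 - (real l)\<^sup>2) * (1 / fact (2 * (k - j)))))"
    unfolding S_def even_binomial_pair_sum ..
  also have "\<dots> = (\<Prod>i<n. if c i = 0 then 1 else 2)
      * det (mat n n (\<lambda>(i, j). \<Prod>l<k - j. (real (c i))\<^sup>2 - (real l)\<^sup>2)) * (\<Prod>j<n. 1 / fact (2 * (k - j)))"
    by (rule det_scale_rows_cols)
  also have "(\<Prod>i<n. if c i = 0 then 1 else 2 :: real) = (if \<nu> (n - 1) = 0 then 2 ^ (n - 1) else 2 ^ n)"
  proof -
    have "(\<Prod>i<k. if c i = 0 then 1 else 2 :: real) = (\<Prod>i<k. 2)"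
      by (intro prod.cong) (auto simp: c_def)
    then show ?thesis unfolding nk by (simp add: c_def)
  qed
  also have "det (mat n n (\<lambda>(i, j). \<Prod>l<k - j. (real (c i))\<^sup>2 - (real l)\<^sup>2)) = sq_vandermonde (c ` {..<n})"
  proof -
    define p where "p m = (\<Prod>l<m. [:- (real l)\<^sup>2, 1:])" for m
    have p_deg: "degree (p m) = m" for m unfolding p_def by (subst degree_prod_eq_sum_degree) auto
    have "lead_coeff (p m) = 1" for m unfolding p_def by (simp add: lead_coeff_prod)
    then have p_lead: "coeff (p m) m = 1" for m using p_deg by metis
    have dec: "c j < c i" if "i < j" "j < n" for i j
      using that by (induction j) (auto simp: less_Suc_eq intro: less_trans c_dec)
    have "det (mat n n (\<lambda>(i, j). poly (p (n - 1 - j)) ((real (c i))\<^sup>2))) = sq_vandermonde (c ` {..<n})"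
      by (rule det_sq_vandermonde[OF p_deg p_lead dec])
    then show ?thesis by (simp add: p_def poly_prod k_def)
  qed
  also have "(\<Prod>j<n. 1 / fact (2 * (k - j)) :: real) = 1 / (\<Prod>j<n. fact (2 * j))"
  proof -
    have "(\<Prod>j<n. fact (2 * (k - j)) :: real) = (\<Prod>j<n. fact (2 * j))"
      using prod.nat_diff_reindex[of "\<lambda>j. fact (2 * j) :: real" n] by (simp add: nk)
    then show ?thesis by (simp add: prod_dividef)
  qed
  finally show ?thesis using * by (simp add: c_def[abs_def] k_def)
qed

section \<open>Summation over the shapes\<close>

definition shapes :: "nat \<Rightarrow> nat \<Rightarrow> (nat \<Rightarrow> nat) set" where
  "shapes n r = {\<nu>. (\<forall>i. \<nu> (Suc i) \<le> \<nu> i) \<and> (\<forall>i\<ge>n. \<nu> i = 0) \<and> \<nu> 0 \<le> r}"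

lemma shapes_antimono:
  assumes "\<nu> \<in> shapes n r" "i \<le> j"
  shows "\<nu> j \<le> \<nu> i"
proof (rule lift_Suc_antimono_le[of \<nu>])
  show "\<nu> (Suc i) \<le> \<nu> i" for i using assms(1) by (simp add: shapes_def)
qed (rule assms(2))

lemma shapes_rows:
  assumes \<nu>: "\<nu> \<in> shapes n r"
  shows "{i. \<nu> i \<noteq> 0} = {..<card {i. \<nu> i \<noteq> 0}}" and "card {i. \<nu> i \<noteq> 0} \<le> n"
proof -
  define h where "h = (LEAST i. \<nu> i = 0)"
  have "\<nu> n = 0" using \<nu> by (simp add: shapes_def)
  then have h: "\<nu> h = 0" "h \<le> n" unfolding h_def by (auto intro: LeastI Least_le)
  have "\<nu> i \<noteq> 0 \<longleftrightarrow> i < h" for i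
  proof
    assume "\<nu> i \<noteq> 0"
    then show "i < h" using shapes_antimono[OF \<nu>, of h i] h(1) by (cases "h \<le> i") auto
  next
    assume "i < h"
    then show "\<nu> i \<noteq> 0" unfolding h_def by (rule not_less_Least)
  qed
  then have "{i. \<nu> i \<noteq> 0} = {..<h}" by auto
  then show "{i. \<nu> i \<noteq> 0} = {..<card {i. \<nu> i \<noteq> 0}}" "card {i. \<nu> i \<noteq> 0} \<le> n" using h by auto
qed

text \<open>Translates between the list of nonempty rows and the padded rows used above.\<close>

definition row_fun :: "'a list list \<Rightarrow> nat \<Rightarrow> 'a list" where
  "row_fun T i = (if i < length T then T ! i else [])"

text \<open>The flag \<open>b\<close> selects between all heights and height \<open>n\<close>.\<close>

lemma bij_row_fun:
  assumes n: "n \<ge> 1"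
  shows "\<exists>f. bij_betw f {T. even_sundaram_tableau n T \<and> height T \<le> n \<and> width T \<le> r \<and> (b \<longrightarrow> height T = n)}
    (SIGMA \<nu>:{\<nu> \<in> shapes n r. b \<longrightarrow> \<nu> (n - 1) \<noteq> 0}. full_tableaux n \<nu>)"
proof -
  let ?E = "{T. even_sundaram_tableau n T \<and> height T \<le> n \<and> width T \<le> r \<and> (b \<longrightarrow> height T = n)}"
  let ?F = "SIGMA \<nu>:{\<nu> \<in> shapes n r. b \<longrightarrow> \<nu> (n - 1) \<noteq> 0}. full_tableaux n \<nu>"
  define f where "f T = (\<lambda>i. length (row_fun T i), row_fun T)" for T :: "letter list list"
  define g where "g = (\<lambda>(\<nu> :: nat \<Rightarrow> nat, F :: nat \<Rightarrow> letter list). map F [0..<card {i. \<nu> i \<noteq> 0}])"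
  have "bij_betw f ?E ?F"
  proof (rule bij_betw_byWitness[where f' = g])
    have rows: "{i. length (row_fun T i) \<noteq> 0} = {..<length T}" if "T \<in> ?E" for T
    proof -
      have "\<forall>rw\<in>set T. rw \<noteq> []" using that unfolding even_sundaram_tableau_def young_filling_def by blast
      then have "T ! i \<noteq> []" if "i < length T" for i using nth_mem[OF that] by blast
      then show ?thesis by (auto simp: row_fun_def)
    qed
    show "\<forall>T\<in>?E. g (f T) = T"
    proof
      fix T assume "T \<in> ?E"
      then have "g (f T) = map (row_fun T) [0..<length T]" unfolding f_def g_def prod.case by (simp only: rows card_lessThan)
      also have "\<dots> = T" by (rule nth_equalityI) (auto simp: row_fun_def)
      finally show "g (f T) = T" .
    qed
    show "f ` ?E \<subseteq> ?F"
    proof (intro subsetI, elim imageE)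
      fix p T assume p: "p = f T" and TE: "T \<in> ?E"
      then have T: "even_sundaram_tableau n T" "length T \<le> n" "width T \<le> r" "b \<longrightarrow> length T = n" by (auto simp: height_def)
      let ?\<nu> = "\<lambda>i. length (row_fun T i)"
      have row: "sorted (T ! i) \<and> set (T ! i) \<subseteq> alphabet n \<and> count_list (T ! i) Infty \<le> 1
          \<and> (\<forall>x\<in>set (T ! i). Barred (Suc i) \<le> x)" if "i < length T" for i
        using T(1) that nth_mem[OF that] unfolding even_sundaram_tableau_def by blast
      have "?\<nu> (Suc i) \<le> ?\<nu> i" for i
      proof -
        have "sorted_wrt (\<ge>) (map length T)" using T(1) unfolding even_sundaram_tableau_def young_filling_def by blast
        then show ?thesis
          using sorted_wrt_nth_less[of "(\<ge>)" "map length T" i "Suc i"]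
          by (cases "Suc i < length T") (simp_all add: row_fun_def)
      qed
      moreover have "?\<nu> i = 0" if "n \<le> i" for i using T(2) that by (simp add: row_fun_def)
      moreover have "?\<nu> 0 \<le> r" using T(3) by (cases T) (auto simp: row_fun_def width_def)
      ultimately have "?\<nu> \<in> shapes n r" unfolding shapes_def by blast
      moreover have "n - 1 \<in> {i. ?\<nu> i \<noteq> 0}" if b using that T(4) n unfolding rows[OF TE] by simp
      ultimately have "?\<nu> \<in> {\<nu> \<in> shapes n r. b \<longrightarrow> \<nu> (n - 1) \<noteq> 0}" by blast
      moreover have "row_fun T \<in> full_tableaux n ?\<nu>"
        unfolding full_tableaux_def
      proof (intro CollectI conjI allI impI)
        fix i
        show "sorted (row_fun T i)" using row[of i] by (simp add: row_fun_def)
        show "set (row_fun T i) \<subseteq> alphabet n \<inter> {Barred (Suc i)..}" using row[of i] by (auto simp: row_fun_def)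
        show "count_list (row_fun T i) Infty \<le> 1" using row[of i] by (simp add: row_fun_def)
        fix c assume "c < ?\<nu> (Suc i)"
        then have ic: "Suc i < length T" "c < length (T ! Suc i)" by (simp_all add: row_fun_def split: if_splits)
        then have "T ! i ! c < T ! Suc i ! c \<or> T ! i ! c = Infty \<and> T ! Suc i ! c = Infty"
          using T(1) unfolding even_sundaram_tableau_def by blast
        then show "row_fun T i ! c < row_fun T (Suc i) ! c \<or> row_fun T i ! c = Infty \<and> row_fun T (Suc i) ! c = Infty"
          using ic by (simp add: row_fun_def)
      qed simp
      ultimately show "p \<in> ?F" by (simp add: p f_def)
    qed
    have preimage: "g (\<nu>, F) \<in> ?E" "f (g (\<nu>, F)) = (\<nu>, F)"
      if \<nu>: "\<nu> \<in> shapes n r" "b \<longrightarrow> \<nu> (n - 1) \<noteq> 0" and F: "F \<in> full_tableaux n \<nu>" for \<nu> F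
    proof -
      define h where "h = card {i. \<nu> i \<noteq> 0}"
      have "{i. \<nu> i \<noteq> 0} = {..<h}" unfolding h_def by (rule shapes_rows(1)[OF \<nu>(1)])
      then have h: "\<nu> i \<noteq> 0 \<longleftrightarrow> i < h" for i by auto
      have hn: "h \<le> n" unfolding h_def by (rule shapes_rows(2)[OF \<nu>(1)])
      have g: "g (\<nu>, F) = map F [0..<h]" by (simp add: g_def h_def)
      have len: "length (F i) = \<nu> i" and row: "sorted (F i)" "set (F i) \<subseteq> alphabet n \<inter> {Barred (Suc i)..}"
        "count_list (F i) Infty \<le> 1" for i
        using F by (auto simp: full_tableaux_def)
      have col: "F i ! c < F (Suc i) ! c \<or> F i ! c = Infty \<and> F (Suc i) ! c = Infty" if "c < \<nu> (Suc i)" for i c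
        using F that by (auto simp: full_tableaux_def)
      have "row_fun (g (\<nu>, F)) i = F i" for i
        using h[of i] len[of i] by (auto simp: g row_fun_def)
      then show "f (g (\<nu>, F)) = (\<nu>, F)" by (simp add: f_def len fun_eq_iff)
      have "young_filling (g (\<nu>, F))"
        unfolding young_filling_def
      proof (intro conjI ballI)
        show "sorted_wrt (\<ge>) (map length (g (\<nu>, F)))"
          unfolding g sorted_wrt_iff_nth_less by (simp add: len shapes_antimono[OF \<nu>(1)])
        show "rw \<noteq> []" if "rw \<in> set (g (\<nu>, F))" for rw
        proof -
          from that obtain i where "i < h" "rw = F i" by (auto simp: g)
          then show ?thesis using h[of i] len[of i] by auto
        qed
      qed
      moreover have "\<forall>rw\<in>set (g (\<nu>, F)). set rw \<subseteq> alphabet n" "\<forall>rw\<in>set (g (\<nu>, F)). sorted rw"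
        "\<forall>rw\<in>set (g (\<nu>, F)). count_list rw Infty \<le> 1"
        using row by (simp_all add: g)
      moreover have "\<forall>k c. Suc k < length (g (\<nu>, F)) \<and> c < length (g (\<nu>, F) ! Suc k) \<longrightarrow>
          g (\<nu>, F) ! k ! c < g (\<nu>, F) ! Suc k ! c \<or> g (\<nu>, F) ! k ! c = Infty \<and> g (\<nu>, F) ! Suc k ! c = Infty"
      proof (intro allI impI)
        fix k c assume kc: "Suc k < length (g (\<nu>, F)) \<and> c < length (g (\<nu>, F) ! Suc k)"
        then have k: "Suc k < h" by (simp add: g)
        then have "g (\<nu>, F) ! Suc k = F (Suc k)" by (simp add: g)
        then have "c < \<nu> (Suc k)" using kc len[of "Suc k"] by simp
        then show "g (\<nu>, F) ! k ! c < g (\<nu>, F) ! Suc k ! c \<or> g (\<nu>, F) ! k ! c = Infty \<and> g (\<nu>, F) ! Suc k ! c = Infty"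
          using col[of c k] k by (simp add: g)
      qed
      moreover have "\<forall>k<length (g (\<nu>, F)). \<forall>x\<in>set (g (\<nu>, F) ! k). Barred (Suc k) \<le> x"
      proof (intro allI impI ballI)
        fix k x assume "k < length (g (\<nu>, F))" "x \<in> set (g (\<nu>, F) ! k)"
        then have "x \<in> set (F k)" by (simp add: g)
        then show "Barred (Suc k) \<le> x" using row(2)[of k] by blast
      qed
      ultimately have "even_sundaram_tableau n (g (\<nu>, F))" unfolding even_sundaram_tableau_def by blast
      moreover have "width (g (\<nu>, F)) \<le> r"
      proof (cases h)
        case 0
        then show ?thesis by (simp add: g width_def)
      next
        case (Suc h')
        then have "g (\<nu>, F) = F 0 # map F [1..<Suc h']" unfolding g by (simp add: upt_conv_Cons del: upt_Suc)
        then have "width (g (\<nu>, F)) = \<nu> 0" by (simp add: width_def len)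
        then show ?thesis using \<nu>(1) by (simp add: shapes_def)
      qed
      moreover have "b \<longrightarrow> h = n" using \<nu>(2) h[of "n - 1"] hn n by auto
      ultimately show "g (\<nu>, F) \<in> ?E" using hn by (simp add: g height_def)
    qed
    have shape: "\<nu> \<in> shapes n r" "b \<longrightarrow> \<nu> (n - 1) \<noteq> 0" "F \<in> full_tableaux n \<nu>" if "(\<nu>, F) \<in> ?F" for \<nu> F
      using that by blast+
    show "\<forall>p\<in>?F. f (g p) = p"
    proof
      fix p assume p: "p \<in> ?F"
      obtain \<nu> F where e: "p = (\<nu>, F)" by (rule prod.exhaust)
      show "f (g p) = p" unfolding e by (rule preimage(2)[OF shape[OF p[unfolded e]]])
    qed
    show "g ` ?F \<subseteq> ?E"
    proof (rule image_subsetI)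
      fix p assume p: "p \<in> ?F"
      obtain \<nu> F where e: "p = (\<nu>, F)" by (rule prod.exhaust)
      show "g p \<in> ?E" unfolding e by (rule preimage(1)[OF shape[OF p[unfolded e]]])
    qed
  qed
  then show ?thesis by blast
qed

definition shifted_parts :: "nat \<Rightarrow> (nat \<Rightarrow> nat) \<Rightarrow> nat set" where
  "shifted_parts n \<nu> = (\<lambda>i. \<nu> i + (n - 1 - i)) ` {..<n}"

lemma reverse_lessThan: "(\<lambda>i. n - 1 - i) ` {..<n} = {..<n}" for n :: nat
proof (intro equalityI subsetI)
  fix x assume "x \<in> {..<n}"
  then show "x \<in> (\<lambda>i. n - 1 - i) ` {..<n}" by (intro image_eqI[of _ _ "n - 1 - x"]) auto
qed auto

text \<open>The inverse lists the elements of the set in increasing order and subtracts their positions.\<close>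

lemma bij_shifted_parts:
  assumes n: "n \<ge> 1"
  shows "bij_betw (shifted_parts n) (shapes n r) {A. A \<subseteq> {0..r + n - 1} \<and> card A = n}"
proof -
  define g where "g A = (\<lambda>i. if i < n then sorted_list_of_set A ! (n - 1 - i) - (n - 1 - i) else 0)" for A :: "nat set"
  have list: "sorted_list_of_set (shifted_parts n \<nu>) = map (\<lambda>k. \<nu> (n - 1 - k) + k) [0..<n]"
    and card: "card (shifted_parts n \<nu>) = n" if \<nu>: "\<nu> \<in> shapes n r" for \<nu>
  proof -
    let ?L = "map (\<lambda>k. \<nu> (n - 1 - k) + k) [0..<n]"
    have "\<nu> (n - 1 - i) + i < \<nu> (n - 1 - j) + j" if "i < j" "j < n" for i j
      using shapes_antimono[OF \<nu>, of "n - 1 - j" "n - 1 - i"] that by linarith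
    then have "sorted_wrt (<) ?L" by (simp add: sorted_wrt_iff_nth_less)
    then have L: "sorted ?L" "distinct ?L" by (simp_all add: strict_sorted_iff)
    have eq: "shifted_parts n \<nu> = set ?L"
    proof -
      have "{0..<n} = (\<lambda>i. n - 1 - i) ` {..<n}" unfolding reverse_lessThan by (rule atLeast0LessThan)
      then have "set ?L = (\<lambda>k. \<nu> (n - 1 - k) + k) ` (\<lambda>i. n - 1 - i) ` {..<n}" by (simp only: set_map set_upt)
      also have "\<dots> = shifted_parts n \<nu>"
        unfolding shifted_parts_def image_image by (intro image_cong refl) auto
      finally show ?thesis ..
    qed
    show "sorted_list_of_set (shifted_parts n \<nu>) = ?L"
      unfolding eq by (rule sorted_list_of_set.idem_if_sorted_distinct[OF L])
    show "card (shifted_parts n \<nu>) = n"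
      unfolding eq distinct_card[OF L(2)] by simp
  qed
  show ?thesis
  proof (rule bij_betw_byWitness[where f' = g])
    show "\<forall>\<nu>\<in>shapes n r. g (shifted_parts n \<nu>) = \<nu>"
    proof (intro ballI ext)
      fix \<nu> i assume \<nu>: "\<nu> \<in> shapes n r"
      show "g (shifted_parts n \<nu>) i = \<nu> i"
      proof (cases "i < n")
        case True
        then have i: "n - 1 - i < n" "n - 1 - (n - 1 - i) = i" by auto
        have "g (shifted_parts n \<nu>) i = \<nu> (n - 1 - (n - 1 - i)) + (n - 1 - i) - (n - 1 - i)"
          unfolding g_def list[OF \<nu>] using True i(1) by (simp only: if_True nth_map_upt diff_zero add_0_left)
        then show ?thesis unfolding i(2) by simp
      next
        case False
        then show ?thesis using \<nu> by (simp add: g_def shapes_def)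
      qed
    qed
    show "shifted_parts n ` shapes n r \<subseteq> {A. A \<subseteq> {0..r + n - 1} \<and> card A = n}"
    proof (intro subsetI, elim imageE)
      fix A \<nu> assume A: "A = shifted_parts n \<nu>" and \<nu>: "\<nu> \<in> shapes n r"
      have "\<nu> i \<le> r" for i using shapes_antimono[OF \<nu>, of 0 i] \<nu> by (auto simp: shapes_def)
      then have "\<nu> i + (n - 1 - i) \<le> r + (n - 1)" for i by (intro add_mono) auto
      then have bound: "\<nu> i + (n - 1 - i) \<le> r + n - 1" for i using n by simp
      have "A \<subseteq> {0..r + n - 1}"
      proof
        fix x assume "x \<in> A"
        then obtain i where "x = \<nu> i + (n - 1 - i)" unfolding A shifted_parts_def by blast
        then show "x \<in> {0..r + n - 1}" using bound[of i] by simp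
      qed
      then show "A \<in> {A. A \<subseteq> {0..r + n - 1} \<and> card A = n}" using card[OF \<nu>] A by simp
    qed
    have inv: "g A \<in> shapes n r" "shifted_parts n (g A) = A" if A: "A \<subseteq> {0..r + n - 1}" "card A = n" for A
    proof -
      define L where "L = sorted_list_of_set A"
      have finA: "finite A" using A(1) finite_subset by blast
      have len: "length L = n" and set: "set L = A" using A(2) finA by (simp_all add: L_def)
      have "sorted_wrt (<) L" by (simp add: L_def)
      then have L: "L ! i < L ! j" if "i < j" "j < n" for i j using that len by (simp add: sorted_wrt_iff_nth_less)
      have low: "k < n \<Longrightarrow> k \<le> L ! k" for k
      proof (induction k)
        case (Suc k)
        then show ?case using L[of k "Suc k"] by simp
      qed simp
      have top: "L ! k \<le> r + n - 1" if "k < n" for k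
      proof -
        have "L ! k \<in> A" using nth_mem[of k L] that unfolding len set by simp
        then show ?thesis using A(1) by auto
      qed
      have gA: "g A i = (if i < n then L ! (n - 1 - i) - (n - 1 - i) else 0)" for i by (simp add: g_def L_def)
      have "g A (Suc i) \<le> g A i" for i
      proof (cases "Suc i < n")
        case True
        have e: "n - 1 - i = Suc (n - 1 - Suc i)" using True by simp
        have "L ! (n - 1 - Suc i) < L ! Suc (n - 1 - Suc i)" using True by (intro L) auto
        then show ?thesis using True unfolding gA e by simp
      qed (simp add: gA)
      moreover have "g A 0 \<le> r" using top[of "n - 1"] n by (simp add: gA)
      ultimately show "g A \<in> shapes n r" by (simp add: shapes_def gA)
      have "shifted_parts n (g A) = (\<lambda>i. L ! (n - 1 - i)) ` {..<n}"
        unfolding shifted_parts_def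
      proof (intro image_cong refl)
        fix i assume "i \<in> {..<n}"
        then have i: "i < n" and "n - 1 - i < n" by auto
        then have "L ! (n - 1 - i) - (n - 1 - i) + (n - 1 - i) = L ! (n - 1 - i)"
          by (intro le_add_diff_inverse2 low)
        then show "g A i + (n - 1 - i) = L ! (n - 1 - i)" by (simp only: gA i if_True)
      qed
      also have "\<dots> = (\<lambda>k. L ! k) ` (\<lambda>i. n - 1 - i) ` {..<n}" by (simp only: image_image)
      also have "\<dots> = (\<lambda>k. L ! k) ` {..<n}" by (simp only: reverse_lessThan)
      also have "\<dots> = A" unfolding set [symmetric] using nth_image[of n L] len by (simp add: lessThan_atLeast0)
      finally show "shifted_parts n (g A) = A" .
    qed
    show "\<forall>A\<in>{A. A \<subseteq> {0..r + n - 1} \<and> card A = n}. shifted_parts n (g A) = A"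
      using inv(2) by blast
    show "g ` {A. A \<subseteq> {0..r + n - 1} \<and> card A = n} \<subseteq> shapes n r"
      using inv(1) by blast
  qed
qed

lemma zero_in_shifted_parts:
  assumes "n \<ge> 1"
  shows "0 \<in> shifted_parts n \<nu> \<longleftrightarrow> \<nu> (n - 1) = 0"
proof
  assume "0 \<in> shifted_parts n \<nu>"
  then obtain i where "i < n" "\<nu> i = 0" "n - 1 - i = 0" by (auto simp: shifted_parts_def)
  moreover from this have "i = n - 1" by simp
  ultimately show "\<nu> (n - 1) = 0" by simp
next
  assume "\<nu> (n - 1) = 0"
  then show "0 \<in> shifted_parts n \<nu>"
    using assms unfolding shifted_parts_def by (intro image_eqI[of _ _ "n - 1"]) auto
qed

lemma card_sundaram_tableaux:
  assumes n: "n \<ge> 1"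
  shows "real (card {T. even_sundaram_tableau n T \<and> height T \<le> n \<and> width T \<le> r \<and> (b \<longrightarrow> height T = n)})
    = (\<Sum>A | (A \<subseteq> {0..r + n - 1} \<and> card A = n) \<and> (b \<longrightarrow> 0 \<notin> A).
        (if 0 \<in> A then 2 ^ (n - 1) else 2 ^ n) * sq_vandermonde A / (\<Prod>j<n. fact (2 * j)))"
proof -
  let ?S = "{\<nu> \<in> shapes n r. b \<longrightarrow> \<nu> (n - 1) \<noteq> 0}"
  let ?A = "{A. (A \<subseteq> {0..r + n - 1} \<and> card A = n) \<and> (b \<longrightarrow> 0 \<notin> A)}"
  let ?W = "\<lambda>A. (if 0 \<in> A then 2 ^ (n - 1) else 2 ^ n) * sq_vandermonde A / (\<Prod>j<n. fact (2 * j))"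
  have bij: "bij_betw (shifted_parts n) ?S ?A"
  proof (rule bij_betw_subset[OF bij_shifted_parts[OF n, of r], of ?S])
    have img: "shifted_parts n ` shapes n r = {A. A \<subseteq> {0..r + n - 1} \<and> card A = n}"
      by (rule bij_betw_imp_surj_on[OF bij_shifted_parts[OF n]])
    have S: "?S = {\<nu> \<in> shapes n r. b \<longrightarrow> 0 \<notin> shifted_parts n \<nu>}"
      unfolding zero_in_shifted_parts[OF n] ..
    have filter_image: "f ` {x \<in> X. P (f x)} = {y \<in> f ` X. P y}" for f :: "(nat \<Rightarrow> nat) \<Rightarrow> nat set" and X P
      by blast
    have "shifted_parts n ` ?S = {A \<in> shifted_parts n ` shapes n r. b \<longrightarrow> 0 \<notin> A}"
      unfolding S by (rule filter_image)
    then show "shifted_parts n ` ?S = ?A" unfolding img mem_Collect_eq .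
  qed (rule Collect_restrict)
  have "finite {A. A \<subseteq> {0..r + n - 1}}" by simp
  then have "finite ?A" by (rule rev_finite_subset) blast
  then have finS: "finite ?S" using bij_betw_finite[OF bij] by simp
  have full: "finite (full_tableaux n \<nu>) \<and> real (card (full_tableaux n \<nu>)) = ?W (shifted_parts n \<nu>)" if "\<nu> \<in> ?S" for \<nu>
  proof -
    have "\<nu> \<in> shapes n r" using that by blast
    then have "finite (full_tableaux n \<nu>) \<and> real (card (full_tableaux n \<nu>))
        = (if \<nu> (n - 1) = 0 then 2 ^ (n - 1) else 2 ^ n) * sq_vandermonde (shifted_parts n \<nu>) / (\<Prod>j<n. fact (2 * j))"
      unfolding shifted_parts_def by (intro card_full_tableaux n) (simp_all add: shapes_def)
    then show ?thesis unfolding zero_in_shifted_parts[OF n] .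
  qed
  have "real (card {T. even_sundaram_tableau n T \<and> height T \<le> n \<and> width T \<le> r \<and> (b \<longrightarrow> height T = n)})
      = (\<Sum>\<nu>\<in>?S. real (card (full_tableaux n \<nu>)))"
    by (rule card_Sigma_bij[OF bij_row_fun[OF n, of r b] finS, THEN conjunct2]) (rule full[THEN conjunct1])
  also have "\<dots> = (\<Sum>\<nu>\<in>?S. ?W (shifted_parts n \<nu>))" by (intro sum.cong refl full[THEN conjunct2])
  also have "\<dots> = (\<Sum>A\<in>?A. ?W A)" by (rule sum.reindex_bij_betw[OF bij, of ?W])
  finally show ?thesis .
qed

theorem theorem4p8:
  fixes n r :: nat
  assumes "n \<ge> 1" and "r \<ge> 1"
  shows "real (card {T. even_sundaram_tableau n T \<and> height T \<le> n \<and> width T \<le> r}) =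
           2 ^ (2 * n - 1) *
           ((pochhammer (real r / 2 + 1 / 2) n + pochhammer (real r / 2) n) / fact n) *
           (\<Prod>i = 1..n. \<Prod>j = 1..n - 1. (real i + real j + real r - 1) / (real i + real j))
       \<and> real (card {T. even_sundaram_tableau n T \<and> height T = n \<and> width T \<le> r}) =
           2 ^ (2 * n) *
           (pochhammer (real r / 2) n / fact n) *
           (\<Prod>i = 1..n. \<Prod>j = 1..n - 1. (real i + real j + real r - 1) / (real i + real j))"
proof -
  let ?M = "r + n - 1" and ?f = "\<Prod>j<n. fact (2 * j) :: real"
  let ?\<Pi> = "\<Prod>i = 1..n. \<Prod>j = 1..n - 1. (real i + real j + real r - 1) / (real i + real j)"
  let ?W = "\<lambda>A. (if 0 \<in> A then 2 ^ (n - 1) else 2 ^ n) * sq_vandermonde A / ?f"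
  let ?sub = "\<lambda>A. A \<subseteq> {0..?M} \<and> card A = n"
  define S0 S1 Z where "S0 = sq_vandermonde_sum 0 ?M n" and "S1 = sq_vandermonde_sum 1 ?M n"
    and "Z = (\<Sum>A | ?sub A \<and> 0 \<in> A. sq_vandermonde A)"
  have S1: "2 ^ n * S1 / ?f = 2 ^ (2 * n) * (pochhammer (real r / 2) n / fact n) * ?\<Pi>"
    using sq_vandermonde_sum_formula[of 1 1 r n] assms by (simp add: S1_def)
  have S0: "2 ^ n * S0 / ?f = 2 ^ (2 * n) * (pochhammer (real r / 2 + 1 / 2) n / fact n) * ?\<Pi>"
    using sq_vandermonde_sum_formula[of "-1" 0 r n] assms by (simp add: S0_def)
  have fin: "finite {A. A \<subseteq> {0..?M}}" by simp
  have no_zero: "(\<Sum>A | ?sub A \<and> 0 \<notin> A. sq_vandermonde A) = S1"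
  proof -
    have "{A. ?sub A \<and> 0 \<notin> A} = {A. A \<subseteq> {1..?M} \<and> card A = n}"
    proof (intro Collect_cong)
      fix A :: "nat set"
      have "{1..?M} = {0..?M} - {0}" by auto
      then have "A \<subseteq> {0..?M} \<and> 0 \<notin> A \<longleftrightarrow> A \<subseteq> {1..?M}" by blast
      then show "(?sub A \<and> 0 \<notin> A) = (A \<subseteq> {1..?M} \<and> card A = n)" by blast
    qed
    then show ?thesis by (simp add: S1_def sq_vandermonde_sum_def)
  qed
  have split: "sum G {A. ?sub A} = sum G {A. ?sub A \<and> 0 \<notin> A} + sum G {A. ?sub A \<and> 0 \<in> A}" for G :: "nat set \<Rightarrow> real"
  proof -
    have "finite {A. ?sub A \<and> 0 \<notin> A}" "finite {A. ?sub A \<and> 0 \<in> A}" by (rule rev_finite_subset[OF fin]; auto)+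
    then have "sum G ({A. ?sub A \<and> 0 \<notin> A} \<union> {A. ?sub A \<and> 0 \<in> A})
        = sum G {A. ?sub A \<and> 0 \<notin> A} + sum G {A. ?sub A \<and> 0 \<in> A}"
      by (rule sum.union_disjoint) blast
    moreover have "{A. ?sub A} = {A. ?sub A \<and> 0 \<notin> A} \<union> {A. ?sub A \<and> 0 \<in> A}" by blast
    ultimately show ?thesis by (simp only:)
  qed
  have W_out: "sum ?W {A. ?sub A \<and> 0 \<notin> A} = 2 ^ n * S1 / ?f"
    unfolding no_zero[symmetric] sum_distrib_left sum_divide_distrib by (rule sum.cong) simp_all
  have W_in: "sum ?W {A. ?sub A \<and> 0 \<in> A} = 2 ^ (n - 1) * Z / ?f"
    unfolding Z_def sum_distrib_left sum_divide_distrib by (rule sum.cong) simp_all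
  have S0_split: "S0 = S1 + Z"
    unfolding S0_def Z_def sq_vandermonde_sum_def no_zero[symmetric] by (rule split)
  \<comment> \<open>Sets containing 0 have half the weight, so the total is the mean of the sums over the two ranges.\<close>
  have two: "(2 :: real) ^ n = 2 * 2 ^ (n - 1)" "(2 :: real) ^ (2 * n) = 2 * 2 ^ (2 * n - 1)"
    using assms(1) by (simp_all flip: power_Suc)
  have "real (card {T. even_sundaram_tableau n T \<and> height T \<le> n \<and> width T \<le> r}) = sum ?W {A. ?sub A}"
    using card_sundaram_tableaux[OF assms(1), of r False] unfolding simp_thms .
  also have "\<dots> = 2 ^ n * S1 / ?f + 2 ^ (n - 1) * Z / ?f"
    unfolding split[of ?W] W_out W_in ..
  also have "\<dots> = (2 ^ n * S0 / ?f + 2 ^ n * S1 / ?f) / 2"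
  proof -
    have "2 * q * a / f + q * z / f = (2 * q * (a + z) / f + 2 * q * a / f) / 2" for q a z f :: real
      by (simp add: add_divide_distrib algebra_simps)
    then show ?thesis unfolding S0_split two(1) .
  qed
  also have "\<dots> = 2 ^ (2 * n - 1) * ((pochhammer (real r / 2 + 1 / 2) n + pochhammer (real r / 2) n) / fact n) * ?\<Pi>"
  proof -
    have "(2 * q * (a / c) * p + 2 * q * (b / c) * p) / 2 = q * ((a + b) / c) * p" for a b c p q :: real
      by (simp add: add_divide_distrib algebra_simps)
    then show ?thesis unfolding S0 S1 two(2) .
  qed
  finally have total: "real (card {T. even_sundaram_tableau n T \<and> height T \<le> n \<and> width T \<le> r})
      = 2 ^ (2 * n - 1) * ((pochhammer (real r / 2 + 1 / 2) n + pochhammer (real r / 2) n) / fact n) * ?\<Pi>" .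
  have "{T. even_sundaram_tableau n T \<and> height T = n \<and> width T \<le> r}
      = {T. even_sundaram_tableau n T \<and> height T \<le> n \<and> width T \<le> r \<and> height T = n}" by auto
  moreover have "real (card {T. even_sundaram_tableau n T \<and> height T \<le> n \<and> width T \<le> r \<and> height T = n})
      = sum ?W {A. ?sub A \<and> 0 \<notin> A}"
    using card_sundaram_tableaux[OF assms(1), of r True] unfolding simp_thms .
  ultimately have exact: "real (card {T. even_sundaram_tableau n T \<and> height T = n \<and> width T \<le> r}) = 2 ^ n * S1 / ?f"
    using W_out by (simp only:)
  show ?thesis by (rule conjI[OF total]) (simp only: exact S1)
qed

end
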